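(* Let $X=\mathbb Q_p$, $0<\alpha<1$, $(\alpha-1)/2\le\beta<\alpha$, $b=-\frac{\Gamma_p(\beta+1)}{\Gamma_p(\beta+1-\alpha)}$, $L=\mathfrak D^\alpha$, $H=\mathfrak D^\alpha+b\|x\|_p^{-\alpha}$, and let $g_H$ and $g_L$ be the Green functions of $H$ and $L$. The Green function $g_H(x,y)$ is a continuous function taking finite values off the diagonal set. Moreover, the following relationship holds: $$g_H(x,y)\asymp\frac{\|x\|_p^{\beta}\,\|x-y\|_p^{\alpha-1}\,\|y\|_p^{\beta}}{(\|x\|_p\vee\|y\|_p)^{2\beta}},$$ or equivalently, $$\frac{g_H(x,y)}{g_L(x,y)}\asymp\Big(\frac{\|x\|_p}{\|y\|_p}\wedge\frac{\|y\|_p}{\|x\|_p}\Big)^{\beta}.$$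
   Context: $\mathbb{Q}_p$ ($p$ prime) is the $p$-adic numbers with norm $\|\cdot\|_p$ and Haar measure $m$ normalized by $m(\mathbb Z_p)=1$. $\mathcal D$ is the set of locally constant functions with compact support. $\mathfrak D^{\alpha}$ is the Taibleson–Vladimirov operator in $L^2(\mathbb Q_p,m)$, i.e. the Fourier multiplier with symbol $\|\xi\|_p^\alpha$. $\Gamma_p(z)=(1-p^{z-1})(1-p^{-z})^{-1}$ is the $p$-adic Gamma-function. The sum $H=\mathfrak D^\alpha+b\|x\|_p^{-\alpha}$ is understood in the sense of quadratic forms; it is a self-adjoint and non-negative definite operator in $L^2(X,m)$. As $\beta$ runs over $[(\alpha-1)/2,\alpha)$, $b$ is a continuous increasing function of $\beta$ filling the whole range $[b_*,+\infty)$, where $b_*=-\{\Gamma_p((1+\alpha)/2)\}^2$. The Green function of $L=\mathfrak D^\alpha$ is $g_L(x,y)=\frac1{\Gamma_p(\alpha)}\|x-y\|_p^{\alpha-1}$. The Green function of $H$ (the fundamental solution of $Hu=v$) is $$g_H(x,y)=h(x)\,g_{\mathcal L}(x,y)\,h(y),\qquad h(x)=\|x\|_p^\beta,$$ where $g_{\mathcal L}$ is defined as follows. Let $hm$ be the measure with density $h$ with respect to $m$, $J(x,y)=-\frac1{\Gamma_p(-\alpha)}\|x-y\|_p^{-1-\alpha}$, and let $\mathcal L$ be the (essentially self-adjoint, non-negative) operator in $L^2(X,hm)$ given on $\mathcal D$ by $\mathcal Lu(x)=\int_X(u(x)-u(y))J(x,y)h(y)\,dm(y)$. For $\lambda>0$,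 the resolvent $(\mathcal L+\lambda\mathrm I)^{-1}$ has an integral kernel $g_{\mathcal L}(\lambda,x,y)$ with respect to $hm$, continuous, finite off the diagonal and decreasing in $\lambda$; then $g_{\mathcal L}(x,y)=\lim_{\lambda\to0}g_{\mathcal L}(\lambda,x,y)$ (finite or infinite). The sign $\asymp$ means that the ratio of the left- and right-hand sides is bounded from below and above by positive constants. $a\vee b=\max\{a,b\}$, $a\wedge b=\min\{a,b\}$.
   Formalization: At β=(α−1)/2 the limit defining g_𝓛 is infinite and the claim fails; requiring g_H to be a fundamental solution excludes it. For β<0 finiteness needs x,y≠0, as h(0)=∞. Continuity is claimed away from (0,0), the relations for x,y≠0, x≠y. *)

theory Defs
  imports "HOL-Analysis.Analysis" "Berlekamp_Zassenhaus.Finite_Field"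
begin

section \<open>The \<open>p\<close>-adic absolute value on the rationals\<close>

definition padic_abs :: "nat \<Rightarrow> rat \<Rightarrow> real" where
  "padic_abs p r = (if r = 0 then 0
     else real p powi (int (multiplicity (int p) (snd (quotient_of r)))
                       - int (multiplicity (int p) (fst (quotient_of r)))))"

lemma padic_abs_0 [simp]: "padic_abs p 0 = 0"
  by (simp add: padic_abs_def)

context
  fixes p :: nat
  assumes p: "prime p"
begin

lemma padic_abs_fract:
  assumes "a \<noteq> 0" "b \<noteq> 0"
  shows "padic_abs p (of_int a / of_int b)
         = real p powi (int (multiplicity (int p) b) - int (multiplicity (int p) a))"
proof -
  let ?r = "of_int a / of_int b :: rat"
  obtain c d where cd: "quotient_of ?r = (c, d)" by fastforce
  have d: "d > 0" using cd quotient_of_denom_pos by blast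
  have r: "?r = of_int c / of_int d" using cd quotient_of_div by blast
  have "?r \<noteq> 0" using assms by simp
  then have c: "c \<noteq> 0" using r by auto
  have "of_int (a * d) = (of_int (c * b) :: rat)"
    using r assms d by (simp add: field_simps)
  then have eq: "a * d = c * b" by (simp only: of_int_eq_iff)
  have pe: "prime_elem (int p)" using p by auto
  have "multiplicity (int p) (a * d) = multiplicity (int p) a + multiplicity (int p) d"
    "multiplicity (int p) (c * b) = multiplicity (int p) c + multiplicity (int p) b"
    using pe assms c d by (auto intro!: prime_elem_multiplicity_mult_distrib)
  with eq have "multiplicity (int p) a + multiplicity (int p) d
      = multiplicity (int p) c + multiplicity (int p) b" by simp
  then have "int (multiplicity (int p) d) - int (multiplicity (int p) c)
      = int (multiplicity (int p) b) - int (multiplicity (int p) a)" by linarith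
  then show ?thesis using \<open>?r \<noteq> 0\<close> cd by (simp add: padic_abs_def)
qed

lemma rat_fract_cases:
  fixes r :: rat
  assumes "r \<noteq> 0"
  obtains a b :: int where "r = of_int a / of_int b" "a \<noteq> 0" "b \<noteq> 0"
proof -
  obtain a b where ab: "quotient_of r = (a, b)" by fastforce
  then have "r = of_int a / of_int b" "b > 0"
    using quotient_of_div quotient_of_denom_pos by blast+
  with assms that[of a b] show thesis by auto
qed

lemma padic_abs_pos: "r \<noteq> 0 \<Longrightarrow> padic_abs p r > 0"
  using prime_gt_0_nat[OF p] by (auto simp: padic_abs_def)

lemma padic_abs_nonneg [simp]: "padic_abs p r \<ge> 0"
  using padic_abs_pos[of r] by (cases "r = 0") auto

lemma padic_abs_eq_0_iff [simp]: "padic_abs p r = 0 \<longleftrightarrow> r = 0"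
  using padic_abs_pos[of r] by fastforce

lemma padic_abs_mult: "padic_abs p (r * s) = padic_abs p r * padic_abs p s"
proof (cases "r = 0 \<or> s = 0")
  case False
  obtain a b where ab: "r = of_int a / of_int b" "a \<noteq> 0" "b \<noteq> 0"
    using rat_fract_cases[of r] False by blast
  obtain c d where cd: "s = of_int c / of_int d" "c \<noteq> 0" "d \<noteq> 0"
    using rat_fract_cases[of s] False by blast
  have rs: "r * s = of_int (a * c) / of_int (b * d)" using ab cd by simp
  have pe: "prime_elem (int p)" using p by auto
  have m: "multiplicity (int p) (a * c) = multiplicity (int p) a + multiplicity (int p) c"
    "multiplicity (int p) (b * d) = multiplicity (int p) b + multiplicity (int p) d"
    using pe ab cd by (auto intro!: prime_elem_multiplicity_mult_distrib)
  have "real p \<noteq> 0" using prime_gt_0_nat[OF p] by simp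
  then show ?thesis
    unfolding rs unfolding ab(1) cd(1) using ab cd m
    by (simp only: padic_abs_fract mult_eq_0_iff power_int_add[symmetric] simp_thms)
       (simp add: algebra_simps power_int_add[symmetric])
qed auto

lemma padic_abs_1 [simp]: "padic_abs p 1 = 1"
  using padic_abs_fract[of 1 1] by simp

lemma padic_abs_minus [simp]: "padic_abs p (- r) = padic_abs p r"
proof (cases "r = 0")
  case False
  then obtain a b where ab: "r = of_int a / of_int b" "a \<noteq> 0" "b \<noteq> 0"
    using rat_fract_cases[of r] by blast
  then have "- r = of_int (- a) / of_int b" by simp
  moreover have "multiplicity (int p) (- a) = multiplicity (int p) a"
    by (metis abs_minus_cancel multiplicity_normalize_right normalize_int_def)
  ultimately show ?thesis
    using ab padic_abs_fract[of "- a" b] padic_abs_fract[of a b] by simp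
qed simp

lemma padic_abs_inverse: "padic_abs p (inverse r) = inverse (padic_abs p r)"
proof (cases "r = 0")
  case False
  then have "padic_abs p r * padic_abs p (inverse r) = 1"
    by (simp flip: padic_abs_mult)
  then show ?thesis by (simp add: inverse_unique)
qed simp

lemma padic_abs_ultra: "padic_abs p (r + s) \<le> max (padic_abs p r) (padic_abs p s)"
proof (cases "r = 0 \<or> s = 0 \<or> r + s = 0")
  case False
  obtain a b where ab: "r = of_int a / of_int b" "a \<noteq> 0" "b \<noteq> 0"
    using rat_fract_cases[of r] False by blast
  obtain c d where cd: "s = of_int c / of_int d" "c \<noteq> 0" "d \<noteq> 0"
    using rat_fract_cases[of s] False by blast
  let ?A = "a * d" and ?C = "c * b" and ?D = "b * d"
  let ?v = "multiplicity (int p)"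
  have r: "r = of_int ?A / of_int ?D" and s: "s = of_int ?C / of_int ?D"
    using ab cd by (auto simp: field_simps)
  have rs: "r + s = of_int (?A + ?C) / of_int ?D"
    unfolding r s by (simp add: add_divide_distrib)
  have "?A + ?C \<noteq> 0"
  proof
    assume "?A + ?C = 0"
    then have "r + s = 0" unfolding rs by (simp only: of_int_0 div_0)
    with False show False by blast
  qed
  then have nz: "?A \<noteq> 0" "?C \<noteq> 0" "?D \<noteq> 0" "?A + ?C \<noteq> 0"
    using ab cd by auto
  have nu: "\<not> is_unit (int p)" using p not_prime_unit by fastforce
  have "int p ^ min (?v ?A) (?v ?C) dvd ?A + ?C"
    by (intro dvd_add multiplicity_dvd') auto
  then have v: "min (?v ?A) (?v ?C) \<le> ?v (?A + ?C)"
    using nu nz by (intro multiplicity_geI) auto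
  have p1: "1 \<le> real p" using prime_ge_1_nat[OF p] by simp
  have E: "padic_abs p r = real p powi (int (?v ?D) - int (?v ?A))"
    "padic_abs p s = real p powi (int (?v ?D) - int (?v ?C))"
    "padic_abs p (r + s) = real p powi (int (?v ?D) - int (?v (?A + ?C)))"
    unfolding rs unfolding r s
    by (rule padic_abs_fract[OF nz(1) nz(3)] padic_abs_fract[OF nz(2) nz(3)]
          padic_abs_fract[OF nz(4) nz(3)])+
  show ?thesis
  proof (cases "?v ?A \<le> ?v ?C")
    case True
    then have "padic_abs p (r + s) \<le> padic_abs p r"
      unfolding E using v p1 by (intro power_int_increasing) auto
    then show ?thesis by simp
  next
    case False
    then have "padic_abs p (r + s) \<le> padic_abs p s"
      unfolding E using v p1 by (intro power_int_increasing) auto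
    then show ?thesis by simp
  qed
qed (auto simp: le_max_iff_disj)

lemma padic_abs_triangle: "padic_abs p (r + s) \<le> padic_abs p r + padic_abs p s"
  using padic_abs_ultra[of r s] padic_abs_nonneg[of r] padic_abs_nonneg[of s] by linarith

lemma padic_abs_diff_commute: "padic_abs p (r - s) = padic_abs p (s - r)"
  using padic_abs_minus[of "r - s"] by simp

lemma padic_abs_triangle3: "\<bar>padic_abs p r - padic_abs p s\<bar> \<le> padic_abs p (r - s)"
  using padic_abs_triangle[of "r - s" s] padic_abs_triangle[of "s - r" r]
    padic_abs_diff_commute[of r s] by simp

end


section \<open>The field \<open>\<rat>\<^sub>p\<close> as the completion of \<open>\<rat>\<close>\<close>

definition padic_Cauchy :: "nat \<Rightarrow> (nat \<Rightarrow> rat) \<Rightarrow> bool" where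
  "padic_Cauchy p X \<longleftrightarrow> (\<forall>e>0. \<exists>N. \<forall>m\<ge>N. \<forall>n\<ge>N. padic_abs p (X m - X n) < e)"

definition padic_null :: "nat \<Rightarrow> (nat \<Rightarrow> rat) \<Rightarrow> bool" where
  "padic_null p X \<longleftrightarrow> (\<lambda>n. padic_abs p (X n)) \<longlonglongrightarrow> 0"

context
  fixes p :: nat
  assumes p: "prime p"
begin

lemma padic_null_mono:
  assumes "padic_null p Y" "\<And>n. padic_abs p (X n) \<le> C * padic_abs p (Y n)"
  shows "padic_null p X"
  unfolding padic_null_def
proof (rule tendsto_sandwich[where f = "\<lambda>_. 0" and h = "\<lambda>n. C * padic_abs p (Y n)"])
  show "(\<lambda>n. C * padic_abs p (Y n)) \<longlonglongrightarrow> 0"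
    using tendsto_mult_right_zero assms(1) unfolding padic_null_def by blast
qed (use assms p in auto)

lemma padic_null_zero [simp]: "padic_null p (\<lambda>_. 0)"
  by (simp add: padic_null_def)

lemma padic_null_minus: "padic_null p X \<Longrightarrow> padic_null p (\<lambda>n. - X n)"
  by (simp add: padic_null_def p)

lemma padic_null_add:
  assumes "padic_null p X" "padic_null p Y"
  shows "padic_null p (\<lambda>n. X n + Y n)"
  unfolding padic_null_def
proof (rule tendsto_sandwich[where f = "\<lambda>_. 0" and h = "\<lambda>n. padic_abs p (X n) + padic_abs p (Y n)"])
  show "(\<lambda>n. padic_abs p (X n) + padic_abs p (Y n)) \<longlonglongrightarrow> 0"
    using tendsto_add_zero assms unfolding padic_null_def by blast
qed (use p padic_abs_triangle[OF p] in auto)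

lemma padic_Cauchy_const [simp]: "padic_Cauchy p (\<lambda>_. r)"
  by (simp add: padic_Cauchy_def p)

lemma padic_Cauchy_add:
  assumes "padic_Cauchy p X" "padic_Cauchy p Y"
  shows "padic_Cauchy p (\<lambda>n. X n + Y n)"
  unfolding padic_Cauchy_def
proof (intro allI impI)
  fix e :: real assume e: "e > 0"
  obtain N M where N: "\<And>m n. m \<ge> N \<Longrightarrow> n \<ge> N \<Longrightarrow> padic_abs p (X m - X n) < e"
    and M: "\<And>m n. m \<ge> M \<Longrightarrow> n \<ge> M \<Longrightarrow> padic_abs p (Y m - Y n) < e"
    using assms e unfolding padic_Cauchy_def by metis
  have "padic_abs p (X m + Y m - (X n + Y n)) < e" if "m \<ge> max N M" "n \<ge> max N M" for m n
    using padic_abs_ultra[OF p, of "X m - X n" "Y m - Y n"] N[of m n] M[of m n] that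
    by (simp add: algebra_simps)
  then show "\<exists>N. \<forall>m\<ge>N. \<forall>n\<ge>N. padic_abs p (X m + Y m - (X n + Y n)) < e" by blast
qed

lemma padic_Cauchy_minus: "padic_Cauchy p X \<Longrightarrow> padic_Cauchy p (\<lambda>n. - X n)"
  by (simp add: padic_Cauchy_def padic_abs_diff_commute[OF p] minus_diff_commute)

lemma padic_Cauchy_norm:
  assumes "padic_Cauchy p X"
  shows "convergent (\<lambda>n. padic_abs p (X n))"
proof -
  have "Cauchy (\<lambda>n. padic_abs p (X n))"
    unfolding Cauchy_def dist_real_def
    using assms padic_abs_triangle3[OF p] unfolding padic_Cauchy_def by (meson le_less_trans)
  then show ?thesis by (rule real_Cauchy_convergent)
qed

lemma padic_Cauchy_bounded:
  assumes "padic_Cauchy p X"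
  obtains B where "B > 0" "\<And>n. padic_abs p (X n) \<le> B"
proof -
  have "Bseq (\<lambda>n. padic_abs p (X n))"
    using padic_Cauchy_norm[OF assms] by (rule convergent_imp_Bseq)
  then show thesis using that unfolding Bseq_def by (auto simp: p)
qed

lemma padic_Cauchy_mult:
  assumes X: "padic_Cauchy p X" and Y: "padic_Cauchy p Y"
  shows "padic_Cauchy p (\<lambda>n. X n * Y n)"
  unfolding padic_Cauchy_def
proof (intro allI impI)
  fix e :: real assume e: "e > 0"
  obtain A where A: "A > 0" "\<And>n. padic_abs p (X n) \<le> A" using padic_Cauchy_bounded[OF X] by blast
  obtain B where B: "B > 0" "\<And>n. padic_abs p (Y n) \<le> B" using padic_Cauchy_bounded[OF Y] by blast
  obtain N where N: "\<And>m n. m \<ge> N \<Longrightarrow> n \<ge> N \<Longrightarrow> padic_abs p (X m - X n) < e / B"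
    using X e B unfolding padic_Cauchy_def by (metis divide_pos_pos)
  obtain M where M: "\<And>m n. m \<ge> M \<Longrightarrow> n \<ge> M \<Longrightarrow> padic_abs p (Y m - Y n) < e / A"
    using Y e A unfolding padic_Cauchy_def by (metis divide_pos_pos)
  have "padic_abs p (X m * Y m - X n * Y n) < e" if mn: "m \<ge> max N M" "n \<ge> max N M" for m n
  proof -
    have eq: "X m * Y m - X n * Y n = X m * (Y m - Y n) + (X m - X n) * Y n"
      by (simp add: algebra_simps)
    have "padic_abs p (X m * (Y m - Y n)) \<le> A * padic_abs p (Y m - Y n)"
      unfolding padic_abs_mult[OF p] using A p by (intro mult_right_mono) auto
    also have "\<dots> < e" using M[of m n] mn A by (simp add: field_simps)
    finally have 1: "padic_abs p (X m * (Y m - Y n)) < e" .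
    have "padic_abs p ((X m - X n) * Y n) \<le> padic_abs p (X m - X n) * B"
      unfolding padic_abs_mult[OF p] using B p by (intro mult_left_mono) auto
    also have "\<dots> < e" using N[of m n] mn B by (simp add: field_simps)
    finally have 2: "padic_abs p ((X m - X n) * Y n) < e" .
    show ?thesis
      unfolding eq using padic_abs_ultra[OF p, of "X m * (Y m - Y n)" "(X m - X n) * Y n"] 1 2
      by linarith
  qed
  then show "\<exists>N. \<forall>m\<ge>N. \<forall>n\<ge>N. padic_abs p (X m * Y m - X n * Y n) < e" by blast
qed

lemma padic_null_mult_bounded:
  assumes "padic_Cauchy p X" "padic_null p Y"
  shows "padic_null p (\<lambda>n. X n * Y n)"
proof -
  obtain A where A: "A > 0" "\<And>n. padic_abs p (X n) \<le> A" using padic_Cauchy_bounded[OF assms(1)] by blast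
  show ?thesis
    by (rule padic_null_mono[OF assms(2), of _ A])
       (use A p in \<open>auto simp: padic_abs_mult intro!: mult_right_mono\<close>)
qed

lemma padic_Cauchy_away:
  assumes "padic_Cauchy p X" "\<not> padic_null p X"
  obtains c N where "c > 0" "\<And>n. n \<ge> N \<Longrightarrow> c \<le> padic_abs p (X n)"
proof -
  obtain l where l: "(\<lambda>n. padic_abs p (X n)) \<longlonglongrightarrow> l"
    using padic_Cauchy_norm[OF assms(1)] unfolding convergent_def by blast
  have "l \<ge> 0" using l by (rule LIMSEQ_le_const) (auto simp: p)
  moreover have "l \<noteq> 0" using l assms(2) unfolding padic_null_def by blast
  ultimately have "l / 2 > 0" "l / 2 < l" by auto
  then have "\<forall>\<^sub>F n in sequentially. l / 2 < padic_abs p (X n)"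
    using order_tendstoD(1)[OF l] by blast
  then show thesis
    using that[OF \<open>l / 2 > 0\<close>] unfolding eventually_sequentially by (meson less_imp_le)
qed

lemma padic_null_diff_inverse:
  assumes X: "padic_Cauchy p X" "\<not> padic_null p X"
    and Y: "padic_Cauchy p Y" "\<not> padic_null p Y"
    and XY: "padic_null p (\<lambda>n. X n - Y n)"
  shows "padic_null p (\<lambda>n. inverse (X n) - inverse (Y n))"
proof -
  obtain c N where c: "c > 0" "\<And>n. n \<ge> N \<Longrightarrow> c \<le> padic_abs p (X n)"
    using padic_Cauchy_away[OF X] by blast
  obtain d M where d: "d > 0" "\<And>n. n \<ge> M \<Longrightarrow> d \<le> padic_abs p (Y n)"
    using padic_Cauchy_away[OF Y] by blast
  have le: "padic_abs p (inverse (X n) - inverse (Y n)) \<le> padic_abs p (X n - Y n) / (c * d)"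
    if "n \<ge> max N M" for n
  proof -
    have cd: "c \<le> padic_abs p (X n)" "d \<le> padic_abs p (Y n)" using c d that by auto
    then have "X n \<noteq> 0" "Y n \<noteq> 0" using c d by auto
    then have "inverse (X n) - inverse (Y n) = (Y n - X n) * (inverse (X n) * inverse (Y n))"
      by (simp add: field_simps)
    then have "padic_abs p (inverse (X n) - inverse (Y n))
        = padic_abs p (X n - Y n) / (padic_abs p (X n) * padic_abs p (Y n))"
      by (simp add: padic_abs_mult[OF p] padic_abs_inverse[OF p]
          padic_abs_diff_commute[OF p, of "Y n"] divide_inverse)
    also have "\<dots> \<le> padic_abs p (X n - Y n) / (c * d)"
      using cd c d p by (intro divide_left_mono mult_mono mult_pos_pos) auto
    finally show ?thesis .
  qed
  show ?thesis
    unfolding padic_null_def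
  proof (rule tendsto_sandwich[where f = "\<lambda>_. 0" and h = "\<lambda>n. padic_abs p (X n - Y n) / (c * d)"])
    show "(\<lambda>n. padic_abs p (X n - Y n) / (c * d)) \<longlonglongrightarrow> 0"
      using tendsto_divide[OF XY[unfolded padic_null_def] tendsto_const, of "c * d"] c d by simp
    show "\<forall>\<^sub>F n in sequentially.
        padic_abs p (inverse (X n) - inverse (Y n)) \<le> padic_abs p (X n - Y n) / (c * d)"
      using le unfolding eventually_sequentially by blast
  qed (use p in auto)
qed

lemma padic_Cauchy_inverse:
  assumes X: "padic_Cauchy p X" "\<not> padic_null p X"
  shows "padic_Cauchy p (\<lambda>n. inverse (X n))"
  unfolding padic_Cauchy_def
proof (intro allI impI)
  fix e :: real assume e: "e > 0"
  obtain c N where c: "c > 0" "\<And>n. n \<ge> N \<Longrightarrow> c \<le> padic_abs p (X n)"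
    using padic_Cauchy_away[OF X] by blast
  have "e * (c * c) > 0" using e c by simp
  then obtain M where M: "\<And>m n. m \<ge> M \<Longrightarrow> n \<ge> M \<Longrightarrow> padic_abs p (X m - X n) < e * (c * c)"
    using X unfolding padic_Cauchy_def by metis
  have "padic_abs p (inverse (X m) - inverse (X n)) < e" if "m \<ge> max N M" "n \<ge> max N M" for m n
  proof -
    have cd: "c \<le> padic_abs p (X m)" "c \<le> padic_abs p (X n)" using c that by auto
    then have "X m \<noteq> 0" "X n \<noteq> 0" using c by auto
    then have "inverse (X m) - inverse (X n) = (X n - X m) * (inverse (X m) * inverse (X n))"
      by (simp add: field_simps)
    then have "padic_abs p (inverse (X m) - inverse (X n))
        = padic_abs p (X m - X n) / (padic_abs p (X m) * padic_abs p (X n))"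
      by (simp add: padic_abs_mult[OF p] padic_abs_inverse[OF p]
          padic_abs_diff_commute[OF p, of "X n"] divide_inverse)
    also have "\<dots> \<le> padic_abs p (X m - X n) / (c * c)"
      using cd c p by (intro divide_left_mono mult_mono mult_pos_pos) auto
    also have "\<dots> < e" using M[of m n] that c by (simp add: divide_less_eq)
    finally show ?thesis .
  qed
  then show "\<exists>N. \<forall>m\<ge>N. \<forall>n\<ge>N. padic_abs p (inverse (X m) - inverse (X n)) < e" by blast
qed

end

definition padic_rel :: "'p::prime_card itself \<Rightarrow> (nat \<Rightarrow> rat) \<Rightarrow> (nat \<Rightarrow> rat) \<Rightarrow> bool" where
  "padic_rel _ X Y \<longleftrightarrow> padic_Cauchy CARD('p) X \<and> padic_Cauchy CARD('p) Y
     \<and> padic_null CARD('p) (\<lambda>n. X n - Y n)"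

lemma part_equivp_padic_rel: "part_equivp (padic_rel TYPE('p::prime_card))"
proof (rule part_equivpI)
  note p = prime_card[where ?'a = 'p]
  show "\<exists>X. padic_rel TYPE('p) X X"
    by (rule exI[of _ "\<lambda>_. 0"]) (simp add: padic_rel_def p)
  show "symp (padic_rel TYPE('p))"
  proof (rule sympI)
    fix X Y assume "padic_rel TYPE('p) X Y"
    then show "padic_rel TYPE('p) Y X"
      using padic_null_minus[OF p, of "\<lambda>n. X n - Y n"] by (simp add: padic_rel_def)
  qed
  show "transp (padic_rel TYPE('p))"
  proof (rule transpI)
    fix X Y Z assume "padic_rel TYPE('p) X Y" "padic_rel TYPE('p) Y Z"
    then show "padic_rel TYPE('p) X Z"
      using padic_null_add[OF p, of "\<lambda>n. X n - Y n" "\<lambda>n. Y n - Z n"]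
      by (simp add: padic_rel_def)
  qed
qed

text \<open>\<open>\<rat>\<^sub>p\<close> for \<open>p = CARD('p)\<close>; every prime is the cardinality of some type of class
  \<^class>\<open>prime_card\<close>.\<close>

typedef (overloaded) ('p::prime_card) padic =
    "{c. \<exists>X. padic_rel TYPE('p) X X \<and> c = Collect (padic_rel TYPE('p) X)}"
  morphisms padic_class Abs_padic
proof -
  have "padic_rel TYPE('p) (\<lambda>_. 0) (\<lambda>_. 0)"
    by (simp add: padic_rel_def prime_card)
  then show ?thesis by blast
qed

definition abs_padic :: "(nat \<Rightarrow> rat) \<Rightarrow> 'p::prime_card padic" where
  "abs_padic X = Abs_padic (Collect (padic_rel TYPE('p) X))"

definition rep_padic :: "'p::prime_card padic \<Rightarrow> nat \<Rightarrow> rat" where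
  "rep_padic x = (SOME X. X \<in> padic_class x)"

lemma abs_padic_eq_iff_rel:
  assumes "padic_rel TYPE('p::prime_card) X X" "padic_rel TYPE('p) Y Y"
  shows "(abs_padic X :: 'p padic) = abs_padic Y \<longleftrightarrow> padic_rel TYPE('p) X Y"
proof -
  have "(abs_padic X :: 'p padic) = abs_padic Y
      \<longleftrightarrow> Collect (padic_rel TYPE('p) X) = Collect (padic_rel TYPE('p) Y)"
    unfolding abs_padic_def using assms by (subst Abs_padic_inject) auto
  also have "\<dots> \<longleftrightarrow> padic_rel TYPE('p) X Y"
    using assms part_equivp_padic_rel[where ?'p = 'p] unfolding part_equivp_def
    by (metis mem_Collect_eq)
  finally show ?thesis .
qed

lemma abs_rep_padic:
  fixes x :: "'p::prime_card padic"
  shows "padic_rel TYPE('p) (rep_padic x) (rep_padic x) \<and> abs_padic (rep_padic x) = x"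
proof -
  obtain X where X: "padic_rel TYPE('p) X X" "padic_class x = Collect (padic_rel TYPE('p) X)"
    using padic_class[of x] by blast
  have "X \<in> padic_class x" using X by simp
  then have "rep_padic x \<in> padic_class x"
    unfolding rep_padic_def by (rule someI[where P = "\<lambda>X. X \<in> padic_class x"])
  then have r: "padic_rel TYPE('p) X (rep_padic x)" using X by simp
  then have rr: "padic_rel TYPE('p) (rep_padic x) (rep_padic x)"
    by (simp add: padic_rel_def prime_card)
  have "abs_padic X = x"
    unfolding abs_padic_def X(2)[symmetric] by (rule padic_class_inverse)
  moreover have "(abs_padic X :: 'p padic) = abs_padic (rep_padic x)"
    using abs_padic_eq_iff_rel[OF X(1) rr] r by blast
  ultimately show ?thesis using rr by metis
qed

lemma rep_padic_Cauchy [simp]: "padic_Cauchy CARD('p) (rep_padic (x :: 'p::prime_card padic))"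
  using abs_rep_padic[of x] by (simp add: padic_rel_def)

lemma abs_rep_padic_eq [simp]: "abs_padic (rep_padic x) = x"
  using abs_rep_padic[of x] by (rule conjunct2)

lemma abs_padic_eq_iff:
  "padic_Cauchy CARD('p) X \<Longrightarrow> padic_Cauchy CARD('p) Y \<Longrightarrow>
     (abs_padic X :: 'p::prime_card padic) = abs_padic Y
       \<longleftrightarrow> padic_null CARD('p) (\<lambda>n. X n - Y n)"
  by (subst abs_padic_eq_iff_rel) (auto simp: padic_rel_def prime_card)

lemma padic_null_rep_abs:
  assumes "padic_Cauchy CARD('p) X"
  shows "padic_null CARD('p) (\<lambda>n. rep_padic (abs_padic X :: 'p::prime_card padic) n - X n)"
  by (rule iffD1[OF abs_padic_eq_iff[OF rep_padic_Cauchy assms] abs_rep_padic_eq])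

lemma padic_cases:
  obtains X where "padic_Cauchy CARD('p) X" "x = (abs_padic X :: 'p::prime_card padic)"
  using that[of "rep_padic x"] by simp

instantiation padic :: (prime_card) "{zero, one, plus, uminus, minus, times, inverse}"
begin

definition zero_padic :: "'a padic" where "zero_padic = abs_padic (\<lambda>_. 0)"

definition one_padic :: "'a padic" where "one_padic = abs_padic (\<lambda>_. 1)"

definition plus_padic :: "'a padic \<Rightarrow> 'a padic \<Rightarrow> 'a padic" where
  "x + y = abs_padic (\<lambda>n. rep_padic x n + rep_padic y n)"

definition uminus_padic :: "'a padic \<Rightarrow> 'a padic" where
  "- x = abs_padic (\<lambda>n. - rep_padic x n)"

definition minus_padic :: "'a padic \<Rightarrow> 'a padic \<Rightarrow> 'a padic" where
  "x - y = x + - (y :: 'a padic)"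

definition times_padic :: "'a padic \<Rightarrow> 'a padic \<Rightarrow> 'a padic" where
  "x * y = abs_padic (\<lambda>n. rep_padic x n * rep_padic y n)"

definition inverse_padic :: "'a padic \<Rightarrow> 'a padic" where
  "inverse x = (if x = 0 then 0 else abs_padic (\<lambda>n. inverse (rep_padic x n)))"

definition divide_padic :: "'a padic \<Rightarrow> 'a padic \<Rightarrow> 'a padic" where
  "x div y = x * inverse (y :: 'a padic)"

instance ..

end

lemma abs_padic_add:
  assumes X: "padic_Cauchy CARD('p) X" and Y: "padic_Cauchy CARD('p) Y"
  shows "(abs_padic X :: 'p::prime_card padic) + abs_padic Y = abs_padic (\<lambda>n. X n + Y n)"
  unfolding plus_padic_def
proof (subst abs_padic_eq_iff)
  note p = prime_card[where ?'a = 'p]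
  show "padic_null CARD('p) (\<lambda>n. rep_padic (abs_padic X :: 'p padic) n
      + rep_padic (abs_padic Y :: 'p padic) n - (X n + Y n))"
    using padic_null_add[OF p padic_null_rep_abs[OF X] padic_null_rep_abs[OF Y]]
    by (simp add: algebra_simps)
qed (use X Y in \<open>simp_all add: padic_Cauchy_add prime_card\<close>)

lemma abs_padic_minus:
  assumes X: "padic_Cauchy CARD('p) X"
  shows "- (abs_padic X :: 'p::prime_card padic) = abs_padic (\<lambda>n. - X n)"
  unfolding uminus_padic_def
proof (subst abs_padic_eq_iff)
  note p = prime_card[where ?'a = 'p]
  show "padic_null CARD('p) (\<lambda>n. - rep_padic (abs_padic X :: 'p padic) n - - X n)"
    using padic_null_minus[OF p padic_null_rep_abs[OF X]] by (simp add: algebra_simps)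
qed (use X in \<open>simp_all add: padic_Cauchy_minus prime_card\<close>)

lemma abs_padic_mult:
  assumes X: "padic_Cauchy CARD('p) X" and Y: "padic_Cauchy CARD('p) Y"
  shows "(abs_padic X :: 'p::prime_card padic) * abs_padic Y = abs_padic (\<lambda>n. X n * Y n)"
  unfolding times_padic_def
proof (subst abs_padic_eq_iff)
  note p = prime_card[where ?'a = 'p]
  let ?X = "rep_padic (abs_padic X :: 'p padic)" and ?Y = "rep_padic (abs_padic Y :: 'p padic)"
  have "padic_null CARD('p) (\<lambda>n. ?X n * (?Y n - Y n) + Y n * (?X n - X n))"
    using Y by (intro padic_null_add[OF p] padic_null_mult_bounded[OF p]
        padic_null_rep_abs[OF X] padic_null_rep_abs[OF Y]) simp_all
  then show "padic_null CARD('p) (\<lambda>n. ?X n * ?Y n - X n * Y n)"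
    by (simp add: algebra_simps)
qed (use X Y in \<open>simp_all add: padic_Cauchy_mult prime_card\<close>)

lemma abs_padic_eq_0_iff:
  "padic_Cauchy CARD('p) X \<Longrightarrow>
     (abs_padic X :: 'p::prime_card padic) = 0 \<longleftrightarrow> padic_null CARD('p) X"
  unfolding zero_padic_def by (subst abs_padic_eq_iff) (auto simp: prime_card)

instance padic :: (prime_card) field
proof
  fix a b c :: "'a padic"
  note p = prime_card[where ?'a = 'a]
  obtain A where A: "padic_Cauchy CARD('a) A" "a = abs_padic A" by (rule padic_cases)
  obtain B where B: "padic_Cauchy CARD('a) B" "b = abs_padic B" by (rule padic_cases)
  obtain C where C: "padic_Cauchy CARD('a) C" "c = abs_padic C" by (rule padic_cases)
  note ops = A B C abs_padic_add abs_padic_mult abs_padic_minus p padic_Cauchy_add[OF p]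
    padic_Cauchy_mult[OF p] padic_Cauchy_minus[OF p] zero_padic_def one_padic_def
    padic_Cauchy_const[OF p]
  show "a + b = b + a" by (simp add: ops add.commute)
  show "(a + b) + c = a + (b + c)" by (simp add: ops add.assoc)
  show "0 + a = a" by (simp add: ops)
  show "- a + a = 0" by (simp add: ops)
  show "a - b = a + - b" by (rule minus_padic_def)
  show "(a * b) * c = a * (b * c)" by (simp add: ops mult.assoc)
  show "a * b = b * a" by (simp add: ops mult.commute)
  show "1 * a = a" by (simp add: ops)
  show "(a + b) * c = a * c + b * c" by (simp add: ops distrib_right)
  have "\<not> padic_null CARD('a) (\<lambda>_. 1)"
    by (simp add: padic_null_def p tendsto_const_iff)
  then show "(0 :: 'a padic) \<noteq> 1"
    using abs_padic_eq_0_iff[of "\<lambda>_. 1", where ?'p = 'a] p by (simp add: one_padic_def)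
  show "inverse a * a = 1" if "a \<noteq> 0"
  proof -
    let ?A = "rep_padic a"
    have nn: "\<not> padic_null CARD('a) ?A"
      using that abs_padic_eq_0_iff[of ?A, where ?'p = 'a] by simp
    obtain d N where d: "d > 0" "\<And>n. n \<ge> N \<Longrightarrow> d \<le> padic_abs CARD('a) (?A n)"
      using padic_Cauchy_away[OF p rep_padic_Cauchy nn] by blast
    have z: "padic_abs CARD('a) (inverse (?A n) * ?A n - 1) = 0" if "n \<ge> N" for n
    proof -
      have "?A n \<noteq> 0" using d(1) d(2)[OF that] p by auto
      then show ?thesis by (simp add: p)
    qed
    then have null: "padic_null CARD('a) (\<lambda>n. inverse (?A n) * ?A n - 1)"
      unfolding padic_null_def
      by (intro tendsto_eventually) (auto simp: eventually_sequentially)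
    have Ci: "padic_Cauchy CARD('a) (\<lambda>n. inverse (?A n))"
      by (rule padic_Cauchy_inverse[OF p rep_padic_Cauchy nn])
    have "inverse a * a = abs_padic (\<lambda>n. inverse (?A n)) * abs_padic ?A"
      using that by (simp add: inverse_padic_def)
    also have "\<dots> = abs_padic (\<lambda>n. inverse (?A n) * ?A n)"
      by (rule abs_padic_mult[OF Ci rep_padic_Cauchy])
    also have "\<dots> = 1"
      unfolding one_padic_def
      using null by (subst abs_padic_eq_iff) (simp_all add: p padic_Cauchy_mult[OF p Ci])
    finally show ?thesis .
  qed
  show "a div b = a * inverse b" by (rule divide_padic_def)
  show "inverse (0 :: 'a padic) = 0" by (simp add: inverse_padic_def)
qed

definition padic_norm :: "'p::prime_card padic \<Rightarrow> real" where
  "padic_norm x = lim (\<lambda>n. padic_abs CARD('p) (rep_padic x n))"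

lemma padic_norm_tendsto:
  assumes X: "padic_Cauchy CARD('p) X"
  shows "(\<lambda>n. padic_abs CARD('p) (X n)) \<longlonglongrightarrow> padic_norm (abs_padic X :: 'p::prime_card padic)"
proof -
  note p = prime_card[where ?'a = 'p]
  let ?Y = "rep_padic (abs_padic X :: 'p padic)"
  have "(\<lambda>n. padic_abs CARD('p) (?Y n)) \<longlonglongrightarrow> padic_norm (abs_padic X :: 'p padic)"
    using padic_Cauchy_norm[OF p rep_padic_Cauchy]
    by (simp add: padic_norm_def convergent_LIMSEQ_iff)
  moreover have "(\<lambda>n. padic_abs CARD('p) (X n) - padic_abs CARD('p) (?Y n)) \<longlonglongrightarrow> 0"
  proof (rule Lim_null_comparison)
    show "\<forall>\<^sub>F n in sequentially. norm (padic_abs CARD('p) (X n) - padic_abs CARD('p) (?Y n))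
        \<le> padic_abs CARD('p) (?Y n - X n)"
      using padic_abs_triangle3[OF p] by (simp add: padic_abs_diff_commute[OF p])
    show "(\<lambda>n. padic_abs CARD('p) (?Y n - X n)) \<longlonglongrightarrow> 0"
      using padic_null_rep_abs[OF X] unfolding padic_null_def .
  qed
  ultimately show ?thesis using tendsto_add by fastforce
qed

lemma padic_norm_nonneg: "padic_norm (x :: 'p::prime_card padic) \<ge> 0"
proof -
  obtain X where X: "padic_Cauchy CARD('p) X" "x = abs_padic X" by (rule padic_cases)
  show ?thesis
    using padic_norm_tendsto[OF X(1)] unfolding X(2)
    by (rule LIMSEQ_le_const) (auto simp: prime_card)
qed

lemma padic_norm_eq_0_iff: "padic_norm (x :: 'p::prime_card padic) = 0 \<longleftrightarrow> x = 0"
proof -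
  obtain X where X: "padic_Cauchy CARD('p) X" "x = abs_padic X" by (rule padic_cases)
  have "padic_norm x = 0 \<longleftrightarrow> padic_null CARD('p) X"
    using padic_norm_tendsto[OF X(1)] unfolding X(2) padic_null_def
    by (auto dest: LIMSEQ_unique)
  also have "\<dots> \<longleftrightarrow> x = 0"
    unfolding X(2) using abs_padic_eq_0_iff[OF X(1)] by simp
  finally show ?thesis .
qed

lemma padic_norm_mult: "padic_norm (x * y) = padic_norm x * padic_norm (y :: 'p::prime_card padic)"
proof -
  obtain X where X: "padic_Cauchy CARD('p) X" "x = abs_padic X" by (rule padic_cases)
  obtain Y where Y: "padic_Cauchy CARD('p) Y" "y = abs_padic Y" by (rule padic_cases)
  note p = prime_card[where ?'a = 'p]
  have "(\<lambda>n. padic_abs CARD('p) (X n) * padic_abs CARD('p) (Y n)) \<longlonglongrightarrow> padic_norm x * padic_norm y"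
    unfolding X(2) Y(2) by (intro tendsto_mult padic_norm_tendsto X Y)
  moreover have "(\<lambda>n. padic_abs CARD('p) (X n) * padic_abs CARD('p) (Y n)) \<longlonglongrightarrow> padic_norm (x * y)"
    using padic_norm_tendsto[OF padic_Cauchy_mult[OF p X(1) Y(1)]]
    unfolding X(2) Y(2) abs_padic_mult[OF X(1) Y(1)] by (simp add: padic_abs_mult[OF p])
  ultimately show ?thesis by (rule LIMSEQ_unique[THEN sym])
qed

lemma padic_norm_ultra: "padic_norm (x + y) \<le> max (padic_norm x) (padic_norm (y :: 'p::prime_card padic))"
proof -
  obtain X where X: "padic_Cauchy CARD('p) X" "x = abs_padic X" by (rule padic_cases)
  obtain Y where Y: "padic_Cauchy CARD('p) Y" "y = abs_padic Y" by (rule padic_cases)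
  note p = prime_card[where ?'a = 'p]
  have 1: "(\<lambda>n. max (padic_abs CARD('p) (X n)) (padic_abs CARD('p) (Y n)))
      \<longlonglongrightarrow> max (padic_norm x) (padic_norm y)"
    unfolding X(2) Y(2) by (intro tendsto_max padic_norm_tendsto X Y)
  have 2: "(\<lambda>n. padic_abs CARD('p) (X n + Y n)) \<longlonglongrightarrow> padic_norm (x + y)"
    using padic_norm_tendsto[OF padic_Cauchy_add[OF p X(1) Y(1)]]
    unfolding X(2) Y(2) abs_padic_add[OF X(1) Y(1)] .
  show ?thesis
    by (rule LIMSEQ_le[OF 2 1]) (use padic_abs_ultra[OF p] in auto)
qed

lemma padic_norm_1: "padic_norm (1 :: 'p::prime_card padic) = 1"
  using padic_norm_mult[of 1 "1 :: 'p padic"] padic_norm_eq_0_iff[of "1 :: 'p padic"] by simp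

lemma padic_norm_minus: "padic_norm (- x) = padic_norm (x :: 'p::prime_card padic)"
proof -
  have "padic_norm (- 1 :: 'p padic) * padic_norm (- 1 :: 'p padic) = 1"
    by (simp flip: padic_norm_mult add: padic_norm_1)
  then have "padic_norm (- 1 :: 'p padic) = 1"
    using padic_norm_nonneg[of "- 1 :: 'p padic"] by (simp add: square_eq_1_iff)
  then show ?thesis using padic_norm_mult[of "- 1" x] by simp
qed

instantiation padic :: (prime_card) metric_space
begin

definition dist_padic :: "'a padic \<Rightarrow> 'a padic \<Rightarrow> real" where
  "dist x y = padic_norm (x - y)"

definition uniformity_padic :: "('a padic \<times> 'a padic) filter" where
  "uniformity_padic = (INF e\<in>{0<..}. principal {(x, y). dist x y < e})"

definition open_padic :: "'a padic set \<Rightarrow> bool" where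
  "open_padic U \<longleftrightarrow> (\<forall>x\<in>U. eventually (\<lambda>(x', y). x' = x \<longrightarrow> y \<in> U) uniformity)"

instance
proof
  fix x y z :: "'a padic" and U :: "'a padic set"
  show "uniformity = (INF e\<in>{0<..}. principal {(x :: 'a padic, y). dist x y < e})"
    by (rule uniformity_padic_def)
  show "open U \<longleftrightarrow> (\<forall>x\<in>U. \<forall>\<^sub>F (x', y) in uniformity. x' = x \<longrightarrow> y \<in> U)"
    by (rule open_padic_def)
  show "dist x y = 0 \<longleftrightarrow> x = y"
    by (simp add: dist_padic_def padic_norm_eq_0_iff)
  show "dist x y \<le> dist x z + dist y z"
    using padic_norm_ultra[of "x - z" "z - y"] padic_norm_minus[of "y - z"]
      padic_norm_nonneg[of "x - z"] padic_norm_nonneg[of "y - z"]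
    by (simp add: dist_padic_def)
qed

end

instance padic :: (prime_card) field_char_0
proof
  have nz: "of_nat n \<noteq> (0 :: 'a padic)" if n: "n > 0" for n
  proof -
    note p = prime_card[where ?'a = 'a]
    have "of_nat k = (abs_padic (\<lambda>_. of_nat k) :: 'a padic)" for k
      by (induction k)
         (simp_all add: zero_padic_def one_padic_def abs_padic_add p)
    then show ?thesis
      using n unfolding zero_padic_def by (simp add: abs_padic_eq_iff p padic_null_def tendsto_const_iff)
  qed
  show "inj (of_nat :: nat \<Rightarrow> 'a padic)"
  proof (rule injI)
    fix k l assume eq: "of_nat k = (of_nat l :: 'a padic)"
    show "k = l"
    proof (rule ccontr)
      assume "k \<noteq> l"
      then consider "k < l" | "l < k" by linarith
      then show False
      proof cases
        case 1
        then have "of_nat (l - k) = (0 :: 'a padic)" using eq by (simp add: of_nat_diff)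
        with nz[of "l - k"] 1 show False by simp
      next
        case 2
        then have "of_nat (k - l) = (0 :: 'a padic)" using eq by (simp add: of_nat_diff)
        with nz[of "k - l"] 2 show False by simp
      qed
    qed
  qed
qed


section \<open>Haar measure, test functions, Fourier multipliers\<close>

definition haar_measure :: "'p::prime_card padic measure \<Rightarrow> bool" where
  "haar_measure m \<longleftrightarrow> sets m = sets borel
     \<and> (\<forall>a. \<forall>A\<in>sets borel. emeasure m ((\<lambda>x. a + x) ` A) = emeasure m A)
     \<and> emeasure m {x. padic_norm x \<le> 1} = 1"

text \<open>The space \<open>\<D>\<close> of locally constant functions with compact support.\<close>

definition test_function :: "('p::prime_card padic \<Rightarrow> complex) \<Rightarrow> bool" where
  "test_function f \<longleftrightarrow> (\<forall>x. \<exists>U. open U \<and> x \<in> U \<and> (\<forall>y\<in>U. f y = f x))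
     \<and> compact (closure {x. f x \<noteq> 0})"

text \<open>The fractional part \<open>{x}\<^sub>p\<close>, i.e. the representative of \<open>x + \<int>\<^sub>p\<close> in
  \<open>\<int>[1/p] \<inter> [0,1)\<close>, and the additive character \<open>exp (2\<pi>i{x}\<^sub>p)\<close>.\<close>

definition padic_frac :: "'p::prime_card padic \<Rightarrow> rat" where
  "padic_frac x = (THE r. 0 \<le> r \<and> r < 1 \<and> (\<exists>n. r * of_nat CARD('p) ^ n \<in> \<int>)
     \<and> padic_norm (x - of_rat r) \<le> 1)"

definition padic_char :: "'p::prime_card padic \<Rightarrow> complex" where
  "padic_char x = cis (2 * pi * of_rat (padic_frac x))"

definition padic_fourier ::
    "'p::prime_card padic measure \<Rightarrow> ('p padic \<Rightarrow> complex) \<Rightarrow> 'p padic \<Rightarrow> complex" where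
  "padic_fourier m f \<xi> = (\<integral>x. padic_char (\<xi> * x) * f x \<partial>m)"

text \<open>The operator \<open>\<DD>\<^sup>\<alpha>\<close> on \<open>\<D>\<close>, as Fourier multiplier with symbol \<open>\<parallel>\<xi>\<parallel>\<^sup>\<alpha>\<close>.\<close>

definition taibleson_vladimirov ::
    "'p::prime_card padic measure \<Rightarrow> real \<Rightarrow> ('p padic \<Rightarrow> complex) \<Rightarrow> 'p padic \<Rightarrow> complex" where
  "taibleson_vladimirov m \<alpha> f x =
     (\<integral>\<xi>. padic_char (- (\<xi> * x)) * of_real (padic_norm \<xi> powr \<alpha>) * padic_fourier m f \<xi> \<partial>m)"

definition padic_Gamma :: "nat \<Rightarrow> real \<Rightarrow> real" where
  "padic_Gamma p z = (1 - real p powr (z - 1)) / (1 - real p powr (- z))"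

text \<open>\<open>\<parallel>x\<parallel>\<^sup>\<gamma>\<close> with values in \<open>[0,\<infinity>]\<close>, extended to \<open>x = 0\<close> by continuity
  (whereas \<open>0 powr \<gamma> = 0\<close> for every \<open>\<gamma>\<close>).\<close>

definition norm_powr :: "real \<Rightarrow> 'p::prime_card padic \<Rightarrow> ennreal" where
  "norm_powr \<gamma> x = (if x \<noteq> 0 then ennreal (padic_norm x powr \<gamma>)
     else if \<gamma> > 0 then 0 else if \<gamma> = 0 then 1 else \<infinity>)"


section \<open>The operator \<open>\<L>\<close> and its Green function\<close>

definition weighted_measure ::
    "'p::prime_card padic measure \<Rightarrow> real \<Rightarrow> 'p padic measure" where
  "weighted_measure m \<beta> = density m (norm_powr \<beta>)"

definition jump_kernel :: "real \<Rightarrow> 'p::prime_card padic \<Rightarrow> 'p padic \<Rightarrow> real" where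
  "jump_kernel \<alpha> x y = - 1 / padic_Gamma CARD('p) (- \<alpha>) * padic_norm (x - y) powr (- 1 - \<alpha>)"

definition calL_op ::
    "'p::prime_card padic measure \<Rightarrow> real \<Rightarrow> real \<Rightarrow> ('p padic \<Rightarrow> complex) \<Rightarrow> 'p padic \<Rightarrow> complex" where
  "calL_op m \<alpha> \<beta> u x =
     (\<integral>y. (u x - u y) * of_real (jump_kernel \<alpha> x y) \<partial>weighted_measure m \<beta>)"

definition L2_fun :: "'a measure \<Rightarrow> ('a \<Rightarrow> complex) \<Rightarrow> bool" where
  "L2_fun M f \<longleftrightarrow> f \<in> borel_measurable M \<and> integrable M (\<lambda>x. (cmod (f x))\<^sup>2)"

definition L2_lim :: "'a measure \<Rightarrow> (nat \<Rightarrow> 'a \<Rightarrow> complex) \<Rightarrow> ('a \<Rightarrow> complex) \<Rightarrow> bool" where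
  "L2_lim M f g \<longleftrightarrow> (\<lambda>n. \<integral>\<^sup>+x. ennreal ((cmod (f n x - g x))\<^sup>2) \<partial>M) \<longlonglongrightarrow> 0"

text \<open>The closure of \<open>\<L>\<close> on \<open>\<D>\<close> as a graph in \<open>L\<^sup>2(X,hm)\<close>; this is the self-adjoint operator
  \<open>\<L>\<close>.\<close>

definition calL_closure ::
    "'p::prime_card padic measure \<Rightarrow> real \<Rightarrow> real
      \<Rightarrow> ('p padic \<Rightarrow> complex) \<Rightarrow> ('p padic \<Rightarrow> complex) \<Rightarrow> bool" where
  "calL_closure m \<alpha> \<beta> u v \<longleftrightarrow>
     L2_fun (weighted_measure m \<beta>) u \<and> L2_fun (weighted_measure m \<beta>) v \<and>
     (\<exists>\<phi>. (\<forall>n. test_function (\<phi> n)) \<and> L2_lim (weighted_measure m \<beta>) \<phi> u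
        \<and> L2_lim (weighted_measure m \<beta>) (\<lambda>n. calL_op m \<alpha> \<beta> (\<phi> n)) v)"

text \<open>\<open>G\<close> is the kernel of \<open>(\<L> + lI)\<^sup>-\<^sup>1\<close> with respect to \<open>hm\<close>: \<open>u = \<integral>G(\<sqdot>,y) f(y) d(hm)(y)\<close> solves
  \<open>\<L>u + lu = f\<close>. The kernel is continuous as a \<open>[0,\<infinity>]\<close>-valued function, which determines it
  everywhere, including the diagonal.\<close>

definition is_resolvent_kernel ::
    "'p::prime_card padic measure \<Rightarrow> real \<Rightarrow> real \<Rightarrow> real
      \<Rightarrow> ('p padic \<Rightarrow> 'p padic \<Rightarrow> ennreal) \<Rightarrow> bool" where
  "is_resolvent_kernel m \<alpha> \<beta> l G \<longleftrightarrow>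
     continuous_on UNIV (\<lambda>(x, y). G x y) \<and> (\<forall>x y. x \<noteq> y \<longrightarrow> G x y < \<infinity>) \<and>
     (\<forall>f. L2_fun (weighted_measure m \<beta>) f \<longrightarrow>
        (AE x in weighted_measure m \<beta>.
           (\<integral>\<^sup>+y. G x y * ennreal (cmod (f y)) \<partial>weighted_measure m \<beta>) < \<infinity>) \<and>
        (let u = (\<lambda>x. \<integral>y. of_real (enn2real (G x y)) * f y \<partial>weighted_measure m \<beta>)
         in calL_closure m \<alpha> \<beta> u (\<lambda>x. f x - of_real l * u x)))"

definition resolvent_kernel ::
    "'p::prime_card padic measure \<Rightarrow> real \<Rightarrow> real \<Rightarrow> real \<Rightarrow> 'p padic \<Rightarrow> 'p padic \<Rightarrow> ennreal" where
  "resolvent_kernel m \<alpha> \<beta> l = (THE G. is_resolvent_kernel m \<alpha> \<beta> l G)"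

definition green_calL ::
    "'p::prime_card padic measure \<Rightarrow> real \<Rightarrow> real \<Rightarrow> 'p padic \<Rightarrow> 'p padic \<Rightarrow> ennreal" where
  "green_calL m \<alpha> \<beta> x y = Lim (at_right 0) (\<lambda>l. resolvent_kernel m \<alpha> \<beta> l x y)"


section \<open>The Green functions of \<open>L\<close> and \<open>H\<close>\<close>

definition green_L :: "real \<Rightarrow> 'p::prime_card padic \<Rightarrow> 'p padic \<Rightarrow> ennreal" where
  "green_L \<alpha> x y = ennreal (1 / padic_Gamma CARD('p) \<alpha>) * norm_powr (\<alpha> - 1) (x - y)"

text \<open>The bilinear form of \<open>H = \<DD>\<^sup>\<alpha> + b \<parallel>x\<parallel>\<^sup>-\<^sup>\<alpha>\<close> (form sum), with \<open>\<psi> \<in> \<D>\<close> and \<open>\<DD>\<^sup>\<alpha>\<close> moved to \<open>\<psi>\<close>, so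
  that \<open>u\<close> need not be in \<open>L\<^sup>2\<close>.\<close>

definition H_form ::
    "'p::prime_card padic measure \<Rightarrow> real \<Rightarrow> real
      \<Rightarrow> ('p padic \<Rightarrow> complex) \<Rightarrow> ('p padic \<Rightarrow> complex) \<Rightarrow> complex" where
  "H_form m \<alpha> b u \<psi> = (\<integral>x. u x * taibleson_vladimirov m \<alpha> \<psi> x \<partial>m)
     + of_real b * (\<integral>x. of_real (padic_norm x powr (- \<alpha>)) * u x * \<psi> x \<partial>m)"

text \<open>For \<open>v \<in> \<D>\<close> the function \<open>u = \<integral>g(\<sqdot>,y) v(y) dm(y)\<close> solves \<open>Hu = v\<close>, tested against
  \<open>\<D>\<close>.\<close>

definition fundamental_solution_H ::
    "'p::prime_card padic measure \<Rightarrow> real \<Rightarrow> real \<Rightarrow> ('p padic \<Rightarrow> 'p padic \<Rightarrow> ennreal) \<Rightarrow> bool" where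
  "fundamental_solution_H m \<alpha> b g \<longleftrightarrow>
     (\<forall>v. test_function v \<longrightarrow>
        (AE x in m. (\<integral>\<^sup>+y. g x y * ennreal (cmod (v y)) \<partial>m) < \<infinity>) \<and>
        (let u = (\<lambda>x. \<integral>y. of_real (enn2real (g x y)) * v y \<partial>m)
         in \<forall>\<psi>. test_function \<psi> \<longrightarrow>
              integrable m (\<lambda>x. u x * taibleson_vladimirov m \<alpha> \<psi> x) \<and>
              integrable m (\<lambda>x. of_real (padic_norm x powr (- \<alpha>)) * u x * \<psi> x) \<and>
              H_form m \<alpha> b u \<psi> = (\<integral>x. v x * \<psi> x \<partial>m)))"

text \<open>The fundamental solution of \<open>Hu = v\<close> obtained from \<open>\<L>\<close> by the ground state transformation
  with \<open>h(x) = \<parallel>x\<parallel>\<^sup>\<beta>\<close>. In the critical case \<open>\<beta> = (\<alpha> - 1)/2\<close> the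
  form of \<open>\<L>\<close> is recurrent, so \<open>green_calL\<close> is infinite and no such \<open>g\<close> exists.\<close>

definition green_function_H ::
    "'p::prime_card padic measure \<Rightarrow> real \<Rightarrow> real \<Rightarrow> real
      \<Rightarrow> ('p padic \<Rightarrow> 'p padic \<Rightarrow> ennreal) \<Rightarrow> bool" where
  "green_function_H m \<alpha> \<beta> b g \<longleftrightarrow>
     (\<forall>x y. g x y = norm_powr \<beta> x * green_calL m \<alpha> \<beta> x y * norm_powr \<beta> y) \<and>
     fundamental_solution_H m \<alpha> b g"

text \<open>\<open>f \<asymp> g\<close> on \<open>S\<close>\<close>

definition comparable_on :: "'a set \<Rightarrow> ('a \<Rightarrow> ennreal) \<Rightarrow> ('a \<Rightarrow> ennreal) \<Rightarrow> bool" where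
  "comparable_on S f g \<longleftrightarrow> (\<exists>c C. 0 < c \<and> 0 < C \<and>
     (\<forall>z\<in>S. ennreal c \<le> f z / g z \<and> f z / g z \<le> ennreal C))"

end

theory Submission
  imports Defs
begin

text \<open>
  Every point of a \<open>p\<close>-adic ball is its centre, so \<open>J(x,y)\<close> depends only on the smallest ball
  containing \<open>x\<close> and \<open>y\<close>, and \<open>\<L>\<close> is a hierarchical Laplacian with respect to \<open>\<mu> = hm\<close>: for a ball
  \<open>B\<close> with parent \<open>B'\<close> the function \<open>1\<^sub>B/\<mu>(B) - 1\<^sub>B\<^sub>'/\<mu>(B')\<close> is an eigenfunction with some eigenvalue
  \<open>\<lambda>(B')\<close>, and these functions span a dense subspace of \<open>L\<^sup>2(\<mu>)\<close>. Hence the resolvent kernel is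
  \<open>G\<^sub>l(x,y) = \<Sum> (1/(\<lambda>(B') + l) - 1/(\<lambda>(B) + l)) / \<mu>(B)\<close>, summed over the balls \<open>B\<close> containing \<open>x\<close> and
  \<open>y\<close>. It is locally constant off the diagonal and tends to \<open>\<infinity>\<close> at the diagonal. It is unique because
  \<open>\<L>\<close> is symmetric and the eigenfunctions are total. Letting \<open>l \<rightarrow> 0\<close> leaves a series comparable to a
  geometric one: with \<open>\<mu>(B) \<asymp> r max(\<parallel>x\<parallel>,r)\<^sup>\<beta>\<close> and \<open>\<lambda>(B) \<asymp> r\<^sup>-\<^sup>\<alpha> max(\<parallel>x\<parallel>,r)\<^sup>\<beta>\<close> for the ball \<open>B\<close> of radius
  \<open>r\<close> about \<open>x\<close>, its terms are of order \<open>r\<^sup>\<alpha>\<^sup>-\<^sup>1 max(\<parallel>x\<parallel>,r)\<^sup>-\<^sup>2\<^sup>\<beta>\<close>, so for \<open>\<beta> > (\<alpha> - 1)/2\<close> the smallest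
  radius \<open>r = \<parallel>x - y\<parallel>\<close> dominates. For \<open>\<beta> = (\<alpha> - 1)/2\<close> the series diverges, and there is no
  fundamental solution of this form.
\<close>

section \<open>The field of \<open>p\<close>-adic numbers\<close>

text \<open>Summation by parts is what makes every term of the series for the kernel nonnegative,
  because the eigenvalue decreases when the ball grows. Exchanging the series with an integral is
  then Tonelli's theorem, and the limit l -> 0 is monotone convergence. The weight destroys
  translation invariance, but no exact measures or eigenvalues are needed: max(|x|, r) describes
  balls with and without the origin at once, and bounds up to constants suffice. The parameter range
  acts through exponents. Since 0 < \<alpha> and \<beta> < \<alpha>, the integrals defining the
  eigenvalues converge, and the eigenvalues tend to infinity on shrinking balls. Since \<beta> >=
  (\<alpha> - 1)/2, the terms at x = 0, of order r^(\<alpha> - 1 - 2 \<beta>), stay bounded below as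
  r -> 0; so the kernel is infinite on the whole diagonal, the origin included, as continuity at
  (0,0) demands. When the inequality is strict, the same exponent makes the series summable at large
  radii. Finally \<beta> > -1 gives balls finite mass and the whole space infinite mass; the latter
  lets mean-zero eigenfunctions span a dense subspace.\<close>

lemma prime_card_gt_1: "1 < CARD('p::prime_card)"
  using prime_card[where ?'a = 'p] by (rule prime_gt_1_nat)

lemma of_int_padic: "(of_int k :: 'p::prime_card padic) = abs_padic (\<lambda>_. of_int k)"
proof -
  note p = prime_card[where ?'a = 'p]
  have nat: "(of_nat n :: 'p padic) = abs_padic (\<lambda>_. of_nat n)" for n
    by (induction n) (simp_all add: zero_padic_def one_padic_def abs_padic_add p)
  show ?thesis
  proof (cases "k \<ge> 0")
    case True
    then show ?thesis using nat[of "nat k"] by simp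
  next
    case False
    then have "k = - int (nat (- k))" by simp
    then obtain n where "k = - int n" by blast
    then show ?thesis using nat[of n] by (simp add: abs_padic_minus p)
  qed
qed

lemma of_rat_padic: "(of_rat r :: 'p::prime_card padic) = abs_padic (\<lambda>_. r)"
proof -
  note p = prime_card[where ?'a = 'p]
  obtain a b where ab: "quotient_of r = (a, b)" by fastforce
  then have r: "r = of_int a / of_int b" and b: "b > 0"
    using quotient_of_div quotient_of_denom_pos by blast+
  have "(of_rat r :: 'p padic) * of_int b = of_int a"
    using b by (simp add: r of_rat_divide)
  moreover have "(abs_padic (\<lambda>_. r) :: 'p padic) * of_int b = of_int a"
    using b by (simp add: of_int_padic abs_padic_mult p r)
  ultimately show ?thesis
    using b by (metis mult_right_cancel of_int_eq_0_iff less_irrefl)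
qed

text \<open>Expresses the distance from a class to a rational as a limit of rational absolute
  values, the form in which density and completeness use it.\<close>

lemma padic_norm_abs_minus_of_rat:
  assumes "padic_Cauchy CARD('p) X"
  shows "(\<lambda>n. padic_abs CARD('p) (X n - r)) \<longlonglongrightarrow>
    padic_norm (abs_padic X - of_rat r :: 'p::prime_card padic)"
proof -
  note p = prime_card[where ?'a = 'p]
  have "padic_Cauchy CARD('p) (\<lambda>n. X n + - r)"
    using assms by (intro padic_Cauchy_add p) (simp_all add: p)
  moreover have "abs_padic X - of_rat r = (abs_padic (\<lambda>n. X n + - r) :: 'p padic)"
    unfolding minus_padic_def of_rat_padic
    by (simp add: abs_padic_add abs_padic_minus assms p del: add_uminus_conv_diff)
  ultimately show ?thesis using padic_norm_tendsto[of "\<lambda>n. X n + - r", where ?'p = 'p] by simp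
qed

lemma padic_norm_of_rat: "padic_norm (of_rat r :: 'p::prime_card padic) = padic_abs CARD('p) r"
proof -
  have "(\<lambda>_. padic_abs CARD('p) r) \<longlonglongrightarrow> padic_norm (of_rat r :: 'p padic)"
    using padic_norm_tendsto[of "\<lambda>_. r", where ?'p = 'p] by (simp add: of_rat_padic prime_card)
  then show ?thesis using LIMSEQ_unique tendsto_const by blast
qed

lemma padic_rat_dense:
  fixes x :: "'p::prime_card padic"
  assumes "e > 0"
  obtains r where "dist x (of_rat r) < e"
proof -
  obtain X where X: "padic_Cauchy CARD('p) X" "x = abs_padic X" by (rule padic_cases)
  \<comment> \<open>A limit preserves only weak inequalities, so the Cauchy condition is taken with
    \<open>e / 2\<close> to end strictly below \<open>e\<close>.\<close>
  obtain N where N: "\<And>m n. m \<ge> N \<Longrightarrow> n \<ge> N \<Longrightarrow> padic_abs CARD('p) (X m - X n) < e / 2"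
    using X(1) assms unfolding padic_Cauchy_def by (meson half_gt_zero)
  have "padic_norm (x - of_rat (X N)) \<le> e / 2"
    using padic_norm_abs_minus_of_rat[OF X(1), of "X N"] unfolding X(2)
    by (rule LIMSEQ_le_const2) (use N in \<open>auto intro!: less_imp_le exI[of _ N]\<close>)
  then show thesis using that[of "X N"] assms by (simp add: dist_padic_def)
qed

lemma padic_dist_ultra: "dist x z \<le> max (dist x y) (dist y (z :: 'p::prime_card padic))"
  using padic_norm_ultra[of "x - y" "y - z"] by (simp add: dist_padic_def)

lemma padic_dist_isosceles:
  "dist x y < dist y z \<Longrightarrow> dist x z = dist y (z :: 'p::prime_card padic)"
  using padic_dist_ultra[of x z y] padic_dist_ultra[of y z x] by (simp add: dist_commute)

lemma padic_norm_eq_dist: "padic_norm x = dist x 0"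
  by (simp add: dist_padic_def)

text \<open>A rational closer to \<open>x - y\<close> than \<open>dist x y\<close> has the same norm
  by the isosceles property, and norms of nonzero rationals are integer powers of p.\<close>

lemma padic_dist_values:
  fixes x y :: "'p::prime_card padic"
  assumes "x \<noteq> y"
  obtains k :: int where "dist x y = real CARD('p) powr k"
proof -
  have pos: "dist x y > 0" using assms by simp
  obtain r where r: "dist (x - y) (of_rat r) < dist x y"
    using padic_rat_dense[OF pos] by blast
  have xy: "dist (x - y) 0 = dist x y" by (simp add: dist_padic_def)
  then have "dist (of_rat r) (0 :: 'p padic) = dist (x - y) 0"
    using r padic_dist_isosceles[of "of_rat r" "x - y" 0] dist_commute[of "x - y" "of_rat r"]
    by simp
  then have "dist x y = padic_norm (of_rat r :: 'p padic)"
    unfolding xy padic_norm_eq_dist by (rule sym)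
  also have "\<dots> = padic_abs CARD('p) r" by (rule padic_norm_of_rat)
  finally have eq: "dist x y = padic_abs CARD('p) r" .
  with pos have "r \<noteq> 0" by auto
  with eq that prime_card_gt_1[where ?'p = 'p] show thesis
    by (simp add: padic_abs_def powr_real_of_int')
qed

text \<open>Distances take only the values 0 and p^k, so balls indexed by integer exponents are all
  the balls there are. They form a tree in which \<open>pball a (k + 1)\<close> is the parent of
  \<open>pball a k\<close>.\<close>

definition pball :: "'p::prime_card padic \<Rightarrow> int \<Rightarrow> 'p padic set" where
  "pball a k = {y. dist a y \<le> real CARD('p) powr k}"

lemma padic_dist_discrete:
  fixes x y :: "'p::prime_card padic"
  assumes "\<not> dist x y \<le> real CARD('p) powr of_int k"
  shows "real CARD('p) powr of_int (k + 1) \<le> dist x y"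
proof -
  have "x \<noteq> y" using assms by auto
  then obtain j :: int where j: "dist x y = real CARD('p) powr j" by (rule padic_dist_values)
  have P: "1 < real CARD('p)" using prime_card_gt_1[where ?'p = 'p] by simp
  have "k < j" using assms P unfolding j by (simp add: powr_le_cancel_iff)
  then show ?thesis unfolding j using P by (intro powr_mono) auto
qed

lemma pball_mem: "y \<in> pball (a :: 'p::prime_card padic) k \<longleftrightarrow> dist a y \<le> real CARD('p) powr k"
  by (simp add: pball_def)

lemma pball_self [simp]: "a \<in> pball a k"
  by (simp add: pball_def)

lemma pball_sym: "y \<in> pball x k \<longleftrightarrow> x \<in> pball y k"
  by (simp add: pball_def dist_commute)

lemma pball_eq:
  assumes "b \<in> pball a k" shows "pball b k = pball a k"
  using assms padic_dist_ultra[of a _ b] padic_dist_ultra[of b _ a]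
  by (auto simp: pball_def dist_commute[of b a]) (meson max.boundedI order.trans)+

lemma pball_mono: "j \<le> k \<Longrightarrow> pball (a :: 'p::prime_card padic) j \<subseteq> pball a k"
proof -
  assume "j \<le> k"
  then have "real CARD('p) powr of_int j \<le> real CARD('p) powr of_int k"
    using prime_card_gt_1[where ?'p = 'p] by (intro powr_mono) auto
  then show ?thesis by (auto simp: pball_def)
qed

lemma pball_mono_mem: "j \<le> k \<Longrightarrow> y \<in> pball a j \<Longrightarrow> y \<in> pball a k"
  using pball_mono by blast

lemma pball_trans: "y \<in> pball x k \<Longrightarrow> z \<in> pball y k \<Longrightarrow> z \<in> pball x k"
  using pball_eq by blast

lemma pball_disjoint: "b \<notin> pball a k \<Longrightarrow> pball a k \<inter> pball b k = {}"
  using pball_trans pball_sym by blast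

lemma powr_int_pos [simp]: "0 < real CARD('p::prime_card) powr k"
  using prime_card_gt_1[where ?'p = 'p] by simp

lemma padic_radius_below:
  assumes "e > 0" obtains k :: int where "real CARD('p::prime_card) powr k < e"
proof -
  have P: "1 < real CARD('p)" using prime_card_gt_1[where ?'p = 'p] by simp
  have "real CARD('p) powr of_int (\<lfloor>log CARD('p) e\<rfloor> - 1) < real CARD('p) powr (log CARD('p) e)"
    using P by (intro powr_less_mono) linarith+
  also have "\<dots> = e" using P assms by (intro powr_log_cancel) auto
  finally show thesis by (rule that)
qed

lemma padic_radius_above:
  obtains k :: int where "e < real CARD('p::prime_card) powr k"
proof -
  have P: "1 < real CARD('p)" using prime_card_gt_1[where ?'p = 'p] by simp
  let ?e = "max e 1"
  have "real CARD('p) powr (log CARD('p) ?e) < real CARD('p) powr of_int (\<lfloor>log CARD('p) ?e\<rfloor> + 1)"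
    using P by (intro powr_less_mono) linarith+
  moreover have "real CARD('p) powr (log CARD('p) ?e) = ?e"
    using P by (intro powr_log_cancel) auto
  ultimately show thesis by (intro that[of "\<lfloor>log CARD('p) ?e\<rfloor> + 1"]) linarith
qed

lemma open_pball: "open (pball (a :: 'p::prime_card padic) k)"
  unfolding open_dist
proof
  fix x assume x: "x \<in> pball a k"
  have "y \<in> pball a k" if "dist y x < real CARD('p) powr k" for y
    using that x pball_trans[of x a k y] by (simp add: pball_def dist_commute)
  then show "\<exists>e>0. \<forall>y. dist y x < e \<longrightarrow> y \<in> pball a k"
    by (intro exI[of _ "real CARD('p) powr k"]) simp
qed

lemma closed_pball: "closed (pball (a :: 'p::prime_card padic) k)"
proof -
  have "pball a k = cball a (real CARD('p) powr k)" by (auto simp: pball_def)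
  then show ?thesis by simp
qed

lemma eventually_nhds_pball: "eventually (\<lambda>y. y \<in> pball x k) (nhds (x :: 'p::prime_card padic))"
  by (rule eventually_nhds_in_open[OF open_pball]) simp

lemma pball_subset_ball:
  assumes "e > 0"
  obtains k where "pball (x :: 'p::prime_card padic) k \<subseteq> ball x e"
proof -
  obtain k :: int where "real CARD('p) powr k < e" using padic_radius_below[OF assms] by blast
  then have "pball x k \<subseteq> ball x e" by (auto simp: pball_def)
  then show thesis by (rule that)
qed

subsection \<open>Residues and compactness\<close>

lemma padic_abs_of_int_less_1:
  assumes p: "prime p" and k: "padic_abs p (of_int k) < 1"
  shows "int p dvd k"
proof (cases "k = 0")
  case False
  have "padic_abs p (of_int k) = real p powi (- int (multiplicity (int p) k))"
    using padic_abs_fract[OF p False, of 1] by simp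
  then have "multiplicity (int p) k \<noteq> 0" using k by (metis less_irrefl minus_zero of_nat_0 power_int_0_right)
  then show ?thesis using not_dvd_imp_multiplicity_0[of "int p" k] by metis
qed simp

lemma padic_abs_of_int_dvd:
  assumes p: "prime p" and k: "int p dvd k"
  shows "padic_abs p (of_int k) < 1"
proof (cases "k = 0")
  case False
  have nu: "\<not> is_unit (int p)" using p not_prime_unit by fastforce
  have m: "multiplicity (int p) k > 0"
    using k False nu by (simp add: multiplicity_gt_zero_iff)
  have "padic_abs p (of_int k) = real p powi (- int (multiplicity (int p) k))"
    using padic_abs_fract[OF p False, of 1] by simp
  also have "\<dots> < real p powi 0"
    using m prime_gt_1_nat[OF p] by (intro power_int_strict_increasing) auto
  finally show ?thesis by simp
qed simp

lemma padic_abs_of_int_le_1: "prime p \<Longrightarrow> padic_abs p (of_int k) \<le> 1"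
proof (cases "k = 0")
  case False
  assume p: "prime p"
  have "padic_abs p (of_int k) = real p powi (- int (multiplicity (int p) k))"
    using padic_abs_fract[OF p False, of 1] by simp
  also have "\<dots> \<le> real p powi 0"
    using prime_ge_1_nat[OF p] by (intro power_int_increasing) auto
  finally show ?thesis by simp
qed simp

text \<open>A rational a/b within distance less than 1 of \<open>x\<close> has a denominator prime
  to p; inverting b modulo p turns a/b into an integer residue.\<close>

lemma padic_residue_exists:
  fixes x :: "'p::prime_card padic"
  assumes "padic_norm x \<le> 1"
  shows "\<exists>i<CARD('p). padic_norm (x - of_nat i) < 1"
proof -
  let ?p = "CARD('p)"
  note p = prime_card[where ?'a = 'p]
  obtain r where r: "dist x (of_rat r) < 1" using padic_rat_dense[of 1] by auto
  have r1: "padic_abs ?p r \<le> 1"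
    using padic_dist_ultra[of "of_rat r" 0 x] r assms
    by (simp add: padic_norm_of_rat[symmetric] padic_norm_eq_dist dist_commute)
  obtain a b where ab: "quotient_of r = (a, b)" by fastforce
  have rab: "r = of_int a / of_int b" and b: "b > 0" and cop: "coprime a b"
    using ab quotient_of_div quotient_of_denom_pos quotient_of_coprime by blast+
  \<comment> \<open>If p divided b, it would not divide a, so a would have absolute value 1; but |a|
    = |r| |b| < 1.\<close>
  have nb: "\<not> int ?p dvd b"
  proof
    assume d: "int ?p dvd b"
    then have "\<not> int ?p dvd a"
      using cop p by (metis coprime_common_divisor not_prime_unit prime_nat_int_transfer)
    then have "padic_abs ?p (of_int a) \<ge> 1"
      using padic_abs_of_int_less_1[OF p] by (meson not_less)
    moreover have "padic_abs ?p (of_int a) = padic_abs ?p r * padic_abs ?p (of_int b)"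
      using b by (simp add: padic_abs_mult[OF p, symmetric] rab)
    moreover have "padic_abs ?p r * padic_abs ?p (of_int b) < 1"
      using padic_abs_of_int_dvd[OF p d] r1 padic_abs_nonneg[OF p, of "of_int b"]
      by (meson le_less_trans mult_left_le_one_le padic_abs_nonneg[OF p])
    ultimately show False by linarith
  qed
  have "coprime b (int ?p)"
    using nb p by (metis coprime_commute prime_imp_coprime prime_nat_int_transfer)
  then obtain v where v: "[b * v = 1] (mod int ?p)"
    using cong_solve_coprime_int by blast
  define i where "i = nat ((a * v) mod int ?p)"
  have ip: "i < ?p" using prime_gt_0_nat[OF p] unfolding i_def
    by (metis int_ops(1) nat_less_iff pos_mod_bound pos_mod_sign zless_nat_conj of_nat_0_less_iff)
  have "[int i = a * v] (mod int ?p)"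
    using prime_gt_0_nat[OF p] unfolding i_def by (simp add: cong_def)
  then have "[b * int i = a * (b * v)] (mod int ?p)"
    by (metis cong_scalar_left mult.left_commute)
  also have "[a * (b * v) = a * 1] (mod int ?p)" using v by (rule cong_scalar_left)
  finally have dv: "int ?p dvd b * int i - a" by (simp add: cong_iff_dvd_diff)
  have b1: "padic_abs ?p (of_int b) = 1"
    using nb padic_abs_of_int_less_1[OF p] padic_abs_of_int_le_1[OF p, of b]
    by (meson antisym not_less)
  have "of_int (b * int i - a) = of_int b * (of_nat i - r)"
    using b by (simp add: rab field_simps)
  then have "padic_abs ?p (of_nat i - r) < 1"
    using padic_abs_of_int_dvd[OF p dv] b1 by (simp add: padic_abs_mult[OF p])
  then have "dist (of_rat r) (of_nat i :: 'p padic) < 1"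
    using padic_norm_of_rat[of "of_nat i - r", where ?'p = 'p]
    by (simp add: dist_commute of_rat_diff dist_padic_def)
  then have "dist x (of_nat i) < 1"
    using r padic_dist_ultra[of x "of_nat i" "of_rat r"] by linarith
  then show ?thesis using ip by (auto simp: dist_padic_def)
qed

lemma padic_residue_unique:
  assumes "i < CARD('p)" "j < CARD('p)" "padic_norm (of_nat i - of_nat j :: 'p::prime_card padic) < 1"
  shows "i = j"
proof -
  note p = prime_card[where ?'a = 'p]
  have "(of_nat i - of_nat j :: 'p padic) = of_rat (of_int (int i - int j))"
    by (simp add: of_rat_diff)
  then have "padic_abs CARD('p) (of_int (int i - int j)) < 1"
    using assms(3) by (simp only: padic_norm_of_rat)
  then have "int CARD('p) dvd int i - int j" by (rule padic_abs_of_int_less_1[OF p])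
  then have "int i mod int CARD('p) = int j mod int CARD('p)"
    by (simp add: mod_eq_dvd_iff)
  then show ?thesis using assms by simp
qed

lemma padic_norm_prime: "padic_norm (of_nat CARD('p) :: 'p::prime_card padic) = 1 / real CARD('p)"
proof -
  note p = prime_card[where ?'a = 'p]
  have nu: "\<not> is_unit (int CARD('p))" using p not_prime_unit by fastforce
  have "multiplicity (int CARD('p)) (int CARD('p)) = 1"
    using nu prime_gt_0_nat[OF p] by (intro multiplicity_self) auto
  then have "padic_abs CARD('p) (of_nat CARD('p)) = 1 / real CARD('p)"
    using padic_abs_fract[OF p, of "int CARD('p)" 1] prime_gt_0_nat[OF p]
    by (simp add: power_int_minus divide_inverse)
  then show ?thesis using padic_norm_of_rat[of "of_nat CARD('p)", where ?'p = 'p] by simp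
qed

text \<open>The exponent is negated because p has norm 1/p; thus \<open>pscale k\<close> has norm
  p^k and can rescale a ball of that radius to the unit ball.\<close>

definition pscale :: "int \<Rightarrow> 'p::prime_card padic" where
  "pscale k = of_nat CARD('p) powi (- k)"

lemma pscale_nz: "pscale k \<noteq> (0 :: 'p::prime_card padic)"
  using prime_card_gt_1[where ?'p = 'p] by (simp add: pscale_def)

lemma padic_norm_power: "padic_norm (x ^ n :: 'p::prime_card padic) = padic_norm x ^ n"
  by (induction n) (simp_all add: padic_norm_1 padic_norm_mult)

lemma padic_norm_inverse: "padic_norm (inverse x :: 'p::prime_card padic) = inverse (padic_norm x)"
proof (cases "x = 0")
  case False
  then have "padic_norm x * padic_norm (inverse x) = 1"
    by (simp flip: padic_norm_mult add: padic_norm_1)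
  then show ?thesis by (simp add: inverse_unique)
qed (simp add: padic_norm_eq_0_iff[THEN iffD2])

lemma padic_norm_pscale: "padic_norm (pscale k :: 'p::prime_card padic) = real CARD('p) powr k"
proof -
  have P: "1 < real CARD('p)" using prime_card_gt_1[where ?'p = 'p] by simp
  have "padic_norm (of_nat CARD('p) powi j :: 'p padic) = (1 / real CARD('p)) powi j" for j
    by (simp add: power_int_def padic_norm_power padic_norm_inverse padic_norm_prime power_divide)
  then have "padic_norm (pscale k :: 'p padic) = (1 / real CARD('p)) powi (- k)"
    by (simp add: pscale_def)
  also have "\<dots> = real CARD('p) powi k"
    by (simp add: power_int_minus power_int_divide_distrib)
  finally show ?thesis using P by (simp add: powr_real_of_int')
qed

text \<open>Division by \<open>pscale (k + 1)\<close> turns the ball into a unit ball, whose p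
  children are the residue classes modulo p.\<close>

lemma pball_split:
  fixes a :: "'p::prime_card padic"
  shows "pball a (k + 1) = (\<Union>i<CARD('p). pball (a + of_nat i * pscale (k + 1)) k)"
    and "disjoint_family_on (\<lambda>i. pball (a + of_nat i * pscale (k + 1)) k) {..<CARD('p)}"
proof -
  let ?s = "pscale (k + 1) :: 'p padic"
  let ?q = "real CARD('p) powr of_int (k + 1)"
  note sn = padic_norm_pscale[of "k + 1", where ?'p = 'p]
  \<comment> \<open>By discreteness of the distances, the strict bound at one radius is the weak
    bound at the next smaller one.\<close>
  have less: "dist x y < ?q \<longleftrightarrow> dist x y \<le> real CARD('p) powr of_int k" for x y :: "'p padic"
  proof -
    have "real CARD('p) powr of_int k < ?q"
      using prime_card_gt_1[where ?'p = 'p] by (intro powr_less_mono) auto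
    then show ?thesis using padic_dist_discrete[of x y k] by linarith
  qed
  have i1: "padic_norm (of_nat i :: 'p padic) \<le> 1" for i
    using padic_norm_of_rat[of "of_int (int i)", where ?'p = 'p]
      padic_abs_of_int_le_1[OF prime_card[where ?'a = 'p], of "int i"] by simp
  show "pball a (k + 1) = (\<Union>i<CARD('p). pball (a + of_nat i * ?s) k)"
  proof (intro equalityI subsetI)
    fix y assume "y \<in> pball a (k + 1)"
    then have "padic_norm (y - a) \<le> ?q"
      unfolding pball_mem dist_commute[of a] by (simp only: dist_padic_def)
    then have "padic_norm ((y - a) / ?s) \<le> 1"
      unfolding divide_inverse padic_norm_mult padic_norm_inverse sn
      by (simp add: pos_divide_le_eq flip: divide_inverse)
    then obtain i where i: "i < CARD('p)" "padic_norm ((y - a) / ?s - of_nat i) < 1"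
      using padic_residue_exists by blast
    have "y - (a + of_nat i * ?s) = ((y - a) / ?s - of_nat i) * ?s"
      using pscale_nz[of "k + 1", where ?'p = 'p] by (simp add: field_simps)
    then have "dist y (a + of_nat i * ?s) < ?q"
      using i(2) by (simp add: dist_padic_def padic_norm_mult sn)
    then show "y \<in> (\<Union>i<CARD('p). pball (a + of_nat i * ?s) k)"
      using i(1) less by (auto simp: pball_def dist_commute)
  next
    fix y assume "y \<in> (\<Union>i<CARD('p). pball (a + of_nat i * ?s) k)"
    then obtain i where i: "y \<in> pball (a + of_nat i * ?s) (k + 1)"
      using pball_mono[of k "k + 1"] by fastforce
    have "a + of_nat i * ?s \<in> pball a (k + 1)"
      using i1[of i] sn
      by (simp add: pball_def dist_padic_def padic_norm_minus padic_norm_mult mult_left_le_one_le padic_norm_nonneg)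
    then show "y \<in> pball a (k + 1)" using i pball_eq by blast
  qed
  show "disjoint_family_on (\<lambda>i. pball (a + of_nat i * ?s) k) {..<CARD('p)}"
    unfolding disjoint_family_on_def
  proof (intro ballI impI)
    fix i j assume ij: "i \<in> {..<CARD('p)}" "j \<in> {..<CARD('p)}" "i \<noteq> j"
    have "a + of_nat j * ?s \<notin> pball (a + of_nat i * ?s) k"
    proof
      assume "a + of_nat j * ?s \<in> pball (a + of_nat i * ?s) k"
      then have "padic_norm ((of_nat i - of_nat j) * ?s) < ?q"
        using less[of "a + of_nat i * ?s" "a + of_nat j * ?s"]
        by (simp add: pball_def dist_padic_def left_diff_distrib)
      then have "padic_norm (of_nat i - of_nat j :: 'p padic) < 1"
        using sn by (simp add: padic_norm_mult)
      then show False using padic_residue_unique[of i j] ij by auto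
    qed
    then show "pball (a + of_nat i * ?s) k \<inter> pball (a + of_nat j * ?s) k = {}"
      by (rule pball_disjoint)
  qed
qed

text \<open>Diagonal argument: each \<open>X n\<close> is replaced by a rational within 1/(n+1). The
  rationals form a Cauchy sequence, and its class is the limit.\<close>

instance padic :: (prime_card) complete_space
proof
  fix X :: "nat \<Rightarrow> 'a padic" assume X: "Cauchy X"
  note p = prime_card[where ?'a = 'a]
  have "\<exists>r. dist (X n) (of_rat r) < 1 / real (Suc n)" for n
    using padic_rat_dense[of "1 / real (Suc n)" "X n"] by auto
  then obtain r where r: "\<And>n. dist (X n) (of_rat (r n)) < 1 / real (Suc n)" by metis
  have C: "padic_Cauchy CARD('a) r"
    unfolding padic_Cauchy_def
  proof (intro allI impI)
    fix e :: real assume e: "e > 0"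
    obtain N where N: "\<And>m n. m \<ge> N \<Longrightarrow> n \<ge> N \<Longrightarrow> dist (X m) (X n) < e"
      using X e unfolding Cauchy_def by blast
    obtain M where M: "inverse (real (Suc M)) < e" using reals_Archimedean[OF e] by blast
    have rM: "dist (X n) (of_rat (r n)) < e" if "n \<ge> M" for n
    proof -
      have "1 / real (Suc n) \<le> inverse (real (Suc M))" using that by (simp add: field_simps)
      then show ?thesis using r[of n] M by linarith
    qed
    have "padic_abs CARD('a) (r m - r n) < e" if "m \<ge> max N M" "n \<ge> max N M" for m n
    proof -
      have "dist (of_rat (r m)) (of_rat (r n) :: 'a padic) < e"
        using padic_dist_ultra[of "of_rat (r m)" "of_rat (r n)" "X m"]
          padic_dist_ultra[of "X m" "of_rat (r n)" "X n"] N[of m n] rM[of m] rM[of n] that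
        by (simp add: dist_commute)
      then show ?thesis
        using padic_norm_of_rat[of "r m - r n", where ?'p = 'a] by (simp add: dist_padic_def of_rat_diff)
    qed
    then show "\<exists>N. \<forall>m\<ge>N. \<forall>n\<ge>N. padic_abs CARD('a) (r m - r n) < e" by blast
  qed
  define x where "x = (abs_padic r :: 'a padic)"
  have "X \<longlonglongrightarrow> x"
  proof (rule metric_LIMSEQ_I)
    fix e :: real assume e: "e > 0"
    obtain N where N: "\<And>m n. m \<ge> N \<Longrightarrow> n \<ge> N \<Longrightarrow> padic_abs CARD('a) (r m - r n) < e / 2"
      using C e unfolding padic_Cauchy_def by (meson half_gt_zero)
    obtain M where M: "inverse (real (Suc M)) < e" using reals_Archimedean[OF e] by blast
    have "dist (X n) x < e" if n: "n \<ge> max N M" for n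
    proof -
      have "padic_norm (x - of_rat (r n)) \<le> e / 2"
        using padic_norm_abs_minus_of_rat[OF C, of "r n"] unfolding x_def
        by (rule LIMSEQ_le_const2) (use N n in \<open>auto intro!: less_imp_le exI[of _ N]\<close>)
      moreover have "1 / real (Suc n) \<le> inverse (real (Suc M))" using n by (simp add: field_simps)
      ultimately show ?thesis
        using padic_dist_ultra[of "X n" x "of_rat (r n)"] r[of n] M e
        by (simp add: dist_commute[of _ x]) (simp add: dist_padic_def)
    qed
    then show "\<exists>N. \<forall>n\<ge>N. dist (X n) x < e" by blast
  qed
  then show "convergent X" by (auto simp: convergent_def)
qed

section \<open>Compactness of balls and second countability\<close>

lemma pball_finite_cover:
  "\<exists>A. finite A \<and> pball (a :: 'p::prime_card padic) (j + int n) \<subseteq> (\<Union>x\<in>A. pball x j)"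
proof (induction n arbitrary: a)
  case 0
  show ?case by (intro exI[of _ "{a}"]) auto
next
  case (Suc n)
  let ?b = "\<lambda>i. a + of_nat i * pscale (j + int n + 1)"
  have "\<forall>i. \<exists>A. finite A \<and> pball (?b i) (j + int n) \<subseteq> (\<Union>x\<in>A. pball x j)"
    using Suc.IH by (rule allI)
  from choice[OF this] obtain A where A: "\<And>i. finite (A i)"
    "\<And>i. pball (?b i) (j + int n) \<subseteq> (\<Union>x\<in>A i. pball x j)" by auto
  have eq: "j + int (Suc n) = (j + int n) + 1" by simp
  show ?case unfolding eq pball_split(1)[of a "j + int n"]
  proof (intro exI[of _ "\<Union>i<CARD('p). A i"] conjI)
    show "(\<Union>i<CARD('p). pball (?b i) (j + int n)) \<subseteq> (\<Union>x\<in>(\<Union>i<CARD('p). A i). pball x j)"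
    proof
      fix y assume "y \<in> (\<Union>i<CARD('p). pball (?b i) (j + int n))"
      then obtain i where i: "i < CARD('p)" "y \<in> pball (?b i) (j + int n)" by blast
      then obtain x where "x \<in> A i" "y \<in> pball x j" using A(2)[of i] by blast
      then show "y \<in> (\<Union>x\<in>(\<Union>i<CARD('p). A i). pball x j)" using i(1) by blast
    qed
  qed (use A(1) in simp)
qed

lemma compact_pball: "compact (pball (a :: 'p::prime_card padic) k)"
  unfolding compact_eq_totally_bounded
proof (intro conjI allI impI)
  show "complete (pball a k)" by (simp add: complete_eq_closed closed_pball)
  fix e :: real assume e: "e > 0"
  obtain j0 where j0: "real CARD('p) powr of_int j0 < e" using padic_radius_below[OF e] by blast
  define j where "j = min j0 k"
  have "real CARD('p) powr of_int j \<le> real CARD('p) powr of_int j0"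
    using prime_card_gt_1[where ?'p = 'p] by (intro powr_mono) (auto simp: j_def)
  then have j: "real CARD('p) powr of_int j < e" using j0 by linarith
  obtain A where A: "finite A" "pball a (j + int (nat (k - j))) \<subseteq> (\<Union>x\<in>A. pball x j)"
    using pball_finite_cover[of a j "nat (k - j)"] by (elim exE conjE)
  have jk: "j + int (nat (k - j)) = k" by (simp add: j_def)
  have "pball a k \<subseteq> (\<Union>x\<in>A. pball x j)" using A(2) unfolding jk .
  moreover have "(\<Union>x\<in>A. pball x j) \<subseteq> (\<Union>x\<in>A. ball x e)"
  proof
    fix y assume "y \<in> (\<Union>x\<in>A. pball x j)"
    then obtain x where x: "x \<in> A" "y \<in> pball x j" by (elim UN_E)
    then have "dist x y < e" using j unfolding pball_mem by linarith
    then show "y \<in> (\<Union>x\<in>A. ball x e)" using x(1) by (intro UN_I) simp_all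
  qed
  ultimately have "pball a k \<subseteq> (\<Union>x\<in>A. ball x e)" by (rule order.trans)
  then show "\<exists>A. finite A \<and> pball a k \<subseteq> (\<Union>x\<in>A. ball x e)" using A(1) by blast
qed

lemma padic_balls_basis:
  fixes U :: "'p::prime_card padic set"
  assumes "open U" "x \<in> U"
  obtains r :: rat and k :: int where "x \<in> pball (of_rat r) k" "pball (of_rat r) k \<subseteq> U"
proof -
  obtain e where e: "e > 0" "ball x e \<subseteq> U" using assms openE by blast
  obtain k where k: "pball x k \<subseteq> ball x e" using pball_subset_ball[OF e(1)] by blast
  obtain r where r: "dist x (of_rat r) < real CARD('p) powr k"
    using padic_rat_dense[of "real CARD('p) powr k"] by auto
  then have "of_rat r \<in> pball x k" by (simp add: pball_def)
  then have "pball (of_rat r) k = pball x k" by (rule pball_eq)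
  then show thesis using that[of r k] k e by auto
qed

lemma padic_topological_basis:
  "topological_basis (range (\<lambda>(r, k). pball (of_rat r :: 'p::prime_card padic) k))" (is "topological_basis ?B")
proof (rule topological_basisI)
  show "open B" if "B \<in> ?B" for B using that open_pball by auto
  fix U :: "'p padic set" and x assume "open U" "x \<in> U"
  then obtain r k where "x \<in> pball (of_rat r) k" "pball (of_rat r) k \<subseteq> U"
    by (rule padic_balls_basis)
  then show "\<exists>B\<in>?B. x \<in> B \<and> B \<subseteq> U"
    by (intro bexI[of _ "pball (of_rat r) k"]) auto
qed

text \<open>Second countability identifies the Borel sets of the product space with the product
  sigma-algebra (\<open>borel_prod\<close>), which makes continuous kernels jointly
  measurable.\<close>

instance padic :: (prime_card) second_countable_topology
proof
  show "\<exists>B::'a padic set set. countable B \<and> open = generate_topology B"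
    using topological_basis_imp_subbasis[OF padic_topological_basis[where ?'p = 'a]]
    by (intro exI[of _ "range (\<lambda>(r, k). pball (of_rat r :: 'a padic) k)"]) auto
qed

section \<open>The weighted measure\<close>

lemma pball_translate: "(\<lambda>x. a + x) ` pball 0 k = pball (a :: 'p::prime_card padic) k"
proof (intro equalityI subsetI)
  fix y assume "y \<in> pball a k"
  then have "y - a \<in> pball 0 k" by (simp add: pball_mem dist_commute[of 0] dist_commute[of a]) (simp add: dist_padic_def)
  then show "y \<in> (\<lambda>x. a + x) ` pball 0 k" by (intro image_eqI[of _ _ "y - a"]) auto
next
  fix y assume "y \<in> (\<lambda>x. a + x) ` pball 0 k"
  then show "y \<in> pball a k" by (auto simp: pball_mem dist_padic_def)
qed

lemma borel_pball [measurable]: "pball (a :: 'p::prime_card padic) k \<in> sets borel"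
  using closed_pball by (rule borel_closed)

text \<open>By translation invariance the p disjoint children of a ball have equal measure, so one
  level up multiplies the measure by p; the unit ball fixes the normalisation.\<close>

lemma haar_pball:
  fixes m :: "'p::prime_card padic measure"
  assumes "haar_measure m"
  shows "emeasure m (pball a k) = ennreal (real CARD('p) powr k)"
proof -
  let ?P = "real CARD('p)"
  have P: "1 < ?P" using prime_card_gt_1[where ?'p = 'p] by simp
  have sets: "sets m = sets borel"
    and trans: "\<And>a A. A \<in> sets borel \<Longrightarrow> emeasure m ((\<lambda>x. a + x) ` A) = emeasure m A"
    and one: "emeasure m {x. padic_norm x \<le> 1} = 1"
    using assms unfolding haar_measure_def by blast+
  define e where "e = (\<lambda>j. emeasure m (pball 0 j))"
  have tr: "emeasure m (pball b j) = e j" for b j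
    unfolding e_def pball_translate[of b, symmetric] by (rule trans) simp
  have step: "e (j + 1) = ennreal ?P * e j" for j
  proof -
    have "e (j + 1) = (\<Sum>i<CARD('p). emeasure m (pball (0 + of_nat i * pscale (j + 1)) j))"
      unfolding e_def pball_split(1)[of _ j]
    proof (rule sum_emeasure[symmetric])
      show "disjoint_family_on (\<lambda>i. pball (0 + of_nat i * pscale (j + 1) :: 'p padic) j) {..<CARD('p)}"
        by (rule pball_split(2))
      show "(\<lambda>i. pball (0 + of_nat i * pscale (j + 1)) j) ` {..<CARD('p)} \<subseteq> sets m"
        unfolding sets by (intro image_subsetI borel_pball)
    qed simp
    then show ?thesis by (simp add: tr ennreal_of_nat_eq_real_of_nat)
  qed
  have "e k = ennreal (?P powr k)"
  proof (induction k rule: int_induct[where k = 0])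
    case base
    have "pball 0 0 = {x :: 'p padic. padic_norm x \<le> 1}"
      using P by (auto simp: pball_mem padic_norm_eq_dist dist_commute)
    then show ?case using one P by (simp add: e_def)
  next
    case (step1 i)
    then show ?case using P by (simp add: step powr_add ennreal_mult[symmetric] mult.commute)
  next
    case (step2 i)
    have "ennreal ?P * e (i - 1) = ennreal (?P powr of_int i)"
      using step[of "i - 1"] step2 by simp
    also have "\<dots> = ennreal ?P * ennreal (?P powr of_int (i - 1))"
      using P by (simp add: ennreal_mult[symmetric] powr_diff)
    finally show ?case using P by (simp add: ennreal_mult_cancel_left)
  qed
  then show ?thesis by (simp add: tr)
qed

lemma term_le_suminf: "f i \<le> suminf (f :: nat \<Rightarrow> ennreal)"
  using sum_le_suminf[of f "{i}"] by simp

locale hweight =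
  fixes m :: "'p::prime_card padic measure" and \<alpha> \<beta> :: real
  assumes haar: "haar_measure m"
    and alpha_pos: "0 < \<alpha>" and alpha_less: "\<alpha> < 1"
    and beta_ge: "(\<alpha> - 1) / 2 \<le> \<beta>" and beta_less: "\<beta> < \<alpha>"
begin

definition P :: real where "P = real CARD('p)"

definition q :: "int \<Rightarrow> real" where "q k = P powr of_int k"

abbreviation M :: "'p padic measure" where "M \<equiv> weighted_measure m \<beta>"

abbreviation Lop :: "('p padic \<Rightarrow> complex) \<Rightarrow> 'p padic \<Rightarrow> complex" where
  "Lop \<equiv> calL_op m \<alpha> \<beta>"

abbreviation Lclos :: "('p padic \<Rightarrow> complex) \<Rightarrow> ('p padic \<Rightarrow> complex) \<Rightarrow> bool" where
  "Lclos \<equiv> calL_closure m \<alpha> \<beta>"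

abbreviation nrm :: "'p padic \<Rightarrow> real" where "nrm \<equiv> padic_norm"

lemma P_gt_1: "1 < P"
  using prime_card_gt_1[where ?'p = 'p] by (simp add: P_def)

lemma P_pos: "0 < P" using P_gt_1 by simp

lemma beta_gt: "- 1 < \<beta>" using beta_ge alpha_pos by simp

lemma q_pos [simp]: "0 < q k" and q_nonneg [simp]: "0 \<le> q k" and q_nz [simp]: "q k \<noteq> 0"
  using P_pos by (simp_all add: q_def)

lemma q_add: "q (j + k) = q j * q k" by (simp add: q_def powr_add)

lemma q_0 [simp]: "q 0 = 1" using P_pos by (simp add: q_def)

lemma q_1 [simp]: "q 1 = P" using P_pos by (simp add: q_def)

lemma q_le_iff [simp]: "q j \<le> q k \<longleftrightarrow> j \<le> k" using P_gt_1 by (simp add: q_def)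

lemma q_less_iff [simp]: "q j < q k \<longleftrightarrow> j < k" using P_gt_1 by (simp add: q_def)

lemma q_powr: "q k powr s = P powr (of_int k * s)" by (simp add: q_def powr_powr)

lemma mem_pball: "y \<in> pball x k \<longleftrightarrow> dist x y \<le> q k" for x y :: "'p padic"
  by (simp add: pball_mem q_def P_def)

lemma dist_gt_q: "\<not> dist x y \<le> q k \<Longrightarrow> q (k + 1) \<le> dist x y" for x y :: "'p padic"
  using padic_dist_discrete[of x y k] by (simp add: q_def P_def)

lemma dist_eq_q: 
  fixes x y :: "'p padic" assumes "x \<noteq> y" obtains k where "dist x y = q k"
  using padic_dist_values[OF assms] by (auto simp: q_def P_def)

lemma q_below: assumes "0 < e" obtains k where "q k < e"
  using assms padic_radius_below[of e, where ?'p = 'p] by (auto simp: q_def P_def)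

lemma q_above: obtains k where "e < q k"
  using padic_radius_above[of e, where ?'p = 'p] by (auto simp: q_def P_def)

lemma sets_m [measurable_cong, simp]: "sets m = sets borel" using haar by (simp add: haar_measure_def)

lemma sets_M [measurable_cong, simp]: "sets M = sets borel"
  by (simp add: weighted_measure_def sets_m)

lemma space_M [simp]: "space M = UNIV"
  using sets_eq_imp_space_eq[OF sets_M] by simp

lemma nrm_measurable [measurable]: "nrm \<in> borel_measurable borel"
  unfolding padic_norm_eq_dist by measurable

lemma norm_powr_measurable: "norm_powr s \<in> borel_measurable (borel :: 'p padic measure)"
  unfolding norm_powr_def by measurable

lemma norm_powr_measurable_m: "norm_powr s \<in> borel_measurable m"
  unfolding measurable_cong_sets[OF sets_m refl] by (rule norm_powr_measurable)

lemma emeasure_m: "emeasure m (pball x k) = ennreal (q k)"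
  using haar_pball[OF haar] by (simp add: q_def P_def)

lemma m_singleton: "emeasure m {x} = 0"
proof -
  have "emeasure m {x} \<le> ennreal e" if e: "0 < e" for e
  proof -
    obtain k where k: "q k < e" using q_below e by blast
    have "emeasure m {x} \<le> emeasure m (pball x k)" by (rule emeasure_mono) (auto simp: sets_m)
    also have "\<dots> \<le> ennreal e" using k by (simp add: emeasure_m ennreal_leI)
    finally show ?thesis .
  qed
  then have "emeasure m {x} \<le> 0 + ennreal e" if "0 < e" for e using that by simp
  then have "emeasure m {x} \<le> 0" by (rule ennreal_le_epsilon)
  then show ?thesis by simp
qed

lemma AE_m_neq: "AE y in m. y \<noteq> x"
  by (rule AE_I[of _ _ "{x}"]) (auto simp: m_singleton sets_m)

text \<open>Kernels below are infinite on the diagonal, where \<open>enn2real\<close> returns 0.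
  Since points are null, this discrepancy does not affect integrals.\<close>

lemma AE_M_neq: "AE y in M. y \<noteq> x"
  unfolding weighted_measure_def AE_density[OF norm_powr_measurable_m]
  using AE_m_neq[of x] by (rule AE_mp) (rule AE_I2, simp)

lemma emeasure_M: "A \<in> sets borel \<Longrightarrow> emeasure M A = (\<integral>\<^sup>+y. norm_powr \<beta> y * indicator A y \<partial>m)"
  unfolding weighted_measure_def
  by (rule emeasure_density[OF norm_powr_measurable_m]) (simp add: sets_m)

subsection \<open>Two-sided bounds for the measure of balls\<close>

text \<open>The largest norm occurring in \<open>pball x k\<close>: the common norm of all points if
  the ball misses 0, and its radius if it contains 0.\<close>

definition N :: "'p padic \<Rightarrow> int \<Rightarrow> real" where "N x k = max (nrm x) (q k)"

text \<open>Model for the weighted measure of \<open>pball x k\<close>: Haar measure times the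
  density at the largest norm.\<close>

definition W :: "'p padic \<Rightarrow> int \<Rightarrow> real" where "W x k = q k * N x k powr \<beta>"

lemma N_pos [simp]: "0 < N x k" by (simp add: N_def less_max_iff_disj)

lemma N_nz [simp]: "N x k \<noteq> 0" using N_pos[of x k] by linarith

lemma W_pos [simp]: "0 < W x k" by (simp add: W_def)

text \<open>\<open>N x (k + i)\<close> lies between \<open>N x k\<close> and
  \<open>N x k * q i\<close>. The sign of \<open>s\<close> decides which end gives the bound, hence
  \<open>max s 0\<close>. All decay rates of the later geometric series come from this
  inequality.\<close>

lemma N_powr_le:
  assumes "0 \<le> i"
  shows "N x (k + i) powr s \<le> N x k powr s * q i powr (max s 0)"
proof -
  have q1: "1 \<le> q i" using q_le_iff[of 0 i] assms by simp
  have le: "N x k \<le> N x (k + i)"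
    using q_le_iff[of k "k + i"] assms unfolding N_def by linarith
  have "nrm x \<le> nrm x * q i" using q1 padic_norm_nonneg[of x] by (simp add: mult_le_cancel_left1)
  also have "\<dots> \<le> N x k * q i" by (intro mult_right_mono) (auto simp: N_def)
  finally have "nrm x \<le> N x k * q i" .
  moreover have "q (k + i) \<le> N x k * q i" unfolding q_add by (intro mult_right_mono) (auto simp: N_def)
  ultimately have ge: "N x (k + i) \<le> N x k * q i" by (auto simp: N_def)
  show ?thesis
  proof (cases "s \<ge> 0")
    case True
    then have "N x (k + i) powr s \<le> (N x k * q i) powr s"
      using ge less_imp_le[OF N_pos] by (intro powr_mono2) auto
    then show ?thesis using True by (simp add: powr_mult)
  next
    case False
    then show ?thesis using le by (simp add: powr_mono2')
  qed
qed

lemma nrm_eq_on_pball: "\<not> nrm x \<le> q k \<Longrightarrow> y \<in> pball x k \<Longrightarrow> nrm y = nrm x"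
  using padic_dist_isosceles[of y x 0] by (auto simp: padic_norm_eq_dist mem_pball dist_commute)

text \<open>The fraction of the Haar measure of a ball about 0 that its outermost sphere
  carries.\<close>

definition cW :: real where "cW = 1 - 1 / P"

text \<open>The geometric series of ratio p^(-(1 + \<beta>)), produced by the concentric balls about
  0; it converges because \<beta> > -1.\<close>

definition CW :: real where "CW = 1 / (1 - P powr (- (1 + \<beta>)))"

lemma P_powr_neg_less: "0 < s \<Longrightarrow> P powr (- s) < 1"
  using P_gt_1 powr_less_mono[of "- s" 0 P] by simp

lemma cW_pos: "0 < cW" using P_gt_1 by (simp add: cW_def)

lemma CW_ge_1: "1 \<le> CW"
  using P_powr_neg_less[of "1 + \<beta>"] beta_gt P_pos by (simp add: CW_def field_simps)

lemma sums_q: 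
  assumes "0 < s"
  shows "(\<lambda>i. q (int i) powr (- s)) sums (1 / (1 - P powr (- s)))"
proof -
  have "(\<lambda>i. (P powr (- s)) ^ i) sums (1 / (1 - P powr (- s)))"
    using P_powr_neg_less[OF assms] P_pos by (intro geometric_sums) simp
  moreover have "(P powr (- s)) ^ i = q (int i) powr (- s)" for i
    using P_pos by (simp add: q_powr powr_powr powr_realpow[symmetric] mult.commute)
  ultimately show ?thesis by simp
qed

text \<open>On a ball that misses 0 the density is constant. A ball that contains 0 may be recentred
  there, and then its spheres are treated separately.\<close>

lemma emeasure_M_bounds:
  "ennreal (cW * W x k) \<le> emeasure M (pball x k) \<and> emeasure M (pball x k) \<le> ennreal (CW * W x k)"
proof (cases "nrm x \<le> q k")
  case False
  have "emeasure M (pball x k) = (\<integral>\<^sup>+y. ennreal (nrm x powr \<beta>) * indicator (pball x k) y \<partial>m)"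
    unfolding emeasure_M[OF borel_pball]
  proof (rule nn_integral_cong)
    fix y
    have "norm_powr \<beta> y = ennreal (nrm x powr \<beta>)" if "y \<in> pball x k"
    proof -
      have eq: "nrm y = nrm x" by (rule nrm_eq_on_pball[OF False that])
      have "nrm x \<noteq> 0" using False q_nonneg[of k] by linarith
      then have "y \<noteq> 0" using eq padic_norm_eq_0_iff[of y] by simp
      then show ?thesis by (simp add: norm_powr_def eq)
    qed
    then show "norm_powr \<beta> y * indicator (pball x k) y
        = ennreal (nrm x powr \<beta>) * indicator (pball x k) y"
      by (cases "y \<in> pball x k") auto
  qed
  also have "\<dots> = ennreal (nrm x powr \<beta>) * ennreal (q k)"
    by (subst nn_integral_cmult_indicator) (auto simp: sets_m emeasure_m)
  also have "\<dots> = ennreal (W x k)"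
    using False by (simp add: W_def N_def ennreal_mult[symmetric] mult.commute)
  finally have "emeasure M (pball x k) = ennreal (W x k)" .
  moreover have "cW * W x k \<le> W x k" "W x k \<le> CW * W x k"
    using CW_ge_1 P_gt_1 less_imp_le[OF W_pos[of x k]]
    by (auto simp: cW_def mult_le_cancel_right1 mult_le_cancel_right2)
  ultimately show ?thesis by (simp add: ennreal_leI)
next
  case True
  then have "x \<in> pball 0 k" by (simp add: mem_pball padic_norm_eq_dist dist_commute)
  then have eq: "pball x k = pball 0 k" by (rule pball_eq)
  have W: "W x k = q k powr (1 + \<beta>)" using True by (simp add: W_def N_def powr_add)
  have qk: "q (k - 1) = q k / P"
    using q_add[of "k - 1" 1] P_pos by (simp add: field_simps)
  \<comment> \<open>Lower bound: only the outermost sphere is kept, where the norm equals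
    \<open>q k\<close>.\<close>
  have "cW * W x k = q k powr \<beta> * (q k - q (k - 1))"
    unfolding qk W cW_def using P_pos by (simp add: powr_add field_simps)
  moreover have "0 \<le> q k - q (k - 1)" using q_le_iff[of "k - 1" k] by linarith
  ultimately have "ennreal (cW * W x k) = ennreal (q k powr \<beta>) * ennreal (q k - q (k - 1))"
    by (simp add: ennreal_mult)
  also have "ennreal (q k - q (k - 1)) = emeasure m (pball 0 k - pball 0 (k - 1))"
    using pball_mono[of "k - 1" k "0 :: 'p padic"]
    by (subst emeasure_Diff) (auto simp: sets_m emeasure_m ennreal_minus[symmetric])
  also have "ennreal (q k powr \<beta>) * emeasure m (pball 0 k - pball 0 (k - 1))
      = (\<integral>\<^sup>+y. ennreal (q k powr \<beta>) * indicator (pball 0 k - pball 0 (k - 1)) y \<partial>m)"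
    by (subst nn_integral_cmult_indicator) (auto simp: sets_m)
  also have "\<dots> \<le> (\<integral>\<^sup>+y. norm_powr \<beta> y * indicator (pball 0 k) y \<partial>m)"
  proof (rule nn_integral_mono)
    fix y :: "'p padic"
    have "norm_powr \<beta> y = ennreal (q k powr \<beta>)" if y: "y \<in> pball 0 k" "y \<notin> pball 0 (k - 1)"
    proof -
      have "nrm y = q k" using y dist_gt_q[of 0 y "k - 1"]
        by (simp add: mem_pball padic_norm_eq_dist dist_commute)
      then show ?thesis using q_nz[of k] by (auto simp: norm_powr_def padic_norm_eq_0_iff[THEN iffD2])
    qed
    then show "ennreal (q k powr \<beta>) * indicator (pball 0 k - pball 0 (k - 1)) y
        \<le> norm_powr \<beta> y * indicator (pball 0 k) y"
      by (auto split: split_indicator)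
  qed
  also have "\<dots> = emeasure M (pball x k)" by (simp add: emeasure_M eq)
  finally have lower: "ennreal (cW * W x k) \<le> emeasure M (pball x k)" .
  \<comment> \<open>Upper bound: the density is dominated by a sum over concentric balls. At a point
    of norm \<open>q (k - i)\<close> the term number \<open>i\<close> already equals it.\<close>
  have "emeasure M (pball x k)
      \<le> (\<integral>\<^sup>+y. (\<Sum>i. ennreal (q (k - int i) powr \<beta>) * indicator (pball 0 (k - int i)) y) \<partial>m)"
    unfolding eq emeasure_M[OF borel_pball]
  proof (rule nn_integral_mono_AE, rule AE_mp[OF AE_m_neq[of 0]], rule AE_I2, rule impI)
    fix y :: "'p padic" assume y0: "y \<noteq> 0"
    show "norm_powr \<beta> y * indicator (pball 0 k) y
        \<le> (\<Sum>i. ennreal (q (k - int i) powr \<beta>) * indicator (pball 0 (k - int i)) y)" (is "_ \<le> suminf ?f")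
    proof (cases "y \<in> pball 0 k")
      case True
      obtain j where j: "dist 0 y = q j" using dist_eq_q y0 by metis
      have "j \<le> k" using True j by (simp add: mem_pball)
      then have kj: "k - int (nat (k - j)) = j" by simp
      have "norm_powr \<beta> y * indicator (pball 0 k) y = ?f (nat (k - j))"
        unfolding kj using y0 j True by (simp add: norm_powr_def padic_norm_eq_dist dist_commute mem_pball)
      also have "\<dots> = sum ?f {nat (k - j)}" by simp
      also have "\<dots> \<le> suminf ?f" by (rule sum_le_suminf) auto
      finally show ?thesis .
    qed simp
  qed
  also have "\<dots> = (\<Sum>i. \<integral>\<^sup>+y. ennreal (q (k - int i) powr \<beta>) * indicator (pball 0 (k - int i)) y \<partial>m)"
    by (rule nn_integral_suminf) measurable
  also have "\<dots> = (\<Sum>i. ennreal (W x k * q (int i) powr (- (1 + \<beta>))))"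
  proof (rule suminf_cong)
    fix i
    have "q (k - int i) powr \<beta> * q (k - int i) = q (k - int i) powr (1 + \<beta>)"
      by (simp add: powr_add)
    also have "\<dots> = W x k * q (int i) powr (- (1 + \<beta>))"
      unfolding W q_powr powr_add[symmetric] by (simp add: algebra_simps)
    finally have "q (k - int i) powr \<beta> * q (k - int i) = W x k * q (int i) powr (- (1 + \<beta>))" .
    then show "(\<integral>\<^sup>+y. ennreal (q (k - int i) powr \<beta>) * indicator (pball 0 (k - int i)) y \<partial>m)
        = ennreal (W x k * q (int i) powr (- (1 + \<beta>)))"
      by (subst nn_integral_cmult_indicator) (auto simp: sets_m emeasure_m ennreal_mult[symmetric])
  qed
  also have "\<dots> = ennreal (W x k * CW)"
    unfolding CW_def
    by (intro suminf_ennreal_eq sums_mult sums_q) (use less_imp_le[OF W_pos] beta_gt in auto)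
  finally show ?thesis using lower by (simp add: mult.commute)
qed

definition mu :: "'p padic \<Rightarrow> int \<Rightarrow> real" where "mu x k = measure M (pball x k)"

lemma emeasure_M_pball: "emeasure M (pball x k) = ennreal (mu x k)"
  unfolding mu_def using emeasure_M_bounds[of x k]
  by (intro emeasure_eq_ennreal_measure) (auto simp: top_unique)

lemma mu_ge: "cW * W x k \<le> mu x k" and mu_le: "mu x k \<le> CW * W x k"
proof -
  have "0 \<le> CW * W x k" using CW_ge_1 less_imp_le[OF W_pos[of x k]] by simp
  moreover have "0 \<le> mu x k" by (simp add: mu_def)
  ultimately show "cW * W x k \<le> mu x k" "mu x k \<le> CW * W x k"
    using emeasure_M_bounds[of x k] unfolding emeasure_M_pball by (simp_all only: ennreal_le_iff)
qed

lemma mu_pos [simp]: "0 < mu x k"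
  using mu_ge[of x k] cW_pos W_pos[of x k] by (smt (verit) mult_pos_pos)

lemma mu_cong: "y \<in> pball x k \<Longrightarrow> mu y k = mu x k"
  unfolding mu_def using pball_eq by metis

lemma sigma_finite_M: "sigma_finite_measure M"
proof
  let ?A = "range (\<lambda>n. pball (0 :: 'p padic) (int n))"
  have "x \<in> \<Union>?A" for x :: "'p padic"
  proof -
    obtain k where "nrm x < q k" using q_above by blast
    moreover have "q k \<le> q (int (nat k))" unfolding q_le_iff by linarith
    ultimately have "dist 0 x \<le> q (int (nat k))"
      unfolding padic_norm_eq_dist dist_commute[of 0] by linarith
    then have "x \<in> pball 0 (int (nat k))" unfolding mem_pball .
    then show ?thesis by blast
  qed
  then have U: "\<Union>?A = space M" by auto
  show "\<exists>A. countable A \<and> A \<subseteq> sets M \<and> \<Union>A = space M \<and> (\<forall>a\<in>A. emeasure M a \<noteq> \<infinity>)"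
    by (rule exI[of _ ?A]) (use U in \<open>auto simp: emeasure_M_pball\<close>)
qed

sublocale sigma_finite_measure M by (rule sigma_finite_M)

sublocale MM: pair_sigma_finite M M ..

section \<open>Truncated jump kernels and the resolvent coefficients\<close>

definition cJ :: real where "cJ = - 1 / padic_Gamma CARD('p) (- \<alpha>)"

lemma cJ_pos: "0 < cJ"
proof -
  have "P powr (- \<alpha> - 1) < 1" using P_powr_neg_less[of "\<alpha> + 1"] alpha_pos by simp
  moreover have "1 < P powr \<alpha>" using P_gt_1 alpha_pos by simp
  ultimately have "padic_Gamma CARD('p) (- \<alpha>) < 0"
    by (simp add: padic_Gamma_def P_def[symmetric] divide_pos_neg)
  then show ?thesis by (simp add: cJ_def divide_neg_neg)
qed

text \<open>The jump kernel truncated at distance \<open>p\<^sup>k\<close>. On functions that are constant on balls of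
  radius \<open>p\<^sup>k\<close> the truncation does not change \<open>\<L>\<close>, and it makes the two halves of
  \<open>(u(x) - u(y)) J(x,y)\<close> separately integrable.\<close>

definition Jk :: "int \<Rightarrow> 'p padic \<Rightarrow> 'p padic \<Rightarrow> real" where
  "Jk k x y = cJ * max (dist x y) (q k) powr (- 1 - \<alpha>)"

lemma jump_kernel_eq: "jump_kernel \<alpha> x y = cJ * dist x y powr (- 1 - \<alpha>)" for x y :: "'p padic"
  by (simp add: jump_kernel_def cJ_def dist_padic_def)

lemma Jk_eq_jump: "q k \<le> dist x y \<Longrightarrow> Jk k x y = jump_kernel \<alpha> x y"
  by (simp add: Jk_def jump_kernel_eq max_def)

lemma Jk_nonneg [simp]: "0 \<le> Jk k x y"
  using cJ_pos by (simp add: Jk_def)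

lemma Jk_sym: "Jk k x y = Jk k y x"
  by (simp add: Jk_def dist_commute)

text \<open>The distance to \<open>y\<close> is cut off from below at \<open>q k\<close>, so moving
  \<open>x\<close> by at most \<open>q k\<close> is invisible to the kernel.\<close>

lemma Jk_cong:
  assumes "x' \<in> pball x k" shows "Jk k x' y = Jk k x y"
proof -
  have "max (dist x' y) (q k) = max (dist x y) (q k)"
    using padic_dist_ultra[of x' y x] padic_dist_ultra[of x y x'] assms
    by (simp add: mem_pball dist_commute[of x' x] max_def split: if_splits)
  then show ?thesis by (simp add: Jk_def)
qed

lemma Jk_measurable2: "(\<lambda>(x, y). Jk k x y) \<in> borel_measurable (borel \<Otimes>\<^sub>M borel)"
  unfolding Jk_def by measurable

lemma Jk_measurable [measurable]: "Jk k x \<in> borel_measurable borel"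
  unfolding Jk_def by measurable

text \<open>The order of magnitude of the eigenvalue \<open>lam x k\<close>: the jump kernel at
  distance \<open>q k\<close> times the mass \<open>W x k\<close>, up to constants
  (\<open>W_V\<close>).\<close>

definition V :: "'p padic \<Rightarrow> int \<Rightarrow> real" where "V x k = N x k powr \<beta> * q k powr (- \<alpha>)"

lemma V_pos [simp]: "0 < V x k" by (simp add: V_def)

lemma V_nonneg [simp]: "0 \<le> V x k" by (simp add: V_def)

lemma W_V: "q k powr (- 1 - \<alpha>) * W x k = V x k"
proof -
  have "q k powr (- 1 - \<alpha>) * q k = q k powr (- \<alpha>)"
    using powr_add[of "q k" "- 1 - \<alpha>" 1] by simp
  then show ?thesis by (simp add: W_def V_def)
qed

text \<open>The rate \<open>\<alpha> - max \<beta> 0\<close> is positive. Read upwards it makes the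
  integral of \<open>Jk\<close> converge; read downwards it makes the eigenvalues tend to infinity
  on small balls.\<close>

lemma V_shift:
  assumes "0 \<le> i"
  shows "V x (k + i) \<le> V x k * q i powr (- (\<alpha> - max \<beta> 0))"
proof -
  have "V x (k + i) \<le> (N x k powr \<beta> * q i powr (max \<beta> 0)) * q (k + i) powr (- \<alpha>)"
    unfolding V_def using N_powr_le[OF assms] by (intro mult_right_mono) auto
  also have "\<dots> = V x k * (q i powr (max \<beta> 0) * q i powr (- \<alpha>))"
    by (simp add: V_def q_add powr_mult)
  also have "q i powr (max \<beta> 0) * q i powr (- \<alpha>) = q i powr (- (\<alpha> - max \<beta> 0))"
    by (simp flip: powr_add)
  finally show ?thesis .
qed

lemma V_antimono: "j \<le> k \<Longrightarrow> V x k \<le> V x j"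
proof -
  assume jk: "j \<le> k"
  have "q (k - j) powr (- (\<alpha> - max \<beta> 0)) \<le> 1"
    using jk P_gt_1 alpha_pos beta_less powr_mono[of "of_int (k - j) * (- (\<alpha> - max \<beta> 0))" 0 P]
    by (simp add: q_powr mult_nonneg_nonpos)
  then have "V x j * q (k - j) powr (- (\<alpha> - max \<beta> 0)) \<le> V x j"
    using less_imp_le[OF V_pos] by (rule mult_left_le)
  moreover have "V x k \<le> V x j * q (k - j) powr (- (\<alpha> - max \<beta> 0))"
    using V_shift[of "k - j" x j] jk by simp
  ultimately show ?thesis by (rule order.trans[rotated])
qed

text \<open>One step up costs only a constant factor, so the eigenvalue of the parent in the
  denominator of \<open>G_coeff\<close> can be compared with \<open>V x k\<close>. The bound on
  \<open>N\<close> is applied to the exponent \<open>- \<beta>\<close> and inverted.\<close>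

lemma V_Suc_ge: "V x k * P powr (- \<alpha> - max (- \<beta>) 0) \<le> V x (k + 1)"
proof -
  have "N x (k + 1) powr (- \<beta>) \<le> N x k powr (- \<beta>) * P powr max (- \<beta>) 0"
    using N_powr_le[of 1 x k "- \<beta>"] by simp
  then have "N x k powr \<beta> * P powr (- max (- \<beta>) 0) \<le> N x (k + 1) powr \<beta>"
    using P_pos by (simp add: powr_minus field_simps)
  then have "N x k powr \<beta> * P powr (- max (- \<beta>) 0) * (q k powr (- \<alpha>) * P powr (- \<alpha>))
      \<le> N x (k + 1) powr \<beta> * (q k powr (- \<alpha>) * P powr (- \<alpha>))"
    by (intro mult_right_mono) auto
  moreover have "q (k + 1) powr (- \<alpha>) = q k powr (- \<alpha>) * P powr (- \<alpha>)"
    by (simp add: q_add powr_mult)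
  moreover have "P powr (- \<alpha> - max (- \<beta>) 0) = P powr (- max (- \<beta>) 0) * P powr (- \<alpha>)"
    unfolding powr_add[symmetric] by (rule arg_cong[where f = "(powr) P"]) linarith
  ultimately show ?thesis by (simp add: V_def mult_ac)
qed

definition CL :: real where "CL = cJ * CW * (1 / (1 - P powr (- (\<alpha> - max \<beta> 0))))"

definition cL :: real where "cL = cJ * cW"

lemma cL_pos: "0 < cL" using cJ_pos cW_pos by (simp add: cL_def)

lemma nn_integral_Jk_le: "(\<integral>\<^sup>+y. ennreal (Jk k x y) \<partial>M) \<le> ennreal (CL * V x k)"
proof -
  let ?s = "\<alpha> - max \<beta> 0"
  let ?f = "\<lambda>i y. ennreal (cJ * q (k + int i) powr (- 1 - \<alpha>)) * indicator (pball x (k + int i)) y"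
  have s: "0 < ?s" using alpha_pos beta_less by simp
  have "(\<integral>\<^sup>+y. ennreal (Jk k x y) \<partial>M) \<le> (\<integral>\<^sup>+y. (\<Sum>i. ?f i y) \<partial>M)"
  proof (rule nn_integral_mono)
    fix y
    \<comment> \<open>The same device as for the measure: one of the concentric balls about
      \<open>x\<close> reproduces the kernel exactly at \<open>y\<close>, and the remaining terms
      only add.\<close>
    have "\<exists>i. ennreal (Jk k x y) = ?f i y"
    proof (cases "y \<in> pball x k")
      case True
      then have "ennreal (Jk k x y) = ?f 0 y"
        by (simp add: Jk_def mem_pball max_def)
      then show ?thesis by blast
    next
      case False
      then have "x \<noteq> y" by auto
      then obtain j where j: "dist x y = q j" by (rule dist_eq_q)
      have "k \<le> j" using False j by (simp add: mem_pball)
      then have kj: "k + int (nat (j - k)) = j" by simp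
      have "ennreal (Jk k x y) = ?f (nat (j - k)) y"
        unfolding kj using j \<open>k \<le> j\<close> by (simp add: Jk_def mem_pball max_def)
      then show ?thesis by blast
    qed
    then obtain i where i: "ennreal (Jk k x y) = ?f i y" by blast
    show "ennreal (Jk k x y) \<le> (\<Sum>i. ?f i y)" unfolding i by (rule term_le_suminf)
  qed
  also have "\<dots> = (\<Sum>i. \<integral>\<^sup>+y. ?f i y \<partial>M)"
    by (rule nn_integral_suminf) simp
  also have "\<dots> \<le> (\<Sum>i. ennreal (cJ * CW * V x k * q (int i) powr (- ?s)))"
  proof (rule suminf_le)
    fix i
    have "(\<integral>\<^sup>+y. ?f i y \<partial>M) = ennreal (cJ * q (k + int i) powr (- 1 - \<alpha>) * mu x (k + int i))"
      using cJ_pos by (subst nn_integral_cmult_indicator) (auto simp: emeasure_M_pball ennreal_mult less_imp_le)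
    also have "cJ * q (k + int i) powr (- 1 - \<alpha>) * mu x (k + int i)
        \<le> cJ * q (k + int i) powr (- 1 - \<alpha>) * (CW * W x (k + int i))"
      using cJ_pos by (intro mult_left_mono mu_le) auto
    also have "\<dots> = cJ * CW * V x (k + int i)" by (simp flip: W_V)
    also have "\<dots> \<le> cJ * CW * (V x k * q (int i) powr (- ?s))"
      using cJ_pos CW_ge_1 by (intro mult_left_mono V_shift) auto
    finally show "(\<integral>\<^sup>+y. ?f i y \<partial>M) \<le> ennreal (cJ * CW * V x k * q (int i) powr (- ?s))"
      by (simp add: ennreal_leI mult.assoc)
  qed auto
  also have "\<dots> = ennreal (cJ * CW * V x k * (1 / (1 - P powr (- ?s))))"
    by (intro suminf_ennreal_eq sums_mult sums_q s)
       (use cJ_pos CW_ge_1 less_imp_le[OF V_pos[of x k]] in auto)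
  finally show ?thesis by (simp add: CL_def mult_ac)
qed

text \<open>\<open>lam a (n + 1)\<close> is the eigenvalue of \<open>\<L>\<close> on functions supported in \<open>pball a (n + 1)\<close>, of mean
  zero and constant on its \<open>p\<close> children.\<close>

definition lam :: "'p padic \<Rightarrow> int \<Rightarrow> real" where "lam x k = (\<integral>y. Jk k x y \<partial>M)"

lemma Jk_integrable: "integrable M (Jk k x)"
  unfolding integrable_iff_bounded
  using nn_integral_Jk_le[of k x] by (auto simp: less_top[symmetric] top_unique)

lemma lam_nn: "(\<integral>\<^sup>+y. ennreal (Jk k x y) \<partial>M) = ennreal (lam x k)"
  unfolding lam_def by (rule nn_integral_eq_integral[OF Jk_integrable]) simp

lemma lam_nonneg: "0 \<le> lam x k"
  unfolding lam_def by simp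

lemma indicator_pball_integrable: "integrable M (indicator (pball x k) :: _ \<Rightarrow> real)"
  by (rule integrable_real_indicator) (auto simp: emeasure_M_pball)

text \<open>Only the integral over \<open>pball x k\<close> itself is kept; there the truncated
  kernel is constant.\<close>

lemma lam_ge: "cL * V x k \<le> lam x k"
proof -
  have "cL * V x k = cJ * q k powr (- 1 - \<alpha>) * (cW * W x k)"
    by (simp add: cL_def flip: W_V)
  also have "\<dots> \<le> cJ * q k powr (- 1 - \<alpha>) * mu x k"
    using cJ_pos by (intro mult_left_mono mu_ge) auto
  also have "\<dots> = (\<integral>y. cJ * q k powr (- 1 - \<alpha>) * indicator (pball x k) y \<partial>M)"
    by (simp add: mu_def)
  also have "\<dots> \<le> lam x k" unfolding lam_def
  proof (rule integral_mono)
    show "integrable M (\<lambda>y. cJ * q k powr (- 1 - \<alpha>) * indicator (pball x k) y)"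
      using indicator_pball_integrable by (intro integrable_mult_right) auto
    fix y
    show "cJ * q k powr (- 1 - \<alpha>) * indicator (pball x k) y \<le> Jk k x y"
    proof (cases "y \<in> pball x k")
      case True
      then show ?thesis by (simp add: Jk_def mem_pball max_def)
    qed simp
  qed (rule Jk_integrable)
  finally show ?thesis .
qed

lemma lam_le: "lam x k \<le> CL * V x k"
proof -
  have "0 \<le> CL" using cJ_pos CW_ge_1 P_powr_neg_less[of "\<alpha> - max \<beta> 0"] alpha_pos beta_less
    by (auto simp: CL_def)
  then have "0 \<le> CL * V x k" using less_imp_le[OF V_pos[of x k]] by simp
  then show ?thesis using nn_integral_Jk_le[of k x] unfolding lam_nn by (simp only: ennreal_le_iff)
qed

lemma lam_pos [simp]: "0 < lam x k"
  using lam_ge[of x k] cL_pos V_pos[of x k] by (smt (verit) mult_pos_pos)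

lemma CL_pos: "0 < CL"
  using lam_le[of 0 0] lam_pos[of 0 0] V_pos[of 0 0] by (smt (verit) mult_nonpos_nonneg)

lemma lam_cong: "y \<in> pball x k \<Longrightarrow> lam y k = lam x k"
  unfolding lam_def by (intro Bochner_Integration.integral_cong Jk_cong refl)

text \<open>The drop of the truncated kernel inside \<open>pball x k\<close> when the truncation
  radius grows from \<open>q k\<close> to \<open>q (k + 1)\<close>.\<close>

definition dJ :: "int \<Rightarrow> real" where "dJ k = cJ * (1 - P powr (- 1 - \<alpha>)) * q k powr (- 1 - \<alpha>)"

lemma dJ_pos [simp]: "0 < dJ k"
  using cJ_pos P_powr_neg_less[of "1 + \<alpha>"] alpha_pos by (simp add: dJ_def)

text \<open>Truncations at consecutive radii differ only inside the smaller ball, since outside it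
  distances are already at least \<open>q (k + 1)\<close>.\<close>

lemma lam_diff: "lam x k - lam x (k + 1) = dJ k * mu x k"
proof -
  have "lam x k - lam x (k + 1) = (\<integral>y. Jk k x y - Jk (k + 1) x y \<partial>M)"
    unfolding lam_def
    by (rule Bochner_Integration.integral_diff[OF Jk_integrable Jk_integrable, symmetric])
  also have "\<dots> = (\<integral>y. dJ k * indicator (pball x k) y \<partial>M)"
  proof (rule Bochner_Integration.integral_cong)
    fix y
    show "Jk k x y - Jk (k + 1) x y = dJ k * indicator (pball x k) y"
    proof (cases "y \<in> pball x k")
      case True
      then have "dist x y \<le> q k" by (simp add: mem_pball)
      moreover have "dist x y \<le> q (k + 1)" using pball_mono_mem[of k "k+1" y x] True by (simp add: mem_pball)
      ultimately show ?thesis using True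
        by (simp add: Jk_def max_def dJ_def q_add powr_mult algebra_simps)
    next
      case False
      then have "q (k + 1) \<le> dist x y" by (intro dist_gt_q) (simp add: mem_pball)
      moreover have "q k < q (k + 1)" by simp
      ultimately have "\<not> dist x y \<le> q k" by linarith
      with \<open>q (k + 1) \<le> dist x y\<close> False show ?thesis by (simp add: Jk_def max_def)
    qed
  qed simp
  finally show ?thesis by (simp add: mu_def)
qed

lemma lam_antimono: "j \<le> k \<Longrightarrow> lam x k \<le> lam x j"
  unfolding lam_def
proof (rule integral_mono[OF Jk_integrable Jk_integrable])
  fix y assume "j \<le> k"
  then have "q j \<le> q k" by simp
  then have "max (dist x y) (q j) \<le> max (dist x y) (q k)" "0 < max (dist x y) (q j)"
    using q_pos[of j] by linarith+
  then show "Jk k x y \<le> Jk j x y"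
    unfolding Jk_def using cJ_pos alpha_pos by (intro mult_left_mono powr_mono2') auto
qed

text \<open>Summing the spectral expansion of \<open>(\<L> + l)\<^sup>-\<^sup>1\<close> by parts, the indicator of \<open>pball x k\<close> gets the
  coefficient \<open>(1/(lam x (k + 1) + l) - 1/(lam x k + l)) / mu x k\<close>; by \<open>lam_diff\<close> the factor \<open>mu x k\<close>
  cancels.\<close>

definition G_coeff :: "real \<Rightarrow> 'p padic \<Rightarrow> int \<Rightarrow> real" where
  "G_coeff l x k = dJ k / ((lam x k + l) * (lam x (k + 1) + l))"

lemma lam_plus_pos: "0 \<le> l \<Longrightarrow> 0 < lam x k + l" using lam_pos[of x k] by linarith

lemma G_coeff_pos: "0 \<le> l \<Longrightarrow> 0 < G_coeff l x k"
  by (simp add: G_coeff_def lam_plus_pos)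

lemma G_coeff_mu: 
  assumes "0 \<le> l"
  shows "G_coeff l x k * mu x k = 1 / (lam x (k + 1) + l) - 1 / (lam x k + l)"
  using lam_diff[of x k] lam_plus_pos[OF assms, of x k] lam_plus_pos[OF assms, of x "k + 1"]
  by (simp add: G_coeff_def field_simps)

lemma G_coeff_cong: "y \<in> pball x k \<Longrightarrow> G_coeff l y k = G_coeff l x k"
  unfolding G_coeff_def using lam_cong[of y x k] lam_cong[of y x "k + 1"] pball_mono_mem[of k "k + 1" y x] by simp

lemma G_coeff_antimono: "0 \<le> l \<Longrightarrow> l \<le> l' \<Longrightarrow> G_coeff l' x k \<le> G_coeff l x k"
  unfolding G_coeff_def
  by (intro divide_left_mono mult_mono mult_pos_pos) (auto simp: lam_plus_pos less_imp_le)

text \<open>The order of the coefficient \<open>G_coeff 0 x k\<close>, obtained from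
  \<open>dJ k\<close> by replacing both eigenvalues by \<open>V x k\<close>
  (\<open>dJ_V\<close>).\<close>

definition U :: "'p padic \<Rightarrow> int \<Rightarrow> real" where "U x k = q k powr (\<alpha> - 1) * N x k powr (- 2 * \<beta>)"

lemma U_pos [simp]: "0 < U x k" by (simp add: U_def)

lemma dJ_V: "dJ k / (V x k * V x k) = cJ * (1 - P powr (- 1 - \<alpha>)) * U x k"
proof -
  have "q k powr (- 1 - \<alpha>) / (q k powr (- \<alpha>) * q k powr (- \<alpha>)) = q k powr (\<alpha> - 1)"
    by (simp flip: powr_add powr_diff)
  moreover have "1 / (N x k powr \<beta> * N x k powr \<beta>) = N x k powr (- 2 * \<beta>)"
    by (simp flip: powr_add powr_minus_divide)
  ultimately have "q k powr (- 1 - \<alpha>) / (q k powr (- \<alpha>) * q k powr (- \<alpha>)) * (1 / (N x k powr \<beta> * N x k powr \<beta>)) = U x k"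
    by (simp add: U_def)
  moreover have "dJ k / (V x k * V x k) = cJ * (1 - P powr (- 1 - \<alpha>)) *
      (q k powr (- 1 - \<alpha>) / (q k powr (- \<alpha>) * q k powr (- \<alpha>)) * (1 / (N x k powr \<beta> * N x k powr \<beta>)))"
    by (simp add: dJ_def V_def mult_ac)
  ultimately show ?thesis by simp
qed

text \<open>\<open>cU\<close> and \<open>CU\<close> result from bounding both eigenvalues above by
  \<open>CL * V x k\<close> and below by \<open>cL * V x k\<close>; the additional power of
  \<open>P\<close> in \<open>CU\<close> is the loss in \<open>V_Suc_ge\<close>.\<close>

definition cU :: real where "cU = cJ * (1 - P powr (- 1 - \<alpha>)) / CL\<^sup>2"

definition CU :: real where
  "CU = cJ * (1 - P powr (- 1 - \<alpha>)) / (cL\<^sup>2 * P powr (- \<alpha> - max (- \<beta>) 0))"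

lemma cU_pos: "0 < cU"
  using cJ_pos CL_pos P_powr_neg_less[of "1 + \<alpha>"] alpha_pos by (simp add: cU_def)

lemma CU_pos: "0 < CU"
  using cJ_pos cL_pos P_pos P_powr_neg_less[of "1 + \<alpha>"] alpha_pos by (simp add: CU_def)

lemma G_coeff_0_ge: "cU * U x k \<le> G_coeff 0 x k"
proof -
  have "cU * U x k = dJ k / ((CL * V x k) * (CL * V x k))"
  proof -
    have "cU * U x k = (cJ * (1 - P powr (- 1 - \<alpha>)) * U x k) / (CL * CL)"
      by (simp add: cU_def power2_eq_square)
    also have "\<dots> = dJ k / ((CL * V x k) * (CL * V x k))"
      unfolding dJ_V[symmetric] by (simp add: mult_ac)
    finally show ?thesis .
  qed
  also have "\<dots> \<le> dJ k / (lam x k * lam x (k + 1))"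
  proof (intro divide_left_mono mult_mono)
    show "lam x (k + 1) \<le> CL * V x k" using lam_antimono[of k "k + 1" x] lam_le[of x k] by linarith
  qed (use lam_le CL_pos V_pos lam_pos less_imp_le[OF dJ_pos] lam_nonneg in \<open>auto intro!: mult_pos_pos less_imp_le\<close>)
  finally show ?thesis by (simp add: G_coeff_def)
qed

lemma G_coeff_0_le: "G_coeff 0 x k \<le> CU * U x k"
proof -
  let ?r = "P powr (- \<alpha> - max (- \<beta>) 0)"
  have "cL * (V x k * ?r) \<le> cL * V x (k + 1)" using cL_pos V_Suc_ge by (intro mult_left_mono) auto
  then have "cL * (V x k * ?r) \<le> lam x (k + 1)" using lam_ge[of x "k + 1"] by linarith
  then have "G_coeff 0 x k \<le> dJ k / ((cL * V x k) * (cL * (V x k * ?r)))"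
    unfolding G_coeff_def using lam_ge[of x k] cL_pos P_pos
    by (intro divide_left_mono mult_mono mult_pos_pos) (auto simp: lam_nonneg less_imp_le)
  also have "\<dots> = CU * U x k"
  proof -
    have "CU * U x k = (cJ * (1 - P powr (- 1 - \<alpha>)) * U x k) / (cL * cL * ?r)"
      by (simp add: CU_def power2_eq_square)
    also have "\<dots> = dJ k / ((cL * V x k) * (cL * (V x k * ?r)))"
      unfolding dJ_V[symmetric] by (simp add: mult_ac)
    finally show ?thesis by (rule sym)
  qed
  finally show ?thesis .
qed

text \<open>A positive lower bound on infinitely many coefficients forces the series to diverge on
  the diagonal. On small balls the shift \<open>l\<close> is absorbed by the eigenvalue, and
  \<open>U\<close> does not tend to 0 there because \<beta> >= (\<alpha> - 1)/2.\<close>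

lemma G_coeff_lower_small_balls:
  assumes "0 \<le> l" obtains c where "0 < c" "\<And>j. j \<le> - 1 \<Longrightarrow> c \<le> G_coeff l x j"
proof -
  \<comment> \<open>For radii at most 1 the eigenvalue is at least \<open>cL * V x 0\<close>, so
    adding \<open>l\<close> enlarges it at most by the factor \<open>K\<close>.\<close>
  define K where "K = 1 + l / (cL * V x 0)"
  have K: "1 \<le> K" using assms cL_pos V_pos[of x 0] by (simp add: K_def)
  have lK: "lam x j + l \<le> K * lam x j" if "j \<le> 0" for j
  proof -
    have "cL * V x 0 \<le> cL * V x j" using V_antimono[OF that] cL_pos by simp
    also have "\<dots> \<le> lam x j" by (rule lam_ge)
    finally have "cL * V x 0 \<le> lam x j" .
    then have "l / (cL * V x 0) * (cL * V x 0) \<le> l / (cL * V x 0) * lam x j"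
      using assms cL_pos by (intro mult_left_mono) auto
    then show ?thesis using cL_pos V_pos[of x 0] by (simp add: K_def algebra_simps)
  qed
  \<comment> \<open>For \<beta> >= 0 the factor \<open>N\<close> is largest at radius 1. For \<beta>
    < 0 one uses \<open>N x j \<ge> q j\<close>, and the remaining exponent \<alpha> - 1 - 2 \<beta>
    is nonpositive.\<close>
  define u where "u = (if 0 \<le> \<beta> then N x 0 powr (- 2 * \<beta>) else 1)"
  have u: "0 < u" by (simp add: u_def)
  have uU: "u \<le> U x j" if "j \<le> 0" for j
  proof -
    have q1: "1 \<le> q j powr (\<alpha> - 1)"
      using that P_gt_1 alpha_less by (simp add: q_powr ge_one_powr_ge_zero mult_nonpos_nonpos)
    have N0: "N x j \<le> N x 0" using q_le_iff[of j 0] that unfolding N_def by linarith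
    show ?thesis
    proof (cases "0 \<le> \<beta>")
      case True
      then have "N x 0 powr (- 2 * \<beta>) \<le> N x j powr (- 2 * \<beta>)" using N0 by (intro powr_mono2') auto
      then have "1 * N x 0 powr (- 2 * \<beta>) \<le> q j powr (\<alpha> - 1) * N x j powr (- 2 * \<beta>)"
        using q1 by (intro mult_mono) auto
      then show ?thesis using True by (simp add: u_def U_def)
    next
      case False
      have "1 \<le> q j powr (\<alpha> - 1 - 2 * \<beta>)"
        using that P_gt_1 beta_ge by (simp add: q_powr ge_one_powr_ge_zero mult_nonpos_nonpos)
      also have "\<dots> = q j powr (\<alpha> - 1) * q j powr (- 2 * \<beta>)" by (simp flip: powr_add)
      also have "\<dots> \<le> q j powr (\<alpha> - 1) * N x j powr (- 2 * \<beta>)"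
        using False by (intro mult_left_mono powr_mono2) (auto simp: N_def)
      finally show ?thesis using False by (simp add: u_def U_def)
    qed
  qed
  show thesis
  proof
    show "0 < cU * u / (K * K)" using cU_pos u K by simp
    \<comment> \<open>The coefficient also contains the eigenvalue at \<open>j + 1\<close>, and
      \<open>lK\<close> needs that index to be at most 0.\<close>
    fix j :: int assume j: "j \<le> - 1"
    have "cU * u / (K * K) \<le> cU * U x j / (K * K)"
      using uU[of j] j cU_pos K by (intro divide_right_mono mult_left_mono) auto
    also have "\<dots> \<le> G_coeff 0 x j / (K * K)" using G_coeff_0_ge K by (intro divide_right_mono) auto
    also have "\<dots> = dJ j / ((K * lam x j) * (K * lam x (j + 1)))" by (simp add: G_coeff_def)
    also have "\<dots> \<le> G_coeff l x j"
      unfolding G_coeff_def using j assms K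
      by (intro divide_left_mono mult_mono lK mult_pos_pos) (auto simp: lam_plus_pos less_imp_le lam_nonneg)
    finally show "cU * u / (K * K) \<le> G_coeff l x j" .
  qed
qed

section \<open>The resolvent kernel\<close>

lemma mu_nz [simp]: "mu x k \<noteq> 0" and mu_nonneg [simp]: "0 \<le> mu x k"
  using mu_pos[of x k] by linarith+

text \<open>The balls containing \<open>x\<close> and \<open>y\<close> are indexed by integers, and
  on the diagonal the index is unbounded below. An integral over counting measure handles such a
  two-sided sum, allows the value infinity and exchanges with integrals over
  \<open>M\<close>.\<close>

definition G :: "real \<Rightarrow> 'p padic \<Rightarrow> 'p padic \<Rightarrow> ennreal" where
  "G l x y = (\<integral>\<^sup>+k. ennreal (G_coeff l x k) * indicator (pball x k) y \<partial>count_space UNIV)"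

abbreviation Gr :: "real \<Rightarrow> 'p padic \<Rightarrow> 'p padic \<Rightarrow> real" where
  "Gr l x y \<equiv> enn2real (G l x y)"

definition G_tail :: "real \<Rightarrow> 'p padic \<Rightarrow> int \<Rightarrow> ennreal" where
  "G_tail l x n = (\<integral>\<^sup>+k. ennreal (G_coeff l x k) * indicator {n..} k \<partial>count_space UNIV)"

lemma G_eq_tail: "dist x y = q n \<Longrightarrow> G l x y = G_tail l x n"
  unfolding G_def G_tail_def by (intro nn_integral_cong) (simp add: mem_pball indicator_def)

lemma G_sym: "G l x y = G l y x"
  unfolding G_def
proof (intro nn_integral_cong)
  fix k
  show "ennreal (G_coeff l x k) * indicator (pball x k) y = ennreal (G_coeff l y k) * indicator (pball y k) x"
    using G_coeff_cong[of y x k l] pball_sym[of y x k] by (auto simp: indicator_def)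
qed

lemma G_const:
  assumes "x \<notin> pball a n" "y \<in> pball a n" shows "G l x y = G l x a"
proof -
  have "dist x y = dist x a"
    using padic_dist_isosceles[of y a x] assms by (simp add: mem_pball dist_commute)
  then show ?thesis by (simp add: G_def mem_pball indicator_def)
qed

lemma G_tail_le_G: "y \<in> pball x n \<Longrightarrow> G_tail l x n \<le> G l x y"
  unfolding G_def G_tail_def using pball_mono_mem
  by (intro nn_integral_mono) (auto simp: indicator_def)

lemma G_tail_cong: "y \<in> pball x n \<Longrightarrow> G_tail l y n = G_tail l x n"
  unfolding G_tail_def
proof (intro nn_integral_cong)
  fix k assume "y \<in> pball x n"
  then show "ennreal (G_coeff l y k) * indicator {n..} k = ennreal (G_coeff l x k) * indicator {n..} k"
    using G_coeff_cong[of y x k l] pball_mono_mem[of n k y x] by (auto simp: indicator_def)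
qed

lemma G_tail_Suc: "G_tail l x n = ennreal (G_coeff l x n) + G_tail l x (n + 1)"
proof -
  have "G_tail l x n = (\<integral>\<^sup>+k. ennreal (G_coeff l x k) * indicator {n} k
      + ennreal (G_coeff l x k) * indicator {n + 1..} k \<partial>count_space UNIV)"
    unfolding G_tail_def by (intro nn_integral_cong) (auto simp: indicator_def)
  also have "\<dots> = (\<integral>\<^sup>+k. ennreal (G_coeff l x k) * indicator {n} k \<partial>count_space UNIV) + G_tail l x (n + 1)"
    unfolding G_tail_def by (rule nn_integral_add) auto
  also have "(\<integral>\<^sup>+k. ennreal (G_coeff l x k) * indicator {n} k \<partial>count_space UNIV) = ennreal (G_coeff l x n)"
    by (subst nn_integral_indicator_singleton) auto
  finally show ?thesis .
qed

lemma G_tail_ge_sum: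
  assumes "finite F" "F \<subseteq> {n..}"
  shows "(\<Sum>k\<in>F. ennreal (G_coeff l x k)) \<le> G_tail l x n"
proof -
  have "(\<Sum>k\<in>F. ennreal (G_coeff l x k)) = (\<integral>\<^sup>+k. ennreal (G_coeff l x k) * indicator F k \<partial>count_space UNIV)"
    using assms(1) by (simp add: nn_integral_count_space_indicator[symmetric] nn_integral_count_space_finite)
  also have "\<dots> \<le> G_tail l x n"
    unfolding G_tail_def using assms(2) by (intro nn_integral_mono) (auto simp: indicator_def)
  finally show ?thesis .
qed

lemma G_tail_unbounded:
  assumes "0 \<le> l" shows "\<exists>n. ennreal B \<le> G_tail l x n"
proof -
  obtain c where c: "0 < c" "\<And>j. j \<le> - 1 \<Longrightarrow> c \<le> G_coeff l x j"
    using G_coeff_lower_small_balls[OF assms] by blast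
  obtain n :: nat where n: "B < real n * c" using c(1) reals_Archimedean3 by blast
  have "ennreal B \<le> ennreal (real n * c)" using n by (simp add: ennreal_leI)
  also have "\<dots> = (\<Sum>k\<in>{- int n..-1}. ennreal c)"
    using c(1) by (simp add: ennreal_mult ennreal_of_nat_eq_real_of_nat)
  also have "\<dots> \<le> (\<Sum>k\<in>{- int n..-1}. ennreal (G_coeff l x k))"
    using c(2) by (intro sum_mono) (simp add: ennreal_leI)
  also have "\<dots> \<le> G_tail l x (- int n)" by (rule G_tail_ge_sum) auto
  finally show ?thesis by blast
qed

lemma G_diag: assumes "0 \<le> l" shows "G l x x = \<infinity>"
proof (rule ccontr)
  assume "G l x x \<noteq> \<infinity>"
  then obtain B where B: "0 \<le> B" "G l x x = ennreal B" by (cases "G l x x") auto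
  obtain n where "ennreal (B + 1) \<le> G_tail l x n" using G_tail_unbounded[OF assms] by blast
  also have "\<dots> \<le> G l x x" by (rule G_tail_le_G) simp
  finally show False using B by (simp add: ennreal_le_iff)
qed

section \<open>Telescoping, and integrals of the kernel over balls\<close>

lemma inverse_lam_tendsto:
  assumes "0 \<le> l" shows "(\<lambda>i. 1 / (lam x (n - int i) + l)) \<longlonglongrightarrow> 0"
proof (rule tendsto_sandwich[of "\<lambda>_. 0"])
  let ?s = "\<alpha> - max \<beta> 0"
  have s: "0 < ?s" using alpha_pos beta_less by simp
  show "(\<lambda>i. 1 / (cL * V x n) * q (int i) powr (- ?s)) \<longlonglongrightarrow> 0"
    using summable_LIMSEQ_zero[OF sums_summable[OF sums_q[OF s]]] by (rule tendsto_mult_right_zero)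
  show "\<forall>\<^sub>F i in sequentially. 1 / (lam x (n - int i) + l) \<le> 1 / (cL * V x n) * q (int i) powr (- ?s)"
  proof (intro always_eventually allI)
    fix i
    have "V x n \<le> V x (n - int i) * q (int i) powr (- ?s)"
      using V_shift[of "int i" x "n - int i"] by simp
    then have "cL * V x n \<le> (cL * V x (n - int i)) * q (int i) powr (- ?s)"
      using cL_pos by (simp add: mult.assoc)
    also have "\<dots> \<le> (lam x (n - int i) + l) * q (int i) powr (- ?s)"
      using lam_ge[of x "n - int i"] assms by (intro mult_right_mono) auto
    finally have "cL * V x n \<le> (lam x (n - int i) + l) * q (int i) powr (- ?s)" .
    then show "1 / (lam x (n - int i) + l) \<le> 1 / (cL * V x n) * q (int i) powr (- ?s)"
      using lam_plus_pos[OF assms] cL_pos V_pos[of x n] by (simp add: field_simps)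
  qed
qed (use lam_plus_pos[OF assms] in \<open>auto intro!: always_eventually less_imp_le\<close>)

text \<open>By \<open>G_coeff_mu\<close> the terms are consecutive differences. The boundary term at
  radius 0 vanishes because the eigenvalues blow up, so only the outer one survives.\<close>

lemma G_coeff_mu_telescope:
  assumes "0 \<le> l"
  shows "(\<integral>\<^sup>+k. ennreal (G_coeff l x k * mu x k) * indicator {..n} k \<partial>count_space UNIV)
    = ennreal (1 / (lam x (n + 1) + l))"
proof -
  have bij: "bij_betw (\<lambda>i. n - int i) UNIV {..n}"
    by (rule bij_betwI[where g = "\<lambda>k. nat (n - k)"]) auto
  have "(\<integral>\<^sup>+k. ennreal (G_coeff l x k * mu x k) * indicator {..n} k \<partial>count_space UNIV)
      = (\<integral>\<^sup>+k. ennreal (G_coeff l x k * mu x k) \<partial>count_space {..n})"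
    by (subst nn_integral_count_space_indicator) auto
  also have "\<dots> = (\<integral>\<^sup>+i. ennreal (G_coeff l x (n - int i) * mu x (n - int i)) \<partial>count_space UNIV)"
    by (rule nn_integral_bij_count_space[OF bij, symmetric])
  also have "\<dots> = (\<Sum>i. ennreal (G_coeff l x (n - int i) * mu x (n - int i)))"
    by (rule nn_integral_count_space_nat)
  also have "\<dots> = ennreal (1 / (lam x (n + 1 - int 0) + l) - 0)"
  proof (rule suminf_ennreal_eq)
    have "G_coeff l x (n - int i) * mu x (n - int i)
        = 1 / (lam x (n + 1 - int i) + l) - 1 / (lam x (n + 1 - int (Suc i)) + l)" for i
      unfolding G_coeff_mu[OF assms] by (simp add: algebra_simps)
    then show "(\<lambda>i. G_coeff l x (n - int i) * mu x (n - int i)) sums (1 / (lam x (n + 1 - int 0) + l) - 0)"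
      using telescope_sums'[OF inverse_lam_tendsto[OF assms, of x "n + 1"]] by simp
  qed (use G_coeff_pos[OF assms] in \<open>auto intro!: mult_nonneg_nonneg less_imp_le\<close>)
  finally show ?thesis by simp
qed

lemma nn_integral_G_indicator:
  assumes A: "A \<in> sets borel"
  shows "(\<integral>\<^sup>+y. G l x y * indicator A y \<partial>M)
    = (\<integral>\<^sup>+k. ennreal (G_coeff l x k) * emeasure M (pball x k \<inter> A) \<partial>count_space UNIV)"
proof -
  have "(\<integral>\<^sup>+y. G l x y * indicator A y \<partial>M)
      = (\<integral>\<^sup>+y. (\<integral>\<^sup>+k. ennreal (G_coeff l x k) * indicator (pball x k \<inter> A) y \<partial>count_space UNIV) \<partial>M)"
    unfolding G_def
    by (intro nn_integral_cong, subst nn_integral_multc[symmetric])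
       (auto simp: mult.assoc indicator_inter_arith)
  also have "\<dots> = (\<integral>\<^sup>+k. (\<integral>\<^sup>+y. ennreal (G_coeff l x k) * indicator (pball x k \<inter> A) y \<partial>M) \<partial>count_space UNIV)"
    using A by (intro nn_integral_count_space_nn_integral) auto
  also have "\<dots> = (\<integral>\<^sup>+k. ennreal (G_coeff l x k) * emeasure M (pball x k \<inter> A) \<partial>count_space UNIV)"
    using A by (intro nn_integral_cong nn_integral_cmult_indicator) auto
  finally show ?thesis .
qed

text \<open>Balls about \<open>x\<close> of radius at most \<open>q n\<close> lie inside
  \<open>pball a n\<close> and contribute the telescoping sum; each larger one contains
  \<open>pball a n\<close> and contributes its coefficient times \<open>mu a n\<close>.\<close>

lemma nn_integral_G_pball:
  assumes "0 \<le> l" "x \<in> pball a n"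
  shows "(\<integral>\<^sup>+y. G l x y * indicator (pball a n) y \<partial>M)
    = ennreal (1 / (lam a (n + 1) + l)) + ennreal (mu a n) * G_tail l a (n + 1)"
proof -
  have xa: "pball a n = pball x n" "mu a n = mu x n" "lam a (n + 1) = lam x (n + 1)" "G_tail l a (n + 1) = G_tail l x (n + 1)"
    using assms(2) pball_eq mu_cong lam_cong G_tail_cong pball_mono_mem[of n "n + 1" x a] by auto
  have eq: "ennreal (G_coeff l x k) * emeasure M (pball x k \<inter> pball x n)
      = ennreal (G_coeff l x k * mu x k) * indicator {..n} k
        + ennreal (mu x n) * (ennreal (G_coeff l x k) * indicator {n + 1..} k)" for k
  proof (cases "k \<le> n")
    case True
    then have "pball x k \<inter> pball x n = pball x k" using pball_mono by blast
    then show ?thesis using True G_coeff_pos[OF assms(1), of x k]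
      by (simp add: emeasure_M_pball ennreal_mult less_imp_le)
  next
    case False
    then have "pball x k \<inter> pball x n = pball x n" using pball_mono[of n k x] by force
    then show ?thesis using False by (simp add: emeasure_M_pball mult.commute)
  qed
  show ?thesis
    unfolding xa nn_integral_G_indicator[OF borel_pball] eq
    by (subst nn_integral_add) (auto simp: G_coeff_mu_telescope[OF assms(1)] nn_integral_cmult G_tail_def)
qed

text \<open>The integral is the supremum of the telescoped sums up to radius \<open>q n\<close>,
  each of the form 1/(eigenvalue + l).\<close>

lemma nn_integral_G_le:
  assumes "0 < l" shows "(\<integral>\<^sup>+y. G l x y \<partial>M) \<le> ennreal (1 / l)"
proof -
  let ?f = "\<lambda>n k. ennreal (G_coeff l x k * mu x k) * indicator {..int n} k"
  have "(\<integral>\<^sup>+y. G l x y \<partial>M) = (\<integral>\<^sup>+y. G l x y * indicator UNIV y \<partial>M)" by simp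
  also have "\<dots> = (\<integral>\<^sup>+k. ennreal (G_coeff l x k * mu x k) \<partial>count_space UNIV)"
    using assms by (subst nn_integral_G_indicator)
      (auto simp: emeasure_M_pball ennreal_mult G_coeff_pos less_imp_le)
  also have "\<dots> = (\<integral>\<^sup>+k. (SUP n. ?f n k) \<partial>count_space UNIV)"
  proof (rule nn_integral_cong)
    fix k
    show "ennreal (G_coeff l x k * mu x k) = (SUP n. ?f n k)"
    proof (rule antisym)
      have "ennreal (G_coeff l x k * mu x k) = ?f (nat k) k" by simp
      also have "\<dots> \<le> (SUP n. ?f n k)" by (rule SUP_upper) simp
      finally show "ennreal (G_coeff l x k * mu x k) \<le> (SUP n. ?f n k)" .
    qed (auto intro!: SUP_least simp: indicator_def)
  qed
  also have "\<dots> = (SUP n. \<integral>\<^sup>+k. ?f n k \<partial>count_space UNIV)"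
    by (rule nn_integral_monotone_convergence_SUP) (auto simp: incseq_def le_fun_def indicator_def)
  also have "\<dots> \<le> ennreal (1 / l)"
    using assms by (intro SUP_least) (auto simp: G_coeff_mu_telescope intro!: ennreal_leI divide_left_mono lam_nonneg
      mult_pos_pos lam_plus_pos)
  finally show ?thesis .
qed

lemma G_tail_finite: 
  assumes "0 < l" shows "G_tail l x n < \<infinity>"
proof -
  \<comment> \<open>The ball of index \<open>n - 1\<close> is chosen because its integral contains
    exactly the tail that starts at \<open>n\<close>.\<close>
  have "ennreal (mu x (n - 1)) * G_tail l x n \<le> (\<integral>\<^sup>+y. G l x y * indicator (pball x (n - 1)) y \<partial>M)"
    using assms by (subst nn_integral_G_pball) auto
  also have "\<dots> \<le> (\<integral>\<^sup>+y. G l x y \<partial>M)"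
    by (intro nn_integral_mono) (auto simp: indicator_def)
  also have "\<dots> < \<infinity>" using nn_integral_G_le[OF assms, of x] by (simp add: le_less_trans)
  finally show ?thesis using mu_pos[of x "n - 1"] by (auto simp: ennreal_mult_less_top)
qed

lemma G_finite: "0 < l \<Longrightarrow> x \<noteq> y \<Longrightarrow> G l x y < \<infinity>"
  by (metis G_eq_tail G_tail_finite dist_eq_q)

section \<open>Continuity and measurability of the kernel\<close>

lemma continuous_at_G_offdiag:
  assumes "x \<noteq> y"
  shows "((\<lambda>(x, y). G l x y) \<longlongrightarrow> G l x y) (nhds (x, y))"
proof -
  obtain n where n: "dist x y = q n" using assms by (rule dist_eq_q)
  \<comment> \<open>One radius below the distance the two balls are disjoint, so
    \<open>G_const\<close> moves one argument at a time, with symmetry in between.\<close>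
  have "eventually (\<lambda>z. fst z \<in> pball x (n - 1) \<and> snd z \<in> pball y (n - 1)) (nhds (x, y))"
    unfolding nhds_prod by (rule eventually_prodI) (rule eventually_nhds_pball)+
  then have "eventually (\<lambda>z. (\<lambda>(x, y). G l x y) z = G l x y) (nhds (x, y))"
  proof (rule eventually_mono, clarsimp)
    fix a b assume a: "a \<in> pball x (n - 1)" and b: "b \<in> pball y (n - 1)"
    have "y \<notin> pball x (n - 1)" using n by (simp add: mem_pball)
    then have "a \<notin> pball y (n - 1)" using a pball_trans[of a y "n - 1" x] pball_sym by blast
    then have "G l a b = G l a y" using b by (rule G_const)
    also have "\<dots> = G l y a" by (rule G_sym)
    also have "\<dots> = G l y x"
      using \<open>y \<notin> pball x (n - 1)\<close> a by (rule G_const)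
    also have "\<dots> = G l x y" by (rule G_sym)
    finally show "G l a b = G l x y" .
  qed
  then show ?thesis by (rule tendsto_eventually)
qed

lemma continuous_at_G_diag:
  assumes "0 \<le> l"
  shows "((\<lambda>(x, y). G l x y) \<longlongrightarrow> G l x x) (nhds (x, x))"
  unfolding G_diag[OF assms]
proof (rule order_tendstoI)
  fix b :: ennreal assume "b < \<infinity>"
  then obtain B where B: "0 \<le> B" "b = ennreal B" by (cases b) auto
  obtain n where n: "ennreal (B + 1) \<le> G_tail l x n" using G_tail_unbounded[OF assms] by blast
  have "eventually (\<lambda>z. fst z \<in> pball x n \<and> snd z \<in> pball x n) (nhds (x, x))"
    unfolding nhds_prod by (rule eventually_prodI) (rule eventually_nhds_pball)+
  then show "eventually (\<lambda>z. b < (\<lambda>(x, y). G l x y) z) (nhds (x, x))"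
  proof (rule eventually_mono, clarsimp)
    fix y z assume y: "y \<in> pball x n" and z: "z \<in> pball x n"
    have "z \<in> pball y n" using y z pball_trans pball_sym by blast
    then have "G_tail l y n \<le> G l y z" by (rule G_tail_le_G)
    then have "ennreal (B + 1) \<le> G l y z" using n G_tail_cong[OF y] by (metis order.trans)
    moreover have "b < ennreal (B + 1)" using B by (simp add: ennreal_less_iff)
    ultimately show "b < G l y z" by (rule less_le_trans[rotated])
  qed
qed simp

lemma continuous_G: "0 \<le> l \<Longrightarrow> continuous_on UNIV (\<lambda>(x, y). G l x y)"
proof -
  assume l: "0 \<le> l"
  have "((\<lambda>(x, y). G l x y) \<longlongrightarrow> G l x y) (at (x, y))" for x y
  proof (cases "x = y")
    case True
    then show ?thesis using continuous_at_G_diag[OF l, of x] tendsto_mono[OF at_within_le_nhds] by blast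
  next
    case False
    then show ?thesis using continuous_at_G_offdiag[OF False, of l] tendsto_mono[OF at_within_le_nhds] by blast
  qed
  then show ?thesis unfolding continuous_on_def by auto
qed

lemma G_measurable2: "0 \<le> l \<Longrightarrow> (\<lambda>(x, y). G l x y) \<in> borel_measurable (borel \<Otimes>\<^sub>M borel)"
  unfolding borel_prod by (rule borel_measurable_continuous_onI[OF continuous_G])

lemma G_measurable: "0 \<le> l \<Longrightarrow> G l x \<in> borel_measurable borel"
  using measurable_compose[OF measurable_Pair1' G_measurable2, of x] by simp

subsection \<open>Eigenfunctions\<close>

definition eig :: "'p padic \<Rightarrow> int \<Rightarrow> 'p padic \<Rightarrow> real" where
  "eig a n x = indicator (pball a n) x / mu a n - indicator (pball a (n + 1)) x / mu a (n + 1)"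

lemma integrable_G: 
  assumes "0 < l" shows "integrable M (\<lambda>y. Gr l x y)"
proof -
  have [measurable]: "G l x \<in> borel_measurable borel" using assms by (intro G_measurable) simp
  have "(\<integral>\<^sup>+y. ennreal (Gr l x y) \<partial>M) \<le> (\<integral>\<^sup>+y. G l x y \<partial>M)"
    by (intro nn_integral_mono) (simp add: ennreal_enn2real_if)
  also have "\<dots> < \<infinity>" using nn_integral_G_le[OF assms, of x] by (simp add: le_less_trans)
  finally show ?thesis unfolding integrable_iff_bounded by simp
qed

lemma integrable_G_indicator:
  assumes "0 < l" shows "integrable M (\<lambda>y. Gr l x y * indicator (pball a n) y)"
  by (rule integrable_mult_indicator[where f = "\<lambda>y. Gr l x y" and A = "pball a n", simplified, unfolded mult.commute[of "indicator _ _"]])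
     (use integrable_G[OF assms] in auto)

lemma integral_G_indicator:
  assumes "0 < l"
  shows "(\<integral>y. Gr l x y * indicator (pball a n) y \<partial>M)
    = (if x \<in> pball a n then 1 / (lam a (n + 1) + l) + mu a n * enn2real (G_tail l a (n + 1))
       else mu a n * enn2real (G l x a))"
proof -
  have [measurable]: "G l x \<in> borel_measurable borel" using assms by (intro G_measurable) simp
  have "(\<integral>y. Gr l x y * indicator (pball a n) y \<partial>M)
      = enn2real (\<integral>\<^sup>+y. ennreal (Gr l x y * indicator (pball a n) y) \<partial>M)"
    by (rule integral_eq_nn_integral) auto
  also have "(\<integral>\<^sup>+y. ennreal (Gr l x y * indicator (pball a n) y) \<partial>M)
      = (\<integral>\<^sup>+y. G l x y * indicator (pball a n) y \<partial>M)"
  proof (rule nn_integral_cong_AE, rule AE_mp[OF AE_M_neq[of x]], rule AE_I2, rule impI)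
    fix y :: "'p padic" assume "y \<noteq> x"
    then have "G l x y < \<infinity>" using G_finite[OF assms, of x y] by metis
    then show "ennreal (Gr l x y * indicator (pball a n) y) = G l x y * indicator (pball a n) y"
      by (simp add: indicator_def less_top)
  qed
  finally have eq: "(\<integral>y. Gr l x y * indicator (pball a n) y \<partial>M)
      = enn2real (\<integral>\<^sup>+y. G l x y * indicator (pball a n) y \<partial>M)" .
  show ?thesis
  proof (cases "x \<in> pball a n")
    case True
    have "0 \<le> mu a n" by (simp add: less_imp_le)
    then show ?thesis
      unfolding eq using True assms G_tail_finite[OF assms, of a "n + 1"]
      by (subst nn_integral_G_pball)
         (auto simp: enn2real_plus ennreal_mult_less_top enn2real_mult less_imp_le lam_plus_pos)
  next
    case False
    have "(\<integral>\<^sup>+y. G l x y * indicator (pball a n) y \<partial>M) = (\<integral>\<^sup>+y. G l x a * indicator (pball a n) y \<partial>M)"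
    proof (rule nn_integral_cong)
      fix y
      show "G l x y * indicator (pball a n) y = G l x a * indicator (pball a n) y"
        using G_const[OF False, of y l] by (cases "y \<in> pball a n") simp_all
    qed
    also have "\<dots> = G l x a * ennreal (mu a n)"
      by (simp add: nn_integral_cmult_indicator emeasure_M_pball)
    finally have "enn2real (\<integral>\<^sup>+y. G l x y * indicator (pball a n) y \<partial>M) = mu a n * enn2real (G l x a)"
      using mu_pos[of a n] by (simp add: enn2real_mult)
    then show ?thesis unfolding eq using False by simp
  qed
qed

text \<open>The integral is a difference of averages of the kernel over a ball and its parent. The
  contributions of all large balls agree and cancel, which leaves the factor 1/(lam + l) from the
  telescoped parts.\<close>

lemma integral_G_eig:
  assumes "0 < l"
  shows "(\<integral>y. Gr l x y * eig a n y \<partial>M) = eig a n x / (lam a (n + 1) + l)"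
proof -
  let ?I = "\<lambda>n. \<integral>y. Gr l x y * indicator (pball a n) y \<partial>M"
  have "(\<integral>y. Gr l x y * eig a n y \<partial>M)
      = (\<integral>y. (Gr l x y * indicator (pball a n) y) / mu a n
          - (Gr l x y * indicator (pball a (n + 1)) y) / mu a (n + 1) \<partial>M)"
    by (intro Bochner_Integration.integral_cong) (auto simp: eig_def algebra_simps)
  also have "\<dots> = ?I n / mu a n - ?I (n + 1) / mu a (n + 1)"
    using integrable_G_indicator[OF assms] by (subst Bochner_Integration.integral_diff) auto
  finally have eq: "(\<integral>y. Gr l x y * eig a n y \<partial>M) = ?I n / mu a n - ?I (n + 1) / mu a (n + 1)" .
  have Tr: "enn2real (G_tail l a k) = G_coeff l a k + enn2real (G_tail l a (k + 1))" for k
    using G_tail_finite[OF assms, of a "k + 1"] G_coeff_pos[of l a k] assms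
    by (subst G_tail_Suc) (simp add: enn2real_plus)
  have tel: "G_coeff l a (n + 1) = (1 / (lam a (n + 2) + l) - 1 / (lam a (n + 1) + l)) / mu a (n + 1)"
  proof -
    have "G_coeff l a (n + 1) * mu a (n + 1) = 1 / (lam a (n + 2) + l) - 1 / (lam a (n + 1) + l)"
      using G_coeff_mu[of l a "n + 1"] assms by (simp add: add.assoc)
    moreover have "mu a (n + 1) \<noteq> 0" using mu_pos[of a "n + 1"] by linarith
    ultimately show ?thesis by (metis nonzero_mult_div_cancel_right)
  qed

  define A where "A = 1 / (lam a (n + 1) + l)"
  have I1: "?I k / mu a k = 1 / (lam a (k + 1) + l) / mu a k + enn2real (G_tail l a (k + 1))"
    if "x \<in> pball a k" for k
    using that mu_pos[of a k] unfolding integral_G_indicator[OF assms] by (simp add: add_divide_distrib)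
  have I2: "?I k / mu a k = enn2real (G l x a)" if "x \<notin> pball a k" for k
    using that mu_pos[of a k] unfolding integral_G_indicator[OF assms] by simp
  \<comment> \<open>One term is split off so that both averages refer to the tail from
    \<open>n + 2\<close>; its telescoped form brings in the eigenvalue
    \<open>lam a (n + 1)\<close>.\<close>
  have T1: "enn2real (G_tail l a (n + 1)) = 1 / (lam a (n + 2) + l) / mu a (n + 1) - A / mu a (n + 1)
      + enn2real (G_tail l a (n + 2))"
    using Tr[of "n + 1"] unfolding tel A_def by (simp add: diff_divide_distrib add.assoc)
  have rhs: "eig a n x / (lam a (n + 1) + l) = eig a n x * A" by (simp add: A_def)
  consider "x \<in> pball a n" "x \<in> pball a (n + 1)" | "x \<notin> pball a n" "x \<in> pball a (n + 1)"
    | "x \<notin> pball a n" "x \<notin> pball a (n + 1)"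
    using pball_mono_mem[of n "n + 1" x a] by auto
  then show ?thesis
  proof cases
    case 1
    have "?I n / mu a n - ?I (n + 1) / mu a (n + 1) = A / mu a n - A / mu a (n + 1)"
      using I1[OF 1(1)] I1[OF 1(2)] T1 by (simp add: A_def add.assoc)
    then show ?thesis unfolding eq rhs using 1 by (simp add: eig_def left_diff_distrib)
  next
    case 2
    \<comment> \<open>In the parent but not in the ball, \<open>x\<close> has exactly this distance
      from \<open>a\<close>, so the kernel value is itself the tail from
      \<open>n + 1\<close>.\<close>
    have "dist x a = q (n + 1)" using 2 dist_gt_q[of a x n] by (simp add: mem_pball dist_commute)
    then have "G l x a = G_tail l a (n + 1)" using G_eq_tail[of a x "n + 1" l] G_sym[of l x a] by (simp add: dist_commute)
    then have "?I n / mu a n - ?I (n + 1) / mu a (n + 1) = - A / mu a (n + 1)"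
      using I2[OF 2(1)] I1[OF 2(2)] T1 by (simp add: A_def add.assoc)
    then show ?thesis unfolding eq rhs using 2 by (simp add: eig_def)
  next
    case 3
    then show ?thesis unfolding eq rhs using I2[OF 3(1)] I2[OF 3(2)] by (simp add: eig_def)
  qed
qed

end

section \<open>Test functions and the operator \<open>\<L>\<close>\<close>

text \<open>Together with \<open>ball_supp\<close> a quantitative form of being a test function: one
  scale of constancy for all points and one ball containing the support.\<close>

definition ball_const :: "int \<Rightarrow> ('p::prime_card padic \<Rightarrow> complex) \<Rightarrow> bool" where
  "ball_const j f \<longleftrightarrow> (\<forall>x. \<forall>y\<in>pball x j. f y = f x)"

definition ball_supp :: "int \<Rightarrow> ('p::prime_card padic \<Rightarrow> complex) \<Rightarrow> bool" where
  "ball_supp R f \<longleftrightarrow> (\<forall>x. f x \<noteq> 0 \<longrightarrow> x \<in> pball 0 R)"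

lemma ball_constD: "ball_const j f \<Longrightarrow> y \<in> pball x j \<Longrightarrow> f y = f x"
  by (simp add: ball_const_def)

lemma ball_const_mono: "ball_const j f \<Longrightarrow> i \<le> j \<Longrightarrow> ball_const i f"
  unfolding ball_const_def using pball_mono_mem by blast

lemma ball_supp_mono: "ball_supp R f \<Longrightarrow> R \<le> S \<Longrightarrow> ball_supp S f"
  unfolding ball_supp_def using pball_mono_mem by blast

lemma ball_const_isCont:
  fixes f :: "'p::prime_card padic \<Rightarrow> complex"
  assumes "ball_const j f" shows "continuous_on UNIV f"
proof -
  have "(f \<longlongrightarrow> f x) (at x)" for x
  proof (rule tendsto_eventually)
    have "eventually (\<lambda>y. y \<in> pball x j) (at x)"
      unfolding eventually_at_filter using eventually_nhds_pball[of x j] by (rule eventually_mono) simp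
    then show "eventually (\<lambda>y. f y = f x) (at x)"
      by (rule eventually_mono) (rule ball_constD[OF assms])
  qed
  then show ?thesis by (simp add: continuous_on_def)
qed

lemma ball_const_measurable: "ball_const j f \<Longrightarrow> f \<in> borel_measurable borel"
  by (intro borel_measurable_continuous_onI ball_const_isCont)

text \<open>Finitely many balls of constancy cover the support, so only finitely many values
  occur.\<close>

lemma ball_const_ball_supp_bounded:
  fixes f :: "'p::prime_card padic \<Rightarrow> complex"
  assumes f: "ball_const j f" "ball_supp R f"
  obtains B where "0 \<le> B" "\<And>x. cmod (f x) \<le> B"
proof -
  define i where "i = min j R"
  have i: "ball_const i f" using ball_const_mono[OF f(1)] by (simp add: i_def)
  have "i + int (nat (R - i)) = R" by (simp add: i_def)
  then obtain A :: "'p padic set" where A: "finite A" "pball 0 R \<subseteq> (\<Union>a\<in>A. pball a i)"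
    using pball_finite_cover[of 0 i "nat (R - i)"] by metis
  show thesis
  proof
    show "0 \<le> (\<Sum>a\<in>A. cmod (f a))" by (intro sum_nonneg) simp
    fix x
    show "cmod (f x) \<le> (\<Sum>a\<in>A. cmod (f a))"
    proof (cases "f x = 0")
      case False
      then obtain a where a: "a \<in> A" "x \<in> pball a i" using A(2) f(2) unfolding ball_supp_def by blast
      then have "cmod (f x) = cmod (f a)" using ball_constD[OF i a(2)] by simp
      also have "\<dots> \<le> (\<Sum>a\<in>A. cmod (f a))" using A(1) a(1) by (intro member_le_sum) auto
      finally show ?thesis .
    qed (simp add: sum_nonneg)
  qed
qed

text \<open>Local constancy becomes uniform through a Lebesgue number for the compact closure of the
  support.\<close>

lemma test_function_ball_const:
  fixes f :: "'p::prime_card padic \<Rightarrow> complex"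
  assumes "test_function f"
  obtains j R where "ball_const j f" "ball_supp R f"
proof -
  define K where "K = closure {x. f x \<noteq> 0}"
  define \<G> where "\<G> = {U. open U \<and> (\<forall>x\<in>U. \<forall>y\<in>U. f x = f y)}"
  have K: "compact K" using assms by (simp add: test_function_def K_def)
  have cover: "K \<subseteq> \<Union>\<G>"
  proof
    fix x
    obtain U where U: "open U" "x \<in> U" "\<forall>y\<in>U. f y = f x"
      using assms unfolding test_function_def by blast
    then have "U \<in> \<G>" unfolding \<G>_def mem_Collect_eq by metis
    then show "x \<in> \<Union>\<G>" using U(2) by blast
  qed
  obtain e where e: "0 < e" "\<And>x. x \<in> K \<Longrightarrow> \<exists>G\<in>\<G>. ball x e \<subseteq> G"
    using Heine_Borel_lemma[OF K cover] unfolding \<G>_def by blast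
  obtain j :: int where j: "real CARD('p) powr j < e" using padic_radius_below[OF e(1)] by blast
  have K_out: "f x = 0" if "x \<notin> K" for x
    using that closure_subset[of "{x. f x \<noteq> 0}"] unfolding K_def by blast
  have in_K: "f y = f x" if x: "x \<in> K" and y: "y \<in> pball x j" for x y
  proof -
    obtain G where G: "G \<in> \<G>" "ball x e \<subseteq> G" using e(2)[OF x] by blast
    have "dist x y < e" using y j unfolding pball_mem by linarith
    then have "y \<in> G" "x \<in> G" using G(2) e(1) by auto
    then show ?thesis using G(1) unfolding \<G>_def by blast
  qed
  have "ball_const j f"
    unfolding ball_const_def
  proof (intro allI ballI)
    fix x y :: "'p padic" assume y: "y \<in> pball x j"
    show "f y = f x"
    \<comment> \<open>If one of the points lies in \<open>K\<close>, the Lebesgue number applies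
      with that point as centre; otherwise both values are 0.\<close>
    proof (cases "x \<in> K \<or> y \<in> K")
      case True
      then show ?thesis using in_K[of x y] in_K[of y x] y pball_sym[of y x] by metis
    next
      case False
      then show ?thesis using K_out by metis
    qed
  qed
  moreover obtain r where r: "\<And>x. x \<in> K \<Longrightarrow> dist 0 x \<le> r"
    using compact_imp_bounded[OF K] bounded_any_center[of K 0] by blast
  obtain R :: int where R: "r < real CARD('p) powr R" using padic_radius_above by blast
  have "ball_supp R f"
    unfolding ball_supp_def pball_mem
  proof (intro allI impI)
    fix x assume "f x \<noteq> 0"
    then have "x \<in> K" using K_out by metis
    then show "dist 0 x \<le> real CARD('p) powr real_of_int R" using r[of x] R by linarith
  qed
  ultimately show thesis by (rule that)
qed

lemma ball_const_test_function:
  fixes f :: "'p::prime_card padic \<Rightarrow> complex"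
  assumes f: "ball_const j f" "ball_supp R f"
  shows "test_function f"
  unfolding test_function_def
proof (intro conjI allI)
  fix x
  show "\<exists>U. open U \<and> x \<in> U \<and> (\<forall>y\<in>U. f y = f x)"
    using ball_constD[OF f(1)] by (intro exI[of _ "pball x j"]) (simp add: open_pball)
next
  have "closure {x. f x \<noteq> 0} \<subseteq> pball 0 R"
    using f(2) by (intro closure_minimal closed_pball) (auto simp: ball_supp_def)
  then show "compact (closure {x. f x \<noteq> 0})"
    using compact_Int_closed[OF compact_pball[of 0 R] closed_closure[of "{x. f x \<noteq> 0}"]]
    by (simp add: Int_absorb1)
qed

lemma ball_const_const [simp]: "ball_const j (\<lambda>_. c)" by (simp add: ball_const_def)

lemma ball_supp_zero [simp]: "ball_supp R (\<lambda>_. 0)" by (simp add: ball_supp_def)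

lemma ball_const_op2: "ball_const j f \<Longrightarrow> ball_const j g \<Longrightarrow> ball_const j (\<lambda>x. h (f x) (g x))"
  unfolding ball_const_def by metis

lemma ball_const_mult: "ball_const j f \<Longrightarrow> ball_const j g \<Longrightarrow> ball_const j (\<lambda>x. f x * g x)"
  by (rule ball_const_op2)

lemma ball_const_add: "ball_const j f \<Longrightarrow> ball_const j g \<Longrightarrow> ball_const j (\<lambda>x. f x + g x)"
  by (rule ball_const_op2)

lemma ball_supp_mult: "ball_supp R f \<Longrightarrow> ball_supp R (\<lambda>x. f x * g x)"
  by (auto simp: ball_supp_def)

lemma ball_supp_mult2: "ball_supp R g \<Longrightarrow> ball_supp R (\<lambda>x. f x * g x)"
  by (auto simp: ball_supp_def)

lemma ball_supp_add: "ball_supp R f \<Longrightarrow> ball_supp R g \<Longrightarrow> ball_supp R (\<lambda>x. f x + g x)"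
  unfolding ball_supp_def by (metis add.right_neutral)

context hweight
begin

abbreviation eigc :: "'p padic \<Rightarrow> int \<Rightarrow> 'p padic \<Rightarrow> complex" where
  "eigc a n x \<equiv> complex_of_real (eig a n x)"

lemma ball_const_eig: "ball_const n (eigc a n)"
  unfolding ball_const_def
proof (intro allI ballI)
  fix x y :: "'p padic" assume y: "y \<in> pball x n"
  have "y \<in> pball a n \<longleftrightarrow> x \<in> pball a n" using y pball_trans pball_sym by blast
  moreover have "y \<in> pball x (n + 1)" using pball_mono_mem[of n "n + 1" y x] y by simp
  then have "y \<in> pball a (n + 1) \<longleftrightarrow> x \<in> pball a (n + 1)" using pball_trans pball_sym by blast
  ultimately show "eigc a n y = eigc a n x" by (simp add: eig_def indicator_def)
qed

lemma eig_supp: "x \<notin> pball a (n + 1) \<Longrightarrow> eig a n x = 0"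
  using pball_mono_mem[of n "n + 1" x a] by (cases "x \<in> pball a n") (simp_all add: eig_def)

lemma pball_in_centered: obtains R where "pball a n \<subseteq> pball (0 :: 'p padic) R"
proof -
  obtain k where k: "dist 0 a < q k" using q_above by blast
  define R where "R = max k n"
  have "q k \<le> q R" by (simp add: R_def)
  then have "a \<in> pball 0 R" using k unfolding mem_pball by linarith
  then have "pball a R = pball 0 R" by (rule pball_eq)
  moreover have "pball a n \<subseteq> pball a R" by (rule pball_mono) (simp add: R_def)
  ultimately show thesis using that by metis
qed

lemma ball_supp_eig: obtains R where "ball_supp R (eigc a n)"
proof -
  obtain R :: int where "pball a (n + 1) \<subseteq> pball 0 R" by (rule pball_in_centered)
  then have "ball_supp R (eigc a n)" unfolding ball_supp_def using eig_supp by fastforce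
  then show thesis by (rule that)
qed

lemma ball_const_ball_supp_integrable:
  assumes f: "ball_const j f" "ball_supp R f"
  shows "integrable M f"
proof -
  obtain B where B: "\<And>x. cmod (f x) \<le> B" using ball_const_ball_supp_bounded[OF f] by blast
  show ?thesis
    by (rule integrableI_bounded_set[of "pball 0 R" _ _ B])
       (use B ball_const_measurable[OF f(1)] f(2) in \<open>auto simp: emeasure_M_pball ball_supp_def\<close>)
qed

lemma Jk_le: "Jk j x y \<le> cJ * q j powr (- 1 - \<alpha>)"
  unfolding Jk_def using cJ_pos alpha_pos
  by (intro mult_left_mono powr_mono2') auto

lemma integrable_mult_Jk:
  assumes f: "ball_const j f" "ball_supp R f"
  shows "integrable M (\<lambda>y. f y * of_real (Jk i x y))"
proof -
  obtain B where B: "0 \<le> B" "\<And>x. cmod (f x) \<le> B" using ball_const_ball_supp_bounded[OF f] by blast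
  have [measurable]: "f \<in> borel_measurable borel" using ball_const_measurable[OF f(1)] .
  have "integrable M (\<lambda>y. B * Jk i x y)" using Jk_integrable by (intro integrable_mult_right) auto
  then show ?thesis
    by (rule Bochner_Integration.integrable_bound)
       (use B in \<open>auto simp: norm_mult intro!: mult_right_mono\<close>)
qed

lemma calL_integrand:
  assumes "ball_const j f"
  shows "(f x - f y) * of_real (jump_kernel \<alpha> x y) = f x * of_real (Jk j x y) - f y * of_real (Jk j x y)"
proof (cases "y \<in> pball x j")
  case True
  then show ?thesis using ball_constD[OF assms True] by simp
next
  case False
  then have "q j \<le> dist x y" by (simp add: mem_pball)
  then show ?thesis by (simp add: Jk_eq_jump left_diff_distrib)
qed

lemma integrable_calL:
  assumes f: "ball_const j f" "ball_supp R f"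
  shows "integrable M (\<lambda>y. (f x - f y) * of_real (jump_kernel \<alpha> x y))"
  unfolding calL_integrand[OF f(1)] using integrable_mult_Jk[OF f] Jk_integrable
  by (intro Bochner_Integration.integrable_diff integrable_mult_right integrable_of_real) auto

abbreviation Jop :: "int \<Rightarrow> ('p padic \<Rightarrow> complex) \<Rightarrow> 'p padic \<Rightarrow> complex" where
  "Jop j f x \<equiv> \<integral>y. f y * of_real (Jk j x y) \<partial>M"

lemma calL_op_ball_const:
  assumes f: "ball_const j f" "ball_supp R f"
  shows "Lop f x = f x * of_real (lam x j) - Jop j f x"
proof -
  have "Lop f x = (\<integral>y. f x * of_real (Jk j x y) - f y * of_real (Jk j x y) \<partial>M)"
    unfolding calL_op_def calL_integrand[OF f(1)] ..
  also have "\<dots> = (\<integral>y. f x * of_real (Jk j x y) \<partial>M) - Jop j f x"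
    using integrable_mult_Jk[OF f] Jk_integrable
    by (intro Bochner_Integration.integral_diff integrable_mult_right integrable_of_real) auto
  also have "(\<integral>y. f x * of_real (Jk j x y) \<partial>M) = f x * of_real (lam x j)"
    by (simp add: lam_def)
  finally show ?thesis .
qed

lemma calL_op_add:
  assumes f: "ball_const j f" "ball_supp R f" and g: "ball_const j g" "ball_supp R g"
  shows "Lop (\<lambda>x. f x + c * g x) x = Lop f x + c * Lop g x"
proof -
  have "Lop (\<lambda>x. f x + c * g x) x
      = (\<integral>y. (f x - f y) * of_real (jump_kernel \<alpha> x y)
        + c * ((g x - g y) * of_real (jump_kernel \<alpha> x y)) \<partial>M)"
    unfolding calL_op_def by (intro Bochner_Integration.integral_cong) (auto simp: algebra_simps)
  also have "\<dots> = Lop f x + c * Lop g x"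
    unfolding calL_op_def using integrable_calL[OF f, of x] integrable_calL[OF g, of x]
    by (subst Bochner_Integration.integral_add) auto
  finally show ?thesis .
qed

lemma calL_op_is_ball_const:
  assumes f: "ball_const j f" "ball_supp R f" shows "ball_const j (Lop f)"
  unfolding ball_const_def
proof (intro allI ballI)
  fix x y :: "'p padic" assume y: "y \<in> pball x j"
  have "(\<integral>z. f z * of_real (Jk j y z) \<partial>M) = (\<integral>z. f z * of_real (Jk j x z) \<partial>M)"
    by (intro Bochner_Integration.integral_cong refl) (simp only: Jk_cong[OF y])
  then show "Lop f y = Lop f x"
    unfolding calL_op_ball_const[OF f] using ball_constD[OF f(1) y] lam_cong[OF y] by simp
qed

lemma integral_eig: "(\<integral>x. eig a n x \<partial>M) = 0"
  unfolding eig_def using indicator_pball_integrable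
  by (subst Bochner_Integration.integral_diff) (auto simp: mu_def[symmetric])

text \<open>\<open>eig a n\<close> has mean zero and is supported in a ball on which the kernel truncated at the
  radius of that ball is constant in \<open>y\<close>, so only the diagonal term of \<open>\<L>\<close> survives.\<close>

lemma calL_op_eig: "Lop (eigc a n) x = of_real (lam a (n + 1)) * eigc a n x"
proof -
  have eq: "(eigc a n x - eigc a n y) * of_real (jump_kernel \<alpha> x y)
      = of_real (eig a n x * Jk (n + 1) x y - eig a n y * Jk (n + 1) x a)" for y
  proof -
    have J: "eig a n y * Jk (n + 1) x y = eig a n y * Jk (n + 1) x a" for y
      using eig_supp[of y a n] Jk_cong[of y a "n + 1" x] Jk_sym by (metis mult_zero_left)
    have "(eig a n x - eig a n y) * jump_kernel \<alpha> x y = (eig a n x - eig a n y) * Jk (n + 1) x y"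
    proof (cases "eig a n x = eig a n y")
      case False
      have "y \<notin> pball x n" using ball_constD[OF ball_const_eig, of y x n a] False by auto
      then have "q (n + 1) \<le> dist x y" by (intro dist_gt_q) (simp add: mem_pball)
      then show ?thesis by (simp add: Jk_eq_jump)
    qed simp
    also have "\<dots> = eig a n x * Jk (n + 1) x y - eig a n y * Jk (n + 1) x a"
      unfolding left_diff_distrib J ..
    finally show ?thesis by (simp flip: of_real_mult of_real_diff)
  qed
  have "Lop (eigc a n) x
      = of_real (\<integral>y. eig a n x * Jk (n + 1) x y - eig a n y * Jk (n + 1) x a \<partial>M)"
    unfolding calL_op_def eq by (rule integral_complex_of_real)
  also have "(\<integral>y. eig a n x * Jk (n + 1) x y - eig a n y * Jk (n + 1) x a \<partial>M)
      = (\<integral>y. eig a n x * Jk (n + 1) x y \<partial>M) - (\<integral>y. eig a n y * Jk (n + 1) x a \<partial>M)"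
  proof (rule Bochner_Integration.integral_diff)
    show "integrable M (\<lambda>y. eig a n x * Jk (n + 1) x y)"
      using Jk_integrable by (intro integrable_mult_right) auto
    show "integrable M (\<lambda>y. eig a n y * Jk (n + 1) x a)"
      unfolding eig_def using indicator_pball_integrable by auto
  qed
  also have "\<dots> = eig a n x * lam x (n + 1)" by (simp add: lam_def integral_eig)
  also have "\<dots> = lam a (n + 1) * eig a n x"
    using lam_cong[of x a "n + 1"] eig_supp[of x a n] by (cases "x \<in> pball a (n + 1)") auto
  finally show ?thesis by simp
qed

text \<open>Symmetry of the operator, tested on an eigenfunction. With both functions resolved at
  the common scale \<open>i\<close>, multiplication by \<open>lam\<close> is symmetric, and so is
  the integral part by Fubini, as \<open>Jk\<close> is symmetric.\<close>

lemma calL_op_symmetric_eig: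
  assumes f: "ball_const j f" "ball_supp R f"
  shows "(\<integral>x. Lop f x * eigc a n x \<partial>M) = of_real (lam a (n + 1)) * (\<integral>x. f x * eigc a n x \<partial>M)"
    and "integrable M (\<lambda>x. Lop f x * eigc a n x)"
proof -
  define i where "i = min j n"
  have fi: "ball_const i f" using ball_const_mono[OF f(1)] by (simp add: i_def)
  have ei: "ball_const i (eigc a n)" using ball_const_mono[OF ball_const_eig] by (simp add: i_def)
  obtain R' where R': "ball_supp R' (eigc a n)" by (rule ball_supp_eig)
  have lami: "ball_const i (\<lambda>x. of_real (lam x i))" unfolding ball_const_def using lam_cong by auto
  have int1: "integrable M (\<lambda>x. f x * of_real (lam x i) * eigc a n x)"
    by (intro ball_const_ball_supp_integrable[of i _ R] ball_const_mult fi ei lami ball_supp_mult f)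
  have Ji: "ball_const i (\<lambda>x. \<integral>y. g y * of_real (Jk i x y) \<partial>M)" for g :: "'p padic \<Rightarrow> complex"
    unfolding ball_const_def
  proof (intro allI ballI)
    fix x y :: "'p padic" assume y: "y \<in> pball x i"
    show "(\<integral>z. g z * of_real (Jk i y z) \<partial>M) = (\<integral>z. g z * of_real (Jk i x z) \<partial>M)"
      by (intro Bochner_Integration.integral_cong refl) (simp only: Jk_cong[OF y])
  qed
  have int2: "integrable M (\<lambda>x. Jop i f x * eigc a n x)"
    by (intro ball_const_ball_supp_integrable[of i _ R'] ball_const_mult Ji ei ball_supp_mult2 R')
  have int3: "integrable M (\<lambda>x. f x * Jop i (eigc a n) x)"
    by (intro ball_const_ball_supp_integrable[of i _ R] ball_const_mult Ji fi ball_supp_mult f)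
  show "integrable M (\<lambda>x. Lop f x * eigc a n x)"
    unfolding calL_op_ball_const[OF fi f(2)] left_diff_distrib
    by (rule Bochner_Integration.integrable_diff[OF int1 int2])
  obtain B where B: "0 \<le> B" "\<And>x. cmod (f x) \<le> B" using ball_const_ball_supp_bounded[OF f] by blast
  obtain B' where B': "0 \<le> B'" "\<And>x. cmod (eigc a n x) \<le> B'" using ball_const_ball_supp_bounded[OF ei R'] by blast
  have [measurable]: "f \<in> borel_measurable borel" "eigc a n \<in> borel_measurable borel"
    using ball_const_measurable[OF fi] ball_const_measurable[OF ei] by auto
  have Jm [measurable]: "(\<lambda>(x, y). Jk i x y) \<in> borel_measurable (borel \<Otimes>\<^sub>M borel)" by (rule Jk_measurable2)
  \<comment> \<open>Truncation makes the integrand bounded, and it is supported in a product of two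
    balls of finite measure.\<close>
  have int4: "integrable (M \<Otimes>\<^sub>M M) (\<lambda>(x, y). f y * of_real (Jk i x y) * eigc a n x)"
  proof (rule integrableI_bounded_set[of "pball 0 R' \<times> pball 0 R" _ _ "B * (cJ * q i powr (- 1 - \<alpha>)) * B'"])
    show "pball 0 R' \<times> pball 0 R \<in> sets (M \<Otimes>\<^sub>M M)" by (intro pair_measureI) auto
    show "emeasure (M \<Otimes>\<^sub>M M) (pball 0 R' \<times> pball 0 R) < \<infinity>"
      by (subst emeasure_pair_measure_Times) (auto simp: emeasure_M_pball ennreal_mult_less_top)
    show "(\<lambda>(x, y). f y * of_real (Jk i x y) * eigc a n x) \<in> borel_measurable (M \<Otimes>\<^sub>M M)"
      by measurable
    show "AE z in M \<Otimes>\<^sub>M M. z \<notin> pball 0 R' \<times> pball 0 R \<longrightarrow> (case z of (x, y) \<Rightarrow> f y * of_real (Jk i x y) * eigc a n x) = 0"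
      using f(2) R' by (intro AE_I2) (auto simp: ball_supp_def)
    show "AE z in M \<Otimes>\<^sub>M M. z \<in> pball 0 R' \<times> pball 0 R \<longrightarrow>
        cmod (case z of (x, y) \<Rightarrow> f y * of_real (Jk i x y) * eigc a n x) \<le> B * (cJ * q i powr (- 1 - \<alpha>)) * B'"
    proof (intro AE_I2 impI)
      fix z :: "'p padic \<times> 'p padic"
      obtain x y where z: "z = (x, y)" by fastforce
      have "cmod (f y * of_real (Jk i x y) * eigc a n x) = cmod (f y) * Jk i x y * cmod (eigc a n x)"
        by (simp add: norm_mult)
      also have "\<dots> \<le> B * (cJ * q i powr (- 1 - \<alpha>)) * B'"
        using B B' Jk_le[of i x y] cJ_pos by (intro mult_mono) (auto intro!: mult_nonneg_nonneg)
      finally show "cmod (case z of (x, y) \<Rightarrow> f y * of_real (Jk i x y) * eigc a n x)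
          \<le> B * (cJ * q i powr (- 1 - \<alpha>)) * B'" by (simp only: z prod.case)
    qed
  qed
  have "(\<integral>x. Jop i f x * eigc a n x \<partial>M)
      = (\<integral>x. (\<integral>y. f y * of_real (Jk i x y) * eigc a n x \<partial>M) \<partial>M)"
    by simp
  also have "\<dots> = (\<integral>y. (\<integral>x. f y * of_real (Jk i x y) * eigc a n x \<partial>M) \<partial>M)"
    by (rule MM.Fubini_integral[OF int4, symmetric])
  also have "\<dots> = (\<integral>y. f y * Jop i (eigc a n) y \<partial>M)"
  proof (rule Bochner_Integration.integral_cong[OF refl])
    fix y
    have "(\<integral>x. f y * of_real (Jk i x y) * eigc a n x \<partial>M) = (\<integral>x. f y * (eigc a n x * of_real (Jk i y x)) \<partial>M)"
      by (intro Bochner_Integration.integral_cong refl) (simp add: Jk_sym[of i y] mult_ac)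
    then show "(\<integral>x. f y * of_real (Jk i x y) * eigc a n x \<partial>M) = f y * Jop i (eigc a n) y"
      by simp
  qed
  finally have fub: "(\<integral>x. Jop i f x * eigc a n x \<partial>M)
      = (\<integral>x. f x * Jop i (eigc a n) x \<partial>M)" .
  have "(\<integral>x. Lop f x * eigc a n x \<partial>M)
      = (\<integral>x. f x * of_real (lam x i) * eigc a n x \<partial>M) - (\<integral>x. f x * Jop i (eigc a n) x \<partial>M)"
    unfolding calL_op_ball_const[OF fi f(2)] left_diff_distrib fub[symmetric]
    by (rule Bochner_Integration.integral_diff[OF int1 int2])
  also have "\<dots> = (\<integral>x. f x * of_real (lam x i) * eigc a n x - f x * Jop i (eigc a n) x \<partial>M)"
    by (rule Bochner_Integration.integral_diff[OF int1 int3, symmetric])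
  also have "\<dots> = (\<integral>x. of_real (lam a (n + 1)) * (f x * eigc a n x) \<partial>M)"
  proof (rule Bochner_Integration.integral_cong[OF refl])
    fix x
    \<comment> \<open>The two halves recombine to the operator applied to the eigenfunction, where
      its eigenvalue can be used.\<close>
    have "f x * of_real (lam x i) * eigc a n x - f x * Jop i (eigc a n) x
        = f x * Lop (eigc a n) x"
      unfolding calL_op_ball_const[OF ei R'] by (simp add: algebra_simps)
    then show "f x * of_real (lam x i) * eigc a n x - f x * Jop i (eigc a n) x
        = of_real (lam a (n + 1)) * (f x * eigc a n x)"
      unfolding calL_op_eig by (simp add: mult_ac)
  qed
  also have "\<dots> = of_real (lam a (n + 1)) * (\<integral>x. f x * eigc a n x \<partial>M)" by simp
  finally show "(\<integral>x. Lop f x * eigc a n x \<partial>M) = of_real (lam a (n + 1)) * (\<integral>x. f x * eigc a n x \<partial>M)" .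
qed

subsection \<open>The span of the eigenfunctions\<close>

text \<open>The linear span, built by adding one multiple of an eigenfunction at a time, so that
  linear statements follow by induction.\<close>

inductive span_eig :: "('p padic \<Rightarrow> complex) \<Rightarrow> bool" where
  zero: "span_eig (\<lambda>_. 0)"
| add: "span_eig f \<Longrightarrow> span_eig (\<lambda>x. f x + c * eigc a n x)"

lemma span_eig_ball_const:
  assumes "span_eig f" shows "\<exists>j R. ball_const j f \<and> ball_supp R f"
  using assms
proof induction
  case zero
  then show ?case by auto
next
  case (add f c a n)
  then obtain j R where f: "ball_const j f" "ball_supp R f" by blast
  obtain R' where R': "ball_supp R' (eigc a n)" by (rule ball_supp_eig)
  have "ball_const (min j n) (\<lambda>x. f x + c * eigc a n x)"
    by (intro ball_const_add ball_const_mult ball_const_const ball_const_mono[OF f(1)] ball_const_mono[OF ball_const_eig]) auto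
  moreover have "ball_supp (max R R') (\<lambda>x. f x + c * eigc a n x)"
    by (intro ball_supp_add ball_supp_mult2 ball_supp_mono[OF f(2)] ball_supp_mono[OF R']) auto
  ultimately show ?case by blast
qed

lemma span_eig_add_scaled:
  assumes "span_eig f" "span_eig g" shows "span_eig (\<lambda>x. f x + c * g x)"
  using assms(2)
proof induction
  case zero
  then show ?case using assms(1) by simp
next
  case (add g d a n)
  then have "span_eig (\<lambda>x. (f x + c * g x) + (c * d) * eigc a n x)" by (intro span_eig.add)
  then show ?case by (simp add: algebra_simps)
qed

text \<open>On the span the resolvent is explicit: each coefficient is divided by the corresponding
  \<open>lam + l\<close>. The image stays in the span, hence consists of test functions on which the
  operator acts pointwise.\<close>

lemma span_eig_resolvent:
  assumes "span_eig f" and l: "0 < l"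
  shows "\<exists>\<phi>. span_eig \<phi> \<and> (\<forall>x. integrable M (\<lambda>y. of_real (Gr l x y) * f y)
      \<and> (\<integral>y. of_real (Gr l x y) * f y \<partial>M) = \<phi> x
      \<and> Lop \<phi> x = f x - of_real l * \<phi> x)"
  using assms(1)
proof induction
  case zero
  have "Lop (\<lambda>_. 0) x = 0" for x by (simp add: calL_op_def)
  then show ?case by (intro exI[of _ "\<lambda>_. 0"]) (simp add: span_eig.zero)
next
  case (add f c a n)
  then obtain \<phi> where \<phi>: "span_eig \<phi>" "\<And>x. integrable M (\<lambda>y. of_real (Gr l x y) * f y)"
    "\<And>x. (\<integral>y. of_real (Gr l x y) * f y \<partial>M) = \<phi> x"
    "\<And>x. Lop \<phi> x = f x - of_real l * \<phi> x" by blast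
  let ?r = "lam a (n + 1) + l"
  let ?d = "c / of_real ?r"
  have r: "?r \<noteq> 0" using lam_plus_pos[of l a "n + 1"] l by linarith
  have eq: "of_real (Gr l x y) * (f y + c * eigc a n y)
      = of_real (Gr l x y) * f y + c * of_real (Gr l x y * eig a n y)" for x y
    by (simp add: algebra_simps)
  have int: "integrable M (\<lambda>y. Gr l x y * eig a n y)" for x
  proof -
    have "integrable M (\<lambda>y. (Gr l x y * indicator (pball a n) y) / mu a n
          - (Gr l x y * indicator (pball a (n + 1)) y) / mu a (n + 1))"
      using integrable_G_indicator[OF l] by (intro Bochner_Integration.integrable_diff) auto
    then show ?thesis by (simp add: eig_def algebra_simps)
  qed
  have int': "integrable M (\<lambda>y. c * complex_of_real (Gr l x y * eig a n y))" for x
    using int[of x] by (intro integrable_mult_right integrable_of_real) auto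
  obtain j R where lj: "ball_const j \<phi>" "ball_supp R \<phi>" using span_eig_ball_const[OF \<phi>(1)] by blast
  obtain R' where R': "ball_supp R' (eigc a n)" by (rule ball_supp_eig)
  show ?case
  proof (intro exI[of _ "\<lambda>x. \<phi> x + ?d * eigc a n x"] conjI allI)
    show "span_eig (\<lambda>x. \<phi> x + ?d * eigc a n x)" using \<phi>(1) by (rule span_eig.add)
    fix x
    show "integrable M (\<lambda>y. of_real (Gr l x y) * (f y + c * eigc a n y))"
      unfolding eq using \<phi>(2) int' by (rule Bochner_Integration.integrable_add)
    have "(\<integral>y. of_real (Gr l x y) * (f y + c * eigc a n y) \<partial>M)
        = \<phi> x + (\<integral>y. c * complex_of_real (Gr l x y * eig a n y) \<partial>M)"
      unfolding eq \<phi>(3)[symmetric] by (rule Bochner_Integration.integral_add[OF \<phi>(2) int'])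
    also have "(\<integral>y. c * complex_of_real (Gr l x y * eig a n y) \<partial>M)
        = c * complex_of_real (eig a n x / ?r)"
      unfolding integral_G_eig[OF l, symmetric] by (simp only: integral_mult_right_zero integral_complex_of_real)
    finally show "(\<integral>y. of_real (Gr l x y) * (f y + c * eigc a n y) \<partial>M) = \<phi> x + ?d * eigc a n x"
      by simp
    have "Lop (\<lambda>x. \<phi> x + ?d * eigc a n x) x
        = Lop \<phi> x + ?d * Lop (eigc a n) x"
      by (rule calL_op_add[of "min j n" _ "max R R'"])
         (auto intro: ball_const_mono[OF lj(1)] ball_const_mono[OF ball_const_eig] ball_supp_mono[OF lj(2)] ball_supp_mono[OF R'])
    also have "?d * Lop (eigc a n) x = c * eigc a n x - of_real l * (?d * eigc a n x)"
    proof -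
      define z where "z = complex_of_real ?r"
      have "z \<noteq> 0" using r unfolding z_def of_real_eq_0_iff .
      moreover have lz: "complex_of_real (lam a (n + 1)) = z - of_real l" by (simp add: z_def)
      ultimately show ?thesis unfolding calL_op_eig lz z_def[symmetric] by (simp add: field_simps)
    qed
    finally show "Lop (\<lambda>x. \<phi> x + ?d * eigc a n x) x
        = (f x + c * eigc a n x) - of_real l * (\<phi> x + ?d * eigc a n x)"
      unfolding \<phi>(4) by (simp add: algebra_simps)
  qed
qed

end

section \<open>Density of the span of the eigenfunctions\<close>

text \<open>The empty set makes the family stable under intersection, two balls being nested or
  disjoint.\<close>

definition padic_ball_sets :: "'p::prime_card padic set set" where
  "padic_ball_sets = insert {} (range (\<lambda>(a, k). pball a k))"

text \<open>Balls with rational centres already generate the Borel sets, being a countable basis;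
  the other balls are Borel.\<close>

lemma borel_padic_ball_sets: "borel = sigma UNIV (padic_ball_sets :: 'p::prime_card padic set set)"
proof (rule measure_eqI)
  let ?B = "range (\<lambda>(r, k). pball (of_rat r :: 'p padic) k)"
  have B: "borel = sigma UNIV ?B"
    using padic_topological_basis by (intro borel_eq_countable_basis countable_image) auto
  have "?B \<subseteq> padic_ball_sets" by (auto simp: padic_ball_sets_def)
  then have "sigma_sets UNIV ?B \<subseteq> sigma_sets UNIV (padic_ball_sets :: 'p padic set set)"
    by (rule sigma_sets_mono')
  moreover have "sigma_sets UNIV padic_ball_sets \<subseteq> sets (borel :: 'p padic measure)"
    by (rule sets.sigma_sets_subset[of _ borel, simplified]) (auto simp: padic_ball_sets_def)
  moreover have "sets (borel :: 'p padic measure) = sigma_sets UNIV ?B"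
    by (subst B) simp
  ultimately show "sets (borel :: 'p padic measure) = sets (sigma UNIV padic_ball_sets)" by auto
  show "emeasure borel A = emeasure (sigma UNIV padic_ball_sets) A" for A :: "'p padic set"
    by (simp add: borel_def emeasure_sigma)
qed

lemma Int_stable_padic_ball_sets: "Int_stable (padic_ball_sets :: 'p::prime_card padic set set)"
proof (rule Int_stableI)
  fix A B :: "'p padic set" assume "A \<in> padic_ball_sets" "B \<in> padic_ball_sets"
  then consider "A = {} \<or> B = {}" | a j b k where "A = pball a j" "B = pball b k"
    by (auto simp: padic_ball_sets_def)
  then show "A \<inter> B \<in> padic_ball_sets"
  proof cases
    case 2
    have nested: "pball a i \<inter> pball b k \<in> {{}, pball a i}" if "i \<le> k" for a b :: "'p padic" and i k
    proof (cases "pball a i \<inter> pball b k = {}")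
      case False
      then obtain c where "c \<in> pball a i" "c \<in> pball b k" by blast
      then have "pball a i = pball c i" "pball b k = pball c k" using pball_eq by blast+
      then show ?thesis using pball_mono[OF that, of c] by blast
    qed simp
    have "A \<inter> B \<in> {{}, A, B}"
      using nested[of j k a b] nested[of k j b a] 2 by (cases "j \<le> k") auto
    then show ?thesis using 2 by (auto simp: padic_ball_sets_def)
  qed (auto simp: padic_ball_sets_def)
qed

lemma ennreal_two_plus_two: "0 \<le> d \<Longrightarrow> 2 * ennreal d + 2 * ennreal d = ennreal (4 * d)"
proof -
  assume d: "0 \<le> d"
  have "ennreal (4 * d) = ennreal (2 * d + 2 * d)" by simp
  also have "\<dots> = ennreal (2 * d) + ennreal (2 * d)" using d by (intro ennreal_plus) auto
  also have "ennreal (2 * d) = 2 * ennreal d" using d by (simp add: ennreal_mult)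
  finally show ?thesis by (rule sym)
qed

lemma cmod_square_add_le: "ennreal ((cmod (a + b))\<^sup>2) \<le> 2 * ennreal ((cmod a)\<^sup>2) + 2 * ennreal ((cmod b)\<^sup>2)"
proof -
  have "(cmod (a + b))\<^sup>2 \<le> (cmod a + cmod b)\<^sup>2" by (intro power_mono norm_triangle_ineq) simp
  also have "\<dots> \<le> 2 * (cmod a)\<^sup>2 + 2 * (cmod b)\<^sup>2"
    using zero_le_power2[of "cmod a - cmod b"] by (simp add: power2_eq_square algebra_simps)
  finally have "ennreal ((cmod (a + b))\<^sup>2) \<le> ennreal (2 * (cmod a)\<^sup>2 + 2 * (cmod b)\<^sup>2)"
    by (rule ennreal_leI)
  then show ?thesis by (simp add: ennreal_mult)
qed

context hweight
begin

abbreviation sqn :: "('p padic \<Rightarrow> complex) \<Rightarrow> ennreal" where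
  "sqn f \<equiv> (\<integral>\<^sup>+x. ennreal ((cmod (f x))\<^sup>2) \<partial>M)"

lemma sqn_add_le:
  assumes [measurable]: "f \<in> borel_measurable borel" "g \<in> borel_measurable borel"
  shows "sqn (\<lambda>x. f x + g x) \<le> 2 * sqn f + 2 * sqn g"
proof -
  have "sqn (\<lambda>x. f x + g x) \<le> (\<integral>\<^sup>+x. 2 * ennreal ((cmod (f x))\<^sup>2) + 2 * ennreal ((cmod (g x))\<^sup>2) \<partial>M)"
    by (intro nn_integral_mono cmod_square_add_le)
  also have "\<dots> = 2 * sqn f + 2 * sqn g"
    by (simp add: nn_integral_add nn_integral_cmult)
  finally show ?thesis .
qed

lemma sqn_scale:
  assumes [measurable]: "f \<in> borel_measurable borel"
  shows "sqn (\<lambda>x. c * f x) = ennreal ((cmod c)\<^sup>2) * sqn f"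
  by (simp add: norm_mult power_mult_distrib ennreal_mult nn_integral_cmult)

text \<open>Membership in the closure of the span in L2. Squared norms are kept throughout, so
  \<open>sqn_add_le\<close> with its factors 2 takes the place of the triangle inequality.\<close>

definition approximable :: "('p padic \<Rightarrow> complex) \<Rightarrow> bool" where
  "approximable f \<longleftrightarrow> f \<in> borel_measurable borel \<and> (\<forall>e>0. \<exists>\<psi>. span_eig \<psi> \<and> sqn (\<lambda>x. f x - \<psi> x) < ennreal e)"

lemma span_eig_measurable: "span_eig f \<Longrightarrow> f \<in> borel_measurable borel"
  using span_eig_ball_const ball_const_measurable by blast

lemma approximable_limit:
  assumes f [measurable]: "f \<in> borel_measurable borel"
    and lim: "\<And>e. 0 < e \<Longrightarrow> \<exists>g. approximable g \<and> sqn (\<lambda>x. f x - g x) < ennreal e"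
  shows "approximable f"
  unfolding approximable_def
proof (intro conjI allI impI f)
  fix e :: real assume e: "0 < e"
  \<comment> \<open>Each of the two errors is doubled by \<open>sqn_add_le\<close>, hence the
    quarter of \<open>e\<close>.\<close>
  obtain g where g: "approximable g" "sqn (\<lambda>x. f x - g x) < ennreal (e / 4)" using lim[of "e / 4"] e by auto
  obtain \<psi> where \<psi>: "span_eig \<psi>" "sqn (\<lambda>x. g x - \<psi> x) < ennreal (e / 4)"
    using g(1) e unfolding approximable_def by (meson divide_pos_pos zero_less_numeral)
  have [measurable]: "g \<in> borel_measurable borel" "\<psi> \<in> borel_measurable borel"
    using g(1) span_eig_measurable[OF \<psi>(1)] by (auto simp: approximable_def)
  have "sqn (\<lambda>x. f x - \<psi> x) = sqn (\<lambda>x. (f x - g x) + (g x - \<psi> x))" by simp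
  also have "\<dots> \<le> 2 * sqn (\<lambda>x. f x - g x) + 2 * sqn (\<lambda>x. g x - \<psi> x)" by (rule sqn_add_le) auto
  also have "\<dots> < 2 * ennreal (e / 4) + 2 * ennreal (e / 4)"
    using g(2) \<psi>(2) by (intro add_strict_mono ennreal_mult_strict_left_mono) auto
  also have "\<dots> = ennreal (4 * (e / 4))" using e by (intro ennreal_two_plus_two) simp
  also have "4 * (e / 4) = e" by simp
  finally show "\<exists>\<psi>. span_eig \<psi> \<and> sqn (\<lambda>x. f x - \<psi> x) < ennreal e" using \<psi>(1) by blast
qed

lemma span_eig_approximable: "span_eig f \<Longrightarrow> approximable f"
  unfolding approximable_def using span_eig_measurable by (auto intro!: exI[of _ f])

lemma approximable_add_scaled:
  assumes f: "approximable f" and g: "approximable g" shows "approximable (\<lambda>x. f x + c * g x)"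
  unfolding approximable_def
proof (intro conjI allI impI)
  have [measurable]: "f \<in> borel_measurable borel" "g \<in> borel_measurable borel"
    using f g by (auto simp: approximable_def)
  show "(\<lambda>x. f x + c * g x) \<in> borel_measurable borel" by measurable
  fix e :: real assume e: "0 < e"
  \<comment> \<open>The summand 1 in the denominator keeps this valid for
    \<open>c = 0\<close>.\<close>
  define d where "d = e / 4 / (1 + (cmod c)\<^sup>2)"
  have pos: "0 < 1 + (cmod c)\<^sup>2" by (simp add: add_pos_nonneg)
  have d: "0 < d" using e pos by (simp add: d_def)
  obtain \<phi> where \<phi>: "span_eig \<phi>" "sqn (\<lambda>x. f x - \<phi> x) < ennreal (e / 4)"
    using f e unfolding approximable_def by (meson divide_pos_pos zero_less_numeral)
  obtain \<psi> where \<psi>: "span_eig \<psi>" "sqn (\<lambda>x. g x - \<psi> x) < ennreal d"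
    using g d unfolding approximable_def by blast
  have [measurable]: "\<phi> \<in> borel_measurable borel" "\<psi> \<in> borel_measurable borel"
    using span_eig_measurable \<phi>(1) \<psi>(1) by auto
  have "sqn (\<lambda>x. (f x + c * g x) - (\<phi> x + c * \<psi> x)) = sqn (\<lambda>x. (f x - \<phi> x) + c * (g x - \<psi> x))"
    by (simp add: algebra_simps)
  also have "\<dots> \<le> 2 * sqn (\<lambda>x. f x - \<phi> x) + 2 * sqn (\<lambda>x. c * (g x - \<psi> x))" by (rule sqn_add_le) auto
  also have "sqn (\<lambda>x. c * (g x - \<psi> x)) = ennreal ((cmod c)\<^sup>2) * sqn (\<lambda>x. g x - \<psi> x)"
    by (rule sqn_scale) auto
  also have "\<dots> \<le> ennreal ((cmod c)\<^sup>2) * ennreal d" using \<psi>(2) by (intro mult_left_mono) auto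
  also have "\<dots> \<le> ennreal (e / 4)"
    unfolding ennreal_mult[symmetric, OF zero_le_power2 less_imp_le[OF d]] using e pos
    by (intro ennreal_leI) (simp add: d_def field_simps)
  also have "2 * sqn (\<lambda>x. f x - \<phi> x) + 2 * ennreal (e / 4) < 2 * ennreal (e / 4) + 2 * ennreal (e / 4)"
  proof -
    have "2 * ennreal (e / 4) \<noteq> \<infinity>" by (simp add: ennreal_mult_eq_top_iff)
    then show ?thesis
      using ennreal_mult_strict_left_mono[OF \<phi>(2), of 2]
      by (simp add: ennreal_add_left_cancel_less add.commute)
  qed
  also have "\<dots> = ennreal (4 * (e / 4))" using e by (intro ennreal_two_plus_two) simp
  also have "4 * (e / 4) = e" by simp
  finally have "sqn (\<lambda>x. (f x + c * g x) - (\<phi> x + c * \<psi> x)) < ennreal e"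
    by (simp add: add_left_mono mult_left_mono)
  then show "\<exists>\<psi>. span_eig \<psi> \<and> sqn (\<lambda>x. (f x + c * g x) - \<psi> x) < ennreal e"
    using span_eig_add_scaled[OF \<phi>(1) \<psi>(1), of c] by (intro exI[of _ "\<lambda>x. \<phi> x + c * \<psi> x"]) auto
qed

lemma approximable_zero: "approximable (\<lambda>_. 0)"
  by (rule span_eig_approximable) (rule span_eig.zero)

lemma approximable_scale: "approximable f \<Longrightarrow> approximable (\<lambda>x. c * f x)"
  using approximable_add_scaled[OF approximable_zero, of f c] by simp

lemma approximable_add: "approximable f \<Longrightarrow> approximable g \<Longrightarrow> approximable (\<lambda>x. f x + g x)"
  using approximable_add_scaled[of f g 1] by simp

lemma approximable_diff: "approximable f \<Longrightarrow> approximable g \<Longrightarrow> approximable (\<lambda>x. f x - g x)"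
  using approximable_add_scaled[of f g "- 1"] by simp

lemma approximable_sum: "finite I \<Longrightarrow> (\<And>i. i \<in> I \<Longrightarrow> approximable (f i)) \<Longrightarrow> approximable (\<lambda>x. \<Sum>i\<in>I. f i x)"
  by (induction I rule: finite_induct) (auto intro: approximable_zero approximable_add)

text \<open>Dominated convergence in L2: the limit inherits the bound \<open>w\<close>, so the
  squared differences are at most 4 w^2. It serves countable unions, exhaustion by balls and
  approximation by simple functions alike.\<close>

lemma approximable_dominated:
  fixes w :: "'p padic \<Rightarrow> real"
  assumes f [measurable]: "f \<in> borel_measurable borel" and g: "\<And>n :: nat. approximable (g n)"
    and lim: "\<And>x. (\<lambda>n. g n x) \<longlonglongrightarrow> f x"
    and w: "\<And>n x. cmod (g n x) \<le> w x" "w \<in> borel_measurable borel"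
      "(\<integral>\<^sup>+x. ennreal ((w x)\<^sup>2) \<partial>M) < \<infinity>"
  shows "approximable f"
proof (rule approximable_limit[OF f])
  fix e :: real assume e: "0 < e"
  note w(2) [measurable]
  have [measurable]: "g n \<in> borel_measurable borel" for n using g by (auto simp: approximable_def)
  have fw: "cmod (f x) \<le> w x" for x
    using tendsto_norm[OF lim[of x]] w(1) by (intro LIMSEQ_le_const2) auto
  have "(\<lambda>n. sqn (\<lambda>x. f x - g n x)) \<longlonglongrightarrow> (\<integral>\<^sup>+x. 0 \<partial>M)"
  proof (rule nn_integral_dominated_convergence)
    show "(\<integral>\<^sup>+x. 4 * ennreal ((w x)\<^sup>2) \<partial>M) < \<infinity>"
      using w(3) by (simp add: nn_integral_cmult ennreal_mult_less_top)
    show "AE x in M. ennreal ((cmod (f x - g n x))\<^sup>2) \<le> 4 * ennreal ((w x)\<^sup>2)" for n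
    proof (rule AE_I2)
      fix x
      have "cmod (f x - g n x) \<le> 2 * w x"
        using norm_triangle_ineq4[of "f x" "g n x"] fw[of x] w(1)[of n x] by linarith
      then have "(cmod (f x - g n x))\<^sup>2 \<le> (2 * w x)\<^sup>2" by (intro power_mono) auto
      then have "ennreal ((cmod (f x - g n x))\<^sup>2) \<le> ennreal (4 * (w x)\<^sup>2)"
        by (intro ennreal_leI) (simp add: power_mult_distrib)
      then show "ennreal ((cmod (f x - g n x))\<^sup>2) \<le> 4 * ennreal ((w x)\<^sup>2)"
        by (simp add: ennreal_mult)
    qed
    show "AE x in M. (\<lambda>n. ennreal ((cmod (f x - g n x))\<^sup>2)) \<longlonglongrightarrow> 0"
    proof (rule AE_I2)
      fix x
      have "(\<lambda>n. (cmod (f x - g n x))\<^sup>2) \<longlonglongrightarrow> (cmod (f x - f x))\<^sup>2"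
        by (intro tendsto_intros lim)
      then show "(\<lambda>n. ennreal ((cmod (f x - g n x))\<^sup>2)) \<longlonglongrightarrow> 0"
        using tendsto_ennrealI by fastforce
    qed
  qed measurable
  then have "(\<lambda>n. sqn (\<lambda>x. f x - g n x)) \<longlonglongrightarrow> 0" by simp
  then have "eventually (\<lambda>n. sqn (\<lambda>x. f x - g n x) < ennreal e) sequentially"
    by (rule order_tendstoD) (use e in simp)
  then obtain n where "sqn (\<lambda>x. f x - g n x) < ennreal e"
    unfolding eventually_sequentially by blast
  then show "\<exists>g. approximable g \<and> sqn (\<lambda>x. f x - g x) < ennreal e" using g by blast
qed

lemma mu_unbounded: "\<exists>k. B < mu a (n + int k)"
proof -
  obtain r where r: "dist 0 a < q r" using q_above by blast
  \<comment> \<open>Once the ball contains 0, \<open>W\<close> is a pure power of the radius with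
    exponent 1 + \<beta> > 0; this \<open>i\<close> solves for the radius at which \<open>cW\<close>
    times that power exceeds \<open>B\<close>.\<close>
  obtain i where i: "(max B 1 / cW) powr (1 / (1 + \<beta>)) < q i" using q_above by blast
  define k where "k = nat (max (max r i) n - n)"
  let ?k = "n + int k"
  have ge: "r \<le> ?k" "i \<le> ?k" by (simp_all add: k_def)
  have "q r \<le> q ?k" using ge(1) by simp
  then have "nrm a \<le> q ?k" using r unfolding padic_norm_eq_dist dist_commute[of a] by linarith
  then have W: "W a ?k = q ?k powr (1 + \<beta>)" by (simp add: W_def N_def powr_add)
  have b: "0 < 1 + \<beta>" using beta_gt by simp
  have "max B 1 / cW = ((max B 1 / cW) powr (1 / (1 + \<beta>))) powr (1 + \<beta>)"
    using b cW_pos by (simp add: powr_powr)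
  also have "\<dots> < q ?k powr (1 + \<beta>)"
    using b i q_le_iff[of i ?k] ge(2) by (intro powr_less_mono2) (auto intro: less_le_trans)
  finally have "max B 1 < cW * W a ?k" using cW_pos W by (simp add: field_simps)
  then have "B < mu a ?k" using mu_ge[of a ?k] by linarith
  then show ?thesis by blast
qed

text \<open>Eigenfunctions summed up the chain of ancestors telescope to the normalised indicator of
  the ball minus that of the last ancestor. The latter has squared norm 1/mu, which tends to
  0.\<close>

lemma approximable_pball: "approximable (\<lambda>x. complex_of_real (indicator (pball a n) x))"
proof -
  let ?u = "\<lambda>k x. complex_of_real (indicator (pball a (n + int k)) x / mu a (n + int k))"
  have span: "span_eig (\<lambda>x. ?u 0 x - ?u k x)" for k
  proof (induction k)
    case 0
    then show ?case by (simp add: span_eig.zero)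
  next
    case (Suc k)
    then have "span_eig (\<lambda>x. (?u 0 x - ?u k x) + 1 * eigc a (n + int k) x)" by (rule span_eig.add)
    moreover have "(?u 0 x - ?u k x) + 1 * eigc a (n + int k) x = ?u 0 x - ?u (Suc k) x" for x
      by (simp add: eig_def add.assoc add.commute[of 1])
    ultimately show ?case by (simp only:)
  qed
  have "approximable (?u 0)"
  proof (rule approximable_limit)
    show "?u 0 \<in> borel_measurable borel" by measurable
    fix e :: real assume e: "0 < e"
    obtain k where k: "1 / e < mu a (n + int k)" using mu_unbounded by blast
    let ?m = "mu a (n + int k)"
    have "sqn (\<lambda>x. ?u 0 x - (?u 0 x - ?u k x)) = (\<integral>\<^sup>+x. ennreal (1 / ?m\<^sup>2) * indicator (pball a (n + int k)) x \<partial>M)"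
      by (intro nn_integral_cong) (auto simp: indicator_def norm_divide power_divide)
    also have "\<dots> = ennreal (1 / ?m\<^sup>2 * ?m)"
      by (subst nn_integral_cmult_indicator) (auto simp: emeasure_M_pball ennreal_mult[symmetric])
    also have "\<dots> < ennreal e"
      using k e mu_pos[of a "n + int k"] by (simp add: ennreal_less_iff field_simps power2_eq_square)
    finally show "\<exists>g. approximable g \<and> sqn (\<lambda>x. ?u 0 x - g x) < ennreal e"
      using span_eig_approximable[OF span[of k]] by (intro exI[of _ "\<lambda>x. ?u 0 x - ?u k x"]) auto
  qed
  then have "approximable (\<lambda>x. of_real (mu a n) * ?u 0 x)" by (rule approximable_scale)
  then show ?thesis by simp
qed

text \<open>Dynkin induction from the balls. Intersecting with a fixed ball keeps all measures
  finite, so complements are differences of approximable functions.\<close>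

lemma approximable_indicator_bounded:
  assumes "A \<in> sets borel"
  shows "approximable (\<lambda>x. complex_of_real (indicator (A \<inter> pball 0 R) x))"
proof -
  have A: "A \<in> sigma_sets UNIV padic_ball_sets"
    using assms by (subst (asm) borel_padic_ball_sets) simp
  have sub: "(padic_ball_sets :: 'p padic set set) \<subseteq> Pow UNIV" by simp
  show ?thesis using Int_stable_padic_ball_sets sub A
  proof (induction rule: sigma_sets_induct_disjoint)
    case (basic A)
    moreover have "pball 0 R \<in> (padic_ball_sets :: 'p padic set set)" by (auto simp: padic_ball_sets_def)
    ultimately have "A \<inter> pball 0 R \<in> padic_ball_sets"
      using Int_stable_padic_ball_sets by (rule Int_stableD[rotated])
    then consider "A \<inter> pball 0 R = {}" | a k where "A \<inter> pball 0 R = pball a k"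
      by (auto simp: padic_ball_sets_def)
    then show ?case using approximable_zero approximable_pball by cases auto
  next
    case empty
    then show ?case using approximable_zero by simp
  next
    case (compl A)
    have "complex_of_real (indicator ((UNIV - A) \<inter> pball 0 R) x)
        = of_real (indicator (pball 0 R) x) - of_real (indicator (A \<inter> pball 0 R) x)" for x
      by (simp add: indicator_def)
    then show ?case using approximable_diff[OF approximable_pball[of 0 R] compl(2)] by simp
  next
    case (union A)
    have meas: "A i \<in> sets borel" for i
      using union(2) by (subst borel_padic_ball_sets) (auto simp: padic_ball_sets_def)
    note meas [measurable]
    show ?case
    proof (rule approximable_dominated[where w = "indicator (pball 0 R)"])
      show "approximable (\<lambda>x. \<Sum>i<n. complex_of_real (indicator (A i \<inter> pball 0 R) x))" for n
        using union(3) by (intro approximable_sum) auto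
      have sum_eq: "(\<Sum>i<n. complex_of_real (indicator (A i \<inter> pball 0 R) x))
          = of_real (indicator ((\<Union>i<n. A i) \<inter> pball 0 R) x)" for n x
      proof -
        have "disjoint_family_on A {..<n}" using union(1) by (rule disjoint_family_on_mono[rotated]) simp
        then have "(\<Sum>i<n. indicator (A i) x) = (indicator (\<Union>i<n. A i) x :: real)"
          by (intro indicator_UN_disjoint[symmetric]) auto
        then show ?thesis
          by (simp add: indicator_inter_arith flip: of_real_sum sum_distrib_right)
      qed
      show "(\<lambda>n. \<Sum>i<n. complex_of_real (indicator (A i \<inter> pball 0 R) x))
          \<longlonglongrightarrow> of_real (indicator (\<Union> (range A) \<inter> pball 0 R) x)" for x
      proof (rule tendsto_eventually)
        show "eventually (\<lambda>n. (\<Sum>i<n. complex_of_real (indicator (A i \<inter> pball 0 R) x))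
            = of_real (indicator (\<Union> (range A) \<inter> pball 0 R) x)) sequentially"
        proof (cases "x \<in> \<Union> (range A)")
          case True
          then obtain k where k: "x \<in> A k" by blast
          show ?thesis unfolding sum_eq eventually_sequentially
            using k True by (intro exI[of _ "Suc k"]) (auto simp: indicator_def)
        next
          case False
          then show ?thesis unfolding sum_eq by (intro always_eventually) (auto simp: indicator_def)
        qed
      qed
      show "cmod (\<Sum>i<n. complex_of_real (indicator (A i \<inter> pball 0 R) x)) \<le> indicator (pball 0 R) x" for n x
        unfolding sum_eq by (auto simp: indicator_def)
      have "(\<integral>\<^sup>+x. ennreal ((indicator (pball 0 R) x)\<^sup>2) \<partial>M) = (\<integral>\<^sup>+x. indicator (pball 0 R) x \<partial>M)"
        by (intro nn_integral_cong) (auto simp: indicator_def)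
      then show "(\<integral>\<^sup>+x. ennreal ((indicator (pball 0 R) x)\<^sup>2) \<partial>M) < \<infinity>"
        by (simp add: emeasure_M_pball)
    qed measurable
  qed
qed

lemma approximable_indicator:
  assumes A: "A \<in> sets borel" "emeasure M A < \<infinity>"
  shows "approximable (\<lambda>x. complex_of_real (indicator A x))"
proof (rule approximable_dominated[where w = "indicator A" and g = "\<lambda>n x. complex_of_real (indicator (A \<inter> pball 0 (int n)) x)"])
  note A(1) [measurable]
  show "(\<lambda>x. complex_of_real (indicator A x)) \<in> borel_measurable borel" by measurable
  show "indicator A \<in> borel_measurable borel" by measurable
  show "approximable (\<lambda>x. complex_of_real (indicator (A \<inter> pball 0 (int n)) x))" for n
    using A(1) by (rule approximable_indicator_bounded)
  show "(\<lambda>n. complex_of_real (indicator (A \<inter> pball 0 (int n)) x)) \<longlonglongrightarrow> of_real (indicator A x)" for x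
  proof (rule tendsto_eventually)
    obtain k where k: "dist 0 x < q k" using q_above by blast
    have "x \<in> pball 0 (int n)" if "nat k \<le> n" for n
    proof -
      have "q k \<le> q (int n)" using that by simp
      then show ?thesis using k unfolding mem_pball by linarith
    qed
    then show "eventually (\<lambda>n. complex_of_real (indicator (A \<inter> pball 0 (int n)) x) = of_real (indicator A x)) sequentially"
      unfolding eventually_sequentially by (intro exI[of _ "nat k"]) (auto simp: indicator_def)
  qed
  have "(\<integral>\<^sup>+x. ennreal ((indicator A x)\<^sup>2) \<partial>M) = (\<integral>\<^sup>+x. indicator A x \<partial>M)"
    by (intro nn_integral_cong) (auto simp: indicator_def)
  then show "(\<integral>\<^sup>+x. ennreal ((indicator A x)\<^sup>2) \<partial>M) < \<infinity>" using A by simp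
qed (auto simp: indicator_def)

lemma approximable_simple:
  assumes F: "simple_function M F" and fin: "sqn F < \<infinity>"
  shows "approximable F"
proof -
  have meas [measurable]: "F \<in> borel_measurable borel"
    using borel_measurable_simple_function[OF F] by simp
  have finF: "finite (F ` UNIV)" using simple_functionD(1)[OF F] by simp
  have "approximable (\<lambda>x. \<Sum>y\<in>F ` UNIV. y * complex_of_real (indicator (F -` {y}) x))"
  proof (rule approximable_sum[OF finF])
    fix y assume "y \<in> F ` UNIV"
    show "approximable (\<lambda>x. y * complex_of_real (indicator (F -` {y}) x))"
    proof (cases "y = 0")
      case True
      then show ?thesis using approximable_zero by simp
    next
      case False
      have A: "F -` {y} \<in> sets borel" using measurable_sets_borel[OF meas, of "{y}"] by simp
      \<comment> \<open>Chebyshev's inequality: a level set of a nonzero value has finite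
        measure.\<close>
      have "ennreal ((cmod y)\<^sup>2) * emeasure M (F -` {y}) = (\<integral>\<^sup>+x. ennreal ((cmod y)\<^sup>2) * indicator (F -` {y}) x \<partial>M)"
        using A by (simp add: nn_integral_cmult_indicator)
      also have "\<dots> \<le> sqn F" by (intro nn_integral_mono) (auto simp: indicator_def)
      finally have "ennreal ((cmod y)\<^sup>2) * emeasure M (F -` {y}) < \<infinity>" using fin by (rule le_less_trans)
      then have "emeasure M (F -` {y}) < \<infinity>" using False by (auto simp: ennreal_mult_less_top)
      then show ?thesis using A by (intro approximable_scale approximable_indicator)
    qed
  qed
  moreover have "(\<Sum>y\<in>F ` UNIV. y * complex_of_real (indicator (F -` {y}) x)) = F x" for x
  proof -
    have "(\<Sum>y\<in>F ` UNIV. y * complex_of_real (indicator (F -` {y}) x)) = (\<Sum>y\<in>F ` UNIV. if y = F x then F x else 0)"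
      by (intro sum.cong) (auto simp: indicator_def)
    then show ?thesis using finF by simp
  qed
  ultimately show ?thesis by simp
qed

lemma approximable_L2:
  assumes f: "f \<in> borel_measurable borel" and fin: "sqn f < \<infinity>"
  shows "approximable f"
proof -
  have "f \<in> borel_measurable M" using f by simp
  from borel_measurable_implies_sequence_metric[OF this, of 0]
  obtain F where F: "\<And>i. simple_function M (F i)" "\<And>x. (\<lambda>i. F i x) \<longlonglongrightarrow> f x"
    "\<And>i x. dist (F i x) 0 \<le> 2 * dist (f x) 0" by auto
  note f [measurable]
  have Ff: "cmod (F i x) \<le> 2 * cmod (f x)" for i x using F(3)[of i x] by simp
  have w: "(\<integral>\<^sup>+x. ennreal ((2 * cmod (f x))\<^sup>2) \<partial>M) < \<infinity>"
    using fin by (simp add: power_mult_distrib ennreal_mult nn_integral_cmult ennreal_mult_less_top)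
  show ?thesis
  proof (rule approximable_dominated[where g = F and w = "\<lambda>x. 2 * cmod (f x)"])
    fix n
    have "sqn (F n) \<le> (\<integral>\<^sup>+x. ennreal ((2 * cmod (f x))\<^sup>2) \<partial>M)"
      using Ff by (intro nn_integral_mono ennreal_leI power_mono) auto
    then show "approximable (F n)" using F(1) w by (intro approximable_simple) (auto intro: le_less_trans)
  qed (use F(2) Ff w f in auto)
qed

section \<open>Existence and uniqueness of the resolvent kernel\<close>

lemma L2_fun_iff: "L2_fun M f \<longleftrightarrow> f \<in> borel_measurable borel \<and> sqn f < \<infinity>"
  unfolding L2_fun_def integrable_iff_bounded by auto

section \<open>The kernel as a bounded operator on L2\<close>

definition G_abs :: "real \<Rightarrow> ('p padic \<Rightarrow> complex) \<Rightarrow> 'p padic \<Rightarrow> ennreal" where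
  "G_abs l f x = (\<integral>\<^sup>+y. G l x y * ennreal (cmod (f y)) \<partial>M)"

lemma G_abs_measurable:
  assumes "0 \<le> l" and f [measurable]: "f \<in> borel_measurable borel"
  shows "G_abs l f \<in> borel_measurable borel"
proof -
  have [measurable]: "(\<lambda>(x, y). G l x y) \<in> borel_measurable (borel \<Otimes>\<^sub>M borel)"
    using G_measurable2[OF assms(1)] .
  have "(\<lambda>x. \<integral>\<^sup>+y. G l x y * ennreal (cmod (f y)) \<partial>M) \<in> borel_measurable borel"
    by measurable
  then show ?thesis by (simp add: G_abs_def[abs_def])
qed

text \<open>Schur's test with the constant function: \<open>\<integral>G(x,y) d\<mu>(y) \<le> 1/l\<close> and \<open>G\<close> is symmetric.\<close>

lemma G_abs_schur:
  assumes l: "0 < l" and f [measurable]: "f \<in> borel_measurable borel"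
  shows "(\<integral>\<^sup>+x. (G_abs l f x)\<^sup>2 \<partial>M) \<le> ennreal (1 / l) * (ennreal (1 / l) * sqn f)"
proof -
  have G2 [measurable]: "(\<lambda>(x, y). G l x y) \<in> borel_measurable (borel \<Otimes>\<^sub>M borel)"
    using l by (intro G_measurable2) simp
  have G1 [measurable]: "G l x \<in> borel_measurable borel" for x
    using l by (intro G_measurable) simp
  have AE_G: "AE y in M. G l x y = ennreal (Gr l x y)" for x
  proof (rule AE_mp[OF AE_M_neq[of x]], rule AE_I2, rule impI)
    fix y :: "'p padic" assume "y \<noteq> x"
    then have "G l x y < \<infinity>" using G_finite[OF l, of x y] by metis
    then show "G l x y = ennreal (Gr l x y)" by (simp add: less_top)
  qed
  have point: "(G_abs l f x)\<^sup>2 \<le> ennreal (1 / l) * (\<integral>\<^sup>+y. G l x y * ennreal ((cmod (f y))\<^sup>2) \<partial>M)" for x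
  proof -
    let ?r = "\<lambda>y. sqrt (Gr l x y)"
    have "G_abs l f x = (\<integral>\<^sup>+y. ennreal (?r y) * ennreal (?r y * cmod (f y)) \<partial>M)"
      unfolding G_abs_def
    proof (rule nn_integral_cong_AE, rule AE_mp[OF AE_G[of x]], rule AE_I2, rule impI)
      fix y assume "G l x y = ennreal (Gr l x y)"
      then have "G l x y * ennreal (cmod (f y)) = ennreal (Gr l x y) * ennreal (cmod (f y))" by (rule arg_cong)
      also have "\<dots> = ennreal (?r y) * ennreal (?r y * cmod (f y))"
        by (simp add: ennreal_mult[symmetric] mult.assoc[symmetric])
      finally show "G l x y * ennreal (cmod (f y)) = ennreal (?r y) * ennreal (?r y * cmod (f y))" .
    qed
    then have "(G_abs l f x)\<^sup>2 \<le> (\<integral>\<^sup>+y. (ennreal (?r y))\<^sup>2 \<partial>M) * (\<integral>\<^sup>+y. (ennreal (?r y * cmod (f y)))\<^sup>2 \<partial>M)"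
      by (simp only:) (rule Cauchy_Schwarz_nn_integral; measurable)
    also have "(\<integral>\<^sup>+y. (ennreal (?r y))\<^sup>2 \<partial>M) = (\<integral>\<^sup>+y. G l x y \<partial>M)"
    proof (rule nn_integral_cong_AE, rule AE_mp[OF AE_G[of x]], rule AE_I2, rule impI)
      fix y assume "G l x y = ennreal (Gr l x y)"
      moreover have "(ennreal (?r y))\<^sup>2 = ennreal (Gr l x y)" by (simp add: ennreal_power)
      ultimately show "(ennreal (?r y))\<^sup>2 = G l x y" by (rule trans[OF _ sym, rotated])
    qed
    also have "(\<integral>\<^sup>+y. (ennreal (?r y * cmod (f y)))\<^sup>2 \<partial>M) = (\<integral>\<^sup>+y. G l x y * ennreal ((cmod (f y))\<^sup>2) \<partial>M)"
    proof (rule nn_integral_cong_AE, rule AE_mp[OF AE_G[of x]], rule AE_I2, rule impI)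
      fix y assume eq: "G l x y = ennreal (Gr l x y)"
      have "(ennreal (?r y * cmod (f y)))\<^sup>2 = ennreal (Gr l x y) * ennreal ((cmod (f y))\<^sup>2)"
        by (simp add: ennreal_power power_mult_distrib ennreal_mult)
      also have "\<dots> = G l x y * ennreal ((cmod (f y))\<^sup>2)" using eq by (rule arg_cong[OF sym])
      finally show "(ennreal (?r y * cmod (f y)))\<^sup>2 = G l x y * ennreal ((cmod (f y))\<^sup>2)" .
    qed
    also have "(\<integral>\<^sup>+y. G l x y \<partial>M) * (\<integral>\<^sup>+y. G l x y * ennreal ((cmod (f y))\<^sup>2) \<partial>M)
        \<le> ennreal (1 / l) * (\<integral>\<^sup>+y. G l x y * ennreal ((cmod (f y))\<^sup>2) \<partial>M)"
      by (intro mult_right_mono nn_integral_G_le[OF l]) simp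
    finally show ?thesis .
  qed
  have "(\<integral>\<^sup>+x. (G_abs l f x)\<^sup>2 \<partial>M)
      \<le> (\<integral>\<^sup>+x. ennreal (1 / l) * (\<integral>\<^sup>+y. G l x y * ennreal ((cmod (f y))\<^sup>2) \<partial>M) \<partial>M)"
    by (intro nn_integral_mono point)
  also have "\<dots> = ennreal (1 / l) * (\<integral>\<^sup>+x. (\<integral>\<^sup>+y. G l x y * ennreal ((cmod (f y))\<^sup>2) \<partial>M) \<partial>M)"
    by (rule nn_integral_cmult) measurable
  also have "(\<integral>\<^sup>+x. (\<integral>\<^sup>+y. G l x y * ennreal ((cmod (f y))\<^sup>2) \<partial>M) \<partial>M)
      = (\<integral>\<^sup>+y. (\<integral>\<^sup>+x. G l x y * ennreal ((cmod (f y))\<^sup>2) \<partial>M) \<partial>M)"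
    by (rule MM.Fubini'[symmetric]) measurable
  also have "\<dots> \<le> (\<integral>\<^sup>+y. ennreal (1 / l) * ennreal ((cmod (f y))\<^sup>2) \<partial>M)"
  proof (rule nn_integral_mono)
    fix y
    have "(\<integral>\<^sup>+x. G l x y * ennreal ((cmod (f y))\<^sup>2) \<partial>M) = (\<integral>\<^sup>+x. G l y x * ennreal ((cmod (f y))\<^sup>2) \<partial>M)"
      by (simp only: G_sym[of l _ y])
    also have "\<dots> = (\<integral>\<^sup>+x. G l y x \<partial>M) * ennreal ((cmod (f y))\<^sup>2)"
      by (rule nn_integral_multc) measurable
    also have "\<dots> \<le> ennreal (1 / l) * ennreal ((cmod (f y))\<^sup>2)"
      by (intro mult_right_mono nn_integral_G_le[OF l]) simp
    finally show "(\<integral>\<^sup>+x. G l x y * ennreal ((cmod (f y))\<^sup>2) \<partial>M) \<le> ennreal (1 / l) * ennreal ((cmod (f y))\<^sup>2)" .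
  qed
  also have "\<dots> = ennreal (1 / l) * sqn f"
    by (rule nn_integral_cmult) measurable
  finally show ?thesis by (simp add: mult_left_mono)
qed

lemma G_abs_finite_AE:
  assumes l: "0 < l" and f: "f \<in> borel_measurable borel" "sqn f < \<infinity>"
  shows "AE x in M. G_abs l f x < \<infinity>"
proof -
  have [measurable]: "G_abs l f \<in> borel_measurable borel" using l f(1) by (intro G_abs_measurable) auto
  have "(\<integral>\<^sup>+x. (G_abs l f x)\<^sup>2 \<partial>M) < \<infinity>"
    by (rule le_less_trans[OF G_abs_schur[OF l f(1)]]) (use f(2) in \<open>simp add: ennreal_mult_less_top\<close>)
  then have "AE x in M. (G_abs l f x)\<^sup>2 \<noteq> \<infinity>"
    by (intro nn_integral_PInf_AE) auto
  then show ?thesis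
    by (rule AE_mp) (auto intro!: AE_I2 simp: less_top power2_eq_square ennreal_mult_less_top)
qed

definition G_op :: "real \<Rightarrow> ('p padic \<Rightarrow> complex) \<Rightarrow> 'p padic \<Rightarrow> complex" where
  "G_op l f x = (\<integral>y. of_real (Gr l x y) * f y \<partial>M)"

lemma G_op_measurable:
  assumes "0 \<le> l" and f [measurable]: "f \<in> borel_measurable borel"
  shows "G_op l f \<in> borel_measurable borel"
proof -
  have [measurable]: "(\<lambda>(x, y). G l x y) \<in> borel_measurable (borel \<Otimes>\<^sub>M borel)"
    using G_measurable2[OF assms(1)] .
  have "(\<lambda>x. \<integral>y. of_real (Gr l x y) * f y \<partial>M) \<in> borel_measurable borel"
    by measurable
  then show ?thesis by (simp add: G_op_def[abs_def])
qed

lemma G_integrand_le: "ennreal (cmod (of_real (Gr l x y) * z)) \<le> G l x y * ennreal (cmod z)"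
  by (simp add: norm_mult ennreal_mult ennreal_enn2real_if)

lemma G_op_integrable:
  assumes "0 \<le> l" and f [measurable]: "f \<in> borel_measurable borel" and fin: "G_abs l f x < \<infinity>"
  shows "integrable M (\<lambda>y. of_real (Gr l x y) * f y)"
proof -
  have [measurable]: "G l x \<in> borel_measurable borel" using G_measurable[OF assms(1)] .
  have "(\<integral>\<^sup>+y. ennreal (cmod (of_real (Gr l x y) * f y)) \<partial>M) \<le> G_abs l f x"
    unfolding G_abs_def by (intro nn_integral_mono G_integrand_le)
  then have "(\<integral>\<^sup>+y. ennreal (cmod (of_real (Gr l x y) * f y)) \<partial>M) < \<infinity>"
    using fin by (rule le_less_trans)
  then show ?thesis unfolding integrable_iff_bounded by simp
qed

lemma G_op_diff_le:
  assumes "0 \<le> l" and f: "f \<in> borel_measurable borel" "integrable M (\<lambda>y. of_real (Gr l x y) * f y)"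
    and g: "g \<in> borel_measurable borel" "integrable M (\<lambda>y. of_real (Gr l x y) * g y)"
  shows "ennreal (cmod (G_op l f x - G_op l g x)) \<le> G_abs l (\<lambda>y. f y - g y) x"
proof -
  have eq: "G_op l f x - G_op l g x = (\<integral>y. of_real (Gr l x y) * (f y - g y) \<partial>M)"
    unfolding G_op_def right_diff_distrib by (rule Bochner_Integration.integral_diff[OF f(2) g(2), symmetric])
  have "integrable M (\<lambda>y. of_real (Gr l x y) * (f y - g y))"
    unfolding right_diff_distrib by (rule Bochner_Integration.integrable_diff[OF f(2) g(2)])
  then have "ennreal (cmod (G_op l f x - G_op l g x)) \<le> (\<integral>\<^sup>+y. ennreal (cmod (of_real (Gr l x y) * (f y - g y))) \<partial>M)"
    unfolding eq by (rule integral_norm_bound_ennreal)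
  also have "\<dots> \<le> G_abs l (\<lambda>y. f y - g y) x"
    unfolding G_abs_def by (intro nn_integral_mono G_integrand_le)
  finally show ?thesis .
qed

text \<open>Linearity of \<open>G_op\<close> needs both integrals to exist. For \<open>f\<close>
  this holds almost everywhere by \<open>G_abs_finite_AE\<close>; for \<open>g\<close>, later an
  element of the span, it holds everywhere.\<close>

lemma sqn_G_op_diff_le:
  assumes l: "0 < l" and f: "f \<in> borel_measurable borel" "sqn f < \<infinity>"
    and g: "g \<in> borel_measurable borel" "\<And>x. integrable M (\<lambda>y. of_real (Gr l x y) * g y)"
  shows "sqn (\<lambda>x. G_op l g x - G_op l f x) \<le> ennreal (1 / l) * (ennreal (1 / l) * sqn (\<lambda>x. g x - f x))"
proof -
  have "sqn (\<lambda>x. G_op l g x - G_op l f x) \<le> (\<integral>\<^sup>+x. (G_abs l (\<lambda>y. g y - f y) x)\<^sup>2 \<partial>M)"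
  proof (rule nn_integral_mono_AE, rule AE_mp[OF G_abs_finite_AE[OF l f]], rule AE_I2, rule impI)
    fix x assume "G_abs l f x < \<infinity>"
    then have "ennreal (cmod (G_op l g x - G_op l f x)) \<le> G_abs l (\<lambda>y. g y - f y) x"
      using l by (intro G_op_diff_le g f(1) G_op_integrable) auto
    then have "(ennreal (cmod (G_op l g x - G_op l f x)))\<^sup>2 \<le> (G_abs l (\<lambda>y. g y - f y) x)\<^sup>2"
      by (rule power_mono) simp
    then show "ennreal ((cmod (G_op l g x - G_op l f x))\<^sup>2) \<le> (G_abs l (\<lambda>y. g y - f y) x)\<^sup>2"
      by (simp add: ennreal_power)
  qed
  also have "\<dots> \<le> ennreal (1 / l) * (ennreal (1 / l) * sqn (\<lambda>x. g x - f x))"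
    using f(1) g(1) by (intro G_abs_schur l) auto
  finally show ?thesis .
qed

lemma sqn_minus_commute: "sqn (\<lambda>x. f x - g x) = sqn (\<lambda>x. g x - f x)"
  by (simp add: norm_minus_commute)

lemma G_op_L2:
  assumes l: "0 < l" and f: "f \<in> borel_measurable borel" "sqn f < \<infinity>"
  shows "sqn (G_op l f) < \<infinity>"
proof -
  have "sqn (G_op l f) = sqn (\<lambda>x. G_op l (\<lambda>_. 0) x - G_op l f x)"
    by (simp add: G_op_def)
  also have "\<dots> \<le> ennreal (1 / l) * (ennreal (1 / l) * sqn (\<lambda>x. 0 - f x))"
    by (rule sqn_G_op_diff_le[OF l f]) auto
  also have "\<dots> < \<infinity>" using f(2) by (simp add: ennreal_mult_less_top)
  finally show ?thesis .
qed

text \<open>Approximants of \<open>f\<close> from the span are mapped by \<open>G_op\<close> to test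
  functions. The Schur bound makes both these and their images under \<open>Lop\<close> converge in
  L2, which is membership in the closed graph.\<close>

lemma calL_closure_G_op:
  assumes l: "0 < l" and f: "f \<in> borel_measurable borel" "sqn f < \<infinity>"
  shows "Lclos (G_op l f) (\<lambda>x. f x - of_real l * G_op l f x)"
proof -
  note f(1) [measurable]
  have R [measurable]: "G_op l f \<in> borel_measurable borel" using l f(1) by (intro G_op_measurable) auto
  have Rfin: "sqn (G_op l f) < \<infinity>" by (rule G_op_L2[OF l f])
  have "sqn (\<lambda>x. f x + (- of_real l) * G_op l f x) \<le> 2 * sqn f + 2 * sqn (\<lambda>x. (- of_real l) * G_op l f x)"
    by (rule sqn_add_le) measurable
  also have "sqn (\<lambda>x. (- of_real l) * G_op l f x) = ennreal ((cmod (- of_real l))\<^sup>2) * sqn (G_op l f)"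
    by (rule sqn_scale[OF R])
  also have "2 * sqn f + 2 * (ennreal ((cmod (- of_real l))\<^sup>2) * sqn (G_op l f)) < \<infinity>"
    using f(2) Rfin by (simp add: ennreal_mult_less_top)
  finally have vfin: "sqn (\<lambda>x. f x - of_real l * G_op l f x) < \<infinity>" by simp
  have "\<forall>n. \<exists>\<psi>. span_eig \<psi> \<and> sqn (\<lambda>x. f x - \<psi> x) < ennreal (1 / real (Suc n))"
    using approximable_L2[OF f] unfolding approximable_def by simp
  then obtain \<psi> where \<psi>: "\<And>n. span_eig (\<psi> n)" "\<And>n. sqn (\<lambda>x. f x - \<psi> n x) < ennreal (1 / real (Suc n))"
    by metis
  have [measurable]: "\<psi> n \<in> borel_measurable borel" for n by (rule span_eig_measurable[OF \<psi>(1)])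
  have int: "integrable M (\<lambda>y. of_real (Gr l x y) * \<psi> n y)" for n x
    using span_eig_resolvent[OF \<psi>(1)[of n] l] by blast
  have G_op_span: "span_eig (G_op l (\<psi> n))"
    and G_op_L: "Lop (G_op l (\<psi> n)) x = \<psi> n x - of_real l * G_op l (\<psi> n) x" for n x
  proof -
    obtain \<phi> where \<phi>: "span_eig \<phi>" "\<And>x. G_op l (\<psi> n) x = \<phi> x"
      "\<And>x. Lop \<phi> x = \<psi> n x - of_real l * \<phi> x"
      using span_eig_resolvent[OF \<psi>(1)[of n] l] unfolding G_op_def by blast
    have "G_op l (\<psi> n) = \<phi>" using \<phi>(2) by (rule ext)
    then show "span_eig (G_op l (\<psi> n))" "Lop (G_op l (\<psi> n)) x = \<psi> n x - of_real l * G_op l (\<psi> n) x"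
      using \<phi>(1,3) by simp_all
  qed
  have e0: "(\<lambda>n. ennreal (1 / real (Suc n))) \<longlonglongrightarrow> 0"
    using tendsto_ennrealI[OF LIMSEQ_inverse_real_of_nat] by (simp add: inverse_eq_divide)
  have \<psi>lim: "(\<lambda>n. sqn (\<lambda>x. \<psi> n x - f x)) \<longlonglongrightarrow> 0"
  proof (rule tendsto_sandwich[OF _ _ tendsto_const e0])
    show "\<forall>\<^sub>F n in sequentially. sqn (\<lambda>x. \<psi> n x - f x) \<le> ennreal (1 / real (Suc n))"
      using \<psi>(2) sqn_minus_commute[of f] by (intro always_eventually allI) (metis less_imp_le)
  qed simp
  have Rlim: "(\<lambda>n. sqn (\<lambda>x. G_op l (\<psi> n) x - G_op l f x)) \<longlonglongrightarrow> 0"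
  proof (rule tendsto_sandwich[OF _ _ tendsto_const])
    show "\<forall>\<^sub>F n in sequentially. sqn (\<lambda>x. G_op l (\<psi> n) x - G_op l f x)
        \<le> ennreal (1 / l) * (ennreal (1 / l) * sqn (\<lambda>x. \<psi> n x - f x))"
      by (intro always_eventually allI sqn_G_op_diff_le[OF l f] int) measurable
    have "(\<lambda>n. ennreal (1 / l) * (ennreal (1 / l) * sqn (\<lambda>x. \<psi> n x - f x))) \<longlonglongrightarrow> ennreal (1 / l) * (ennreal (1 / l) * 0)"
      by (intro ennreal_tendsto_cmult \<psi>lim) auto
    then show "(\<lambda>n. ennreal (1 / l) * (ennreal (1 / l) * sqn (\<lambda>x. \<psi> n x - f x))) \<longlonglongrightarrow> 0" by simp
  qed simp
  have Llim: "(\<lambda>n. sqn (\<lambda>x. Lop (G_op l (\<psi> n)) x - (f x - of_real l * G_op l f x))) \<longlonglongrightarrow> 0"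
  proof (rule tendsto_sandwich[OF _ _ tendsto_const])
    let ?c = "ennreal ((cmod (- of_real l))\<^sup>2)"
    show "\<forall>\<^sub>F n in sequentially. sqn (\<lambda>x. Lop (G_op l (\<psi> n)) x - (f x - of_real l * G_op l f x))
        \<le> 2 * sqn (\<lambda>x. \<psi> n x - f x) + 2 * (?c * sqn (\<lambda>x. G_op l (\<psi> n) x - G_op l f x))"
    proof (intro always_eventually allI)
      fix n
      have [measurable]: "G_op l (\<psi> n) \<in> borel_measurable borel" by (rule span_eig_measurable[OF G_op_span])
      have "sqn (\<lambda>x. Lop (G_op l (\<psi> n)) x - (f x - of_real l * G_op l f x))
          = sqn (\<lambda>x. (\<psi> n x - f x) + (- of_real l) * (G_op l (\<psi> n) x - G_op l f x))"
        unfolding G_op_L by (simp add: algebra_simps)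
      also have "\<dots> \<le> 2 * sqn (\<lambda>x. \<psi> n x - f x) + 2 * sqn (\<lambda>x. (- of_real l) * (G_op l (\<psi> n) x - G_op l f x))"
        by (rule sqn_add_le) measurable
      also have "sqn (\<lambda>x. (- of_real l) * (G_op l (\<psi> n) x - G_op l f x)) = ?c * sqn (\<lambda>x. G_op l (\<psi> n) x - G_op l f x)"
        by (rule sqn_scale) measurable
      finally show "sqn (\<lambda>x. Lop (G_op l (\<psi> n)) x - (f x - of_real l * G_op l f x))
        \<le> 2 * sqn (\<lambda>x. \<psi> n x - f x) + 2 * (?c * sqn (\<lambda>x. G_op l (\<psi> n) x - G_op l f x))" .
    qed
    have "(\<lambda>n. 2 * sqn (\<lambda>x. \<psi> n x - f x) + 2 * (?c * sqn (\<lambda>x. G_op l (\<psi> n) x - G_op l f x))) \<longlonglongrightarrow> 2 * 0 + 2 * (?c * 0)"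
      by (intro tendsto_add ennreal_tendsto_cmult \<psi>lim Rlim) auto
    then show "(\<lambda>n. 2 * sqn (\<lambda>x. \<psi> n x - f x) + 2 * (?c * sqn (\<lambda>x. G_op l (\<psi> n) x - G_op l f x))) \<longlonglongrightarrow> 0" by simp
  qed simp
  have test: "test_function (G_op l (\<psi> n))" for n
    using span_eig_ball_const[OF G_op_span[of n]] ball_const_test_function by blast
  show ?thesis
    unfolding calL_closure_def L2_fun_iff L2_lim_def
    using R Rfin vfin test Rlim Llim by (intro conjI exI[of _ "\<lambda>n. G_op l (\<psi> n)"]) auto
qed

lemma is_resolvent_kernel_G:
  assumes l: "0 < l" shows "is_resolvent_kernel m \<alpha> \<beta> l (G l)"
  unfolding is_resolvent_kernel_def Let_def
proof (intro conjI allI impI)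
  show "continuous_on UNIV (\<lambda>(x, y). G l x y)" using l by (intro continuous_G) simp
  show "G l x y < \<infinity>" if "x \<noteq> y" for x y using G_finite[OF l that] .
  fix f assume "L2_fun M f"
  then have f: "f \<in> borel_measurable borel" "sqn f < \<infinity>" by (simp_all add: L2_fun_iff)
  show "AE x in M. (\<integral>\<^sup>+y. G l x y * ennreal (cmod (f y)) \<partial>M) < \<infinity>"
    using G_abs_finite_AE[OF l f] by (simp add: G_abs_def)
  show "Lclos (\<lambda>x. \<integral>y. of_real (Gr l x y) * f y \<partial>M)
     (\<lambda>x. f x - of_real l * (\<integral>y. of_real (Gr l x y) * f y \<partial>M))"
    using calL_closure_G_op[OF l f] by (simp add: G_op_def[abs_def])
qed

subsection \<open>Uniqueness\<close>

lemma integrable_L2_eig: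
  assumes f [measurable]: "f \<in> borel_measurable borel" and fin: "sqn f < \<infinity>"
  shows "integrable M (\<lambda>x. f x * eigc a n x)"
proof -
  obtain R where R: "ball_supp R (eigc a n)" by (rule ball_supp_eig)
  obtain B where B: "0 \<le> B" "\<And>x. cmod (eigc a n x) \<le> B" using ball_const_ball_supp_bounded[OF ball_const_eig R] by blast
  have [measurable]: "eigc a n \<in> borel_measurable borel" by (rule ball_const_measurable[OF ball_const_eig])
  have int1: "integrable M (\<lambda>x. (cmod (f x))\<^sup>2)" using fin unfolding integrable_iff_bounded by simp
  have "integrable M (\<lambda>x. B * ((cmod (f x))\<^sup>2 + indicator (pball 0 R) x))"
    using int1 indicator_pball_integrable by (intro integrable_mult_right Bochner_Integration.integrable_add) auto
  then show ?thesis
  proof (rule Bochner_Integration.integrable_bound)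
    show "AE x in M. norm (f x * eigc a n x) \<le> norm (B * ((cmod (f x))\<^sup>2 + indicator (pball 0 R) x))"
    proof (rule AE_I2)
      fix x
      \<comment> \<open>This elementary inequality supplies an integrable majorant on the supporting
        ball.\<close>
      have sq: "cmod (f x) \<le> (cmod (f x))\<^sup>2 + 1"
      proof -
        have "2 * cmod (f x) \<le> (cmod (f x))\<^sup>2 + 1"
          using zero_le_power2[of "cmod (f x) - 1"] by (simp add: power2_eq_square algebra_simps)
        then show ?thesis using norm_ge_zero[of "f x"] by linarith
      qed
      have "cmod (f x) * cmod (eigc a n x) \<le> B * ((cmod (f x))\<^sup>2 + indicator (pball 0 R) x)"
      proof (cases "x \<in> pball 0 R")
        case True
        have "cmod (f x) * cmod (eigc a n x) \<le> ((cmod (f x))\<^sup>2 + 1) * B"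
          using sq B(2)[of x] by (intro mult_mono) auto
        then show ?thesis using True by (simp add: mult.commute)
      next
        case False
        then have "eigc a n x = 0" using R unfolding ball_supp_def by blast
        then have "cmod (f x) * cmod (eigc a n x) = 0" by (simp only: norm_zero mult_zero_right)
        moreover have "0 \<le> B * ((cmod (f x))\<^sup>2 + indicator (pball 0 R) x)" using B(1) by simp
        ultimately show ?thesis by linarith
      qed
      then show "norm (f x * eigc a n x) \<le> norm (B * ((cmod (f x))\<^sup>2 + indicator (pball 0 R) x))"
        using B(1) by (simp only: norm_mult real_norm_def abs_mult) (simp add: abs_of_nonneg)
    qed
  qed measurable
qed

lemma sqn_eig_finite: "sqn (eigc a n) < \<infinity>"
proof -
  obtain R where R: "ball_supp R (eigc a n)" by (rule ball_supp_eig)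
  have "integrable M (\<lambda>x. eigc a n x * eigc a n x)"
    by (intro ball_const_ball_supp_integrable[of n _ R] ball_const_mult ball_const_eig ball_supp_mult R)
  then show ?thesis unfolding integrable_iff_bounded by (simp add: norm_mult power2_eq_square)
qed

lemma L2_lim_eig:
  assumes f: "\<And>k. f k \<in> borel_measurable borel" "\<And>k. integrable M (\<lambda>x. f k x * eigc a n x)"
    and u: "u \<in> borel_measurable borel" "integrable M (\<lambda>x. u x * eigc a n x)"
    and lim: "L2_lim M f u"
  shows "(\<lambda>k. \<integral>x. f k x * eigc a n x \<partial>M) \<longlonglongrightarrow> (\<integral>x. u x * eigc a n x \<partial>M)"
proof -
  let ?d = "\<lambda>k. (\<integral>x. f k x * eigc a n x \<partial>M) - (\<integral>x. u x * eigc a n x \<partial>M)"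
  note f(1) [measurable] u(1) [measurable]
  have [measurable]: "eigc a n \<in> borel_measurable borel" by (rule ball_const_measurable[OF ball_const_eig])
  have bound: "ennreal ((cmod (?d k))\<^sup>2) \<le> sqn (eigc a n) * sqn (\<lambda>x. f k x - u x)" for k
  proof -
    have eq: "?d k = (\<integral>x. (f k x - u x) * eigc a n x \<partial>M)"
      unfolding left_diff_distrib by (rule Bochner_Integration.integral_diff[OF f(2) u(2), symmetric])
    have "integrable M (\<lambda>x. (f k x - u x) * eigc a n x)"
      unfolding left_diff_distrib by (rule Bochner_Integration.integrable_diff[OF f(2) u(2)])
    then have "ennreal (cmod (?d k)) \<le> (\<integral>\<^sup>+x. ennreal (cmod ((f k x - u x) * eigc a n x)) \<partial>M)"
      unfolding eq by (rule integral_norm_bound_ennreal)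
    also have "\<dots> = (\<integral>\<^sup>+x. ennreal (cmod (f k x - u x)) * ennreal (cmod (eigc a n x)) \<partial>M)"
      by (intro nn_integral_cong) (simp add: norm_mult ennreal_mult)
    finally have "(ennreal (cmod (?d k)))\<^sup>2 \<le> (\<integral>\<^sup>+x. ennreal (cmod (f k x - u x)) * ennreal (cmod (eigc a n x)) \<partial>M)\<^sup>2"
      by (rule power_mono) simp
    also have "\<dots> \<le> (\<integral>\<^sup>+x. (ennreal (cmod (f k x - u x)))\<^sup>2 \<partial>M) * (\<integral>\<^sup>+x. (ennreal (cmod (eigc a n x)))\<^sup>2 \<partial>M)"
      by (rule Cauchy_Schwarz_nn_integral; measurable)
    finally show ?thesis by (simp add: ennreal_power mult.commute)
  qed
  have "(\<lambda>k. ennreal ((cmod (?d k))\<^sup>2)) \<longlonglongrightarrow> 0"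
  proof (rule tendsto_sandwich[OF _ _ tendsto_const])
    have "(\<lambda>k. sqn (eigc a n) * sqn (\<lambda>x. f k x - u x)) \<longlonglongrightarrow> sqn (eigc a n) * 0"
      using lim sqn_eig_finite[of a n] unfolding L2_lim_def by (intro ennreal_tendsto_cmult) auto
    then show "(\<lambda>k. sqn (eigc a n) * sqn (\<lambda>x. f k x - u x)) \<longlonglongrightarrow> 0" by simp
  qed (use bound in auto)
  then have "(\<lambda>k. (cmod (?d k))\<^sup>2) \<longlonglongrightarrow> 0"
    by (subst (asm) ennreal_tendsto_0_iff) auto
  then have "(\<lambda>k. sqrt ((cmod (?d k))\<^sup>2)) \<longlonglongrightarrow> sqrt 0" by (rule tendsto_real_sqrt)
  then have "(\<lambda>k. cmod (?d k)) \<longlonglongrightarrow> 0" by simp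
  then have "?d \<longlonglongrightarrow> 0" by (rule tendsto_norm_zero_cancel)
  then show ?thesis by (rule LIM_zero_cancel)
qed

text \<open>Symmetry passes to the closure because pairing with a fixed eigenfunction is continuous
  in L2.\<close>

lemma calL_closure_eig:
  assumes "Lclos u v"
  shows "(\<integral>x. v x * eigc a n x \<partial>M) = of_real (lam a (n + 1)) * (\<integral>x. u x * eigc a n x \<partial>M)"
proof -
  have u: "u \<in> borel_measurable borel" "sqn u < \<infinity>" and v: "v \<in> borel_measurable borel" "sqn v < \<infinity>"
    using assms by (simp_all add: calL_closure_def L2_fun_iff)
  obtain \<phi> where \<phi>: "\<And>k. test_function (\<phi> k)" "L2_lim M \<phi> u" "L2_lim M (\<lambda>k. Lop (\<phi> k)) v"
    using assms unfolding calL_closure_def by blast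
  have \<phi>_meas: "\<phi> k \<in> borel_measurable borel" "Lop (\<phi> k) \<in> borel_measurable borel"
    and \<phi>_int: "integrable M (\<lambda>x. \<phi> k x * eigc a n x)" "integrable M (\<lambda>x. Lop (\<phi> k) x * eigc a n x)"
    and \<phi>_eq: "(\<integral>x. Lop (\<phi> k) x * eigc a n x \<partial>M) = of_real (lam a (n + 1)) * (\<integral>x. \<phi> k x * eigc a n x \<partial>M)" for k
  proof -
    obtain j R where jR: "ball_const j (\<phi> k)" "ball_supp R (\<phi> k)" using test_function_ball_const[OF \<phi>(1)] by blast
    show "\<phi> k \<in> borel_measurable borel" "Lop (\<phi> k) \<in> borel_measurable borel"
      using ball_const_measurable[OF jR(1)] ball_const_measurable[OF calL_op_is_ball_const[OF jR]] .
    show "integrable M (\<lambda>x. \<phi> k x * eigc a n x)"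
      by (rule ball_const_ball_supp_integrable[of "min j n" _ R])
         (auto intro!: ball_const_mult ball_supp_mult jR(2) ball_const_mono[OF jR(1)] ball_const_mono[OF ball_const_eig])
    show "integrable M (\<lambda>x. Lop (\<phi> k) x * eigc a n x)"
      "(\<integral>x. Lop (\<phi> k) x * eigc a n x \<partial>M) = of_real (lam a (n + 1)) * (\<integral>x. \<phi> k x * eigc a n x \<partial>M)"
      by (rule calL_op_symmetric_eig[OF jR])+
  qed
  have "(\<lambda>k. \<integral>x. Lop (\<phi> k) x * eigc a n x \<partial>M) \<longlonglongrightarrow> (\<integral>x. v x * eigc a n x \<partial>M)"
    by (intro L2_lim_eig \<phi>_meas \<phi>_int v(1) integrable_L2_eig[OF v] \<phi>(3))
  moreover have "(\<lambda>k. of_real (lam a (n + 1)) * (\<integral>x. \<phi> k x * eigc a n x \<partial>M)) \<longlonglongrightarrow> of_real (lam a (n + 1)) * (\<integral>x. u x * eigc a n x \<partial>M)"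
    by (intro tendsto_mult tendsto_const L2_lim_eig \<phi>_meas \<phi>_int u(1) integrable_L2_eig[OF u] \<phi>(2))
  ultimately show ?thesis unfolding \<phi>_eq by (rule LIMSEQ_unique)
qed

text \<open>Pairings here carry no complex conjugate, so the Hilbert space argument in
  \<open>orthogonal_imp_zero\<close> conjugates the approximant; the eigenfunctions being real, it
  stays in the span.\<close>

lemma span_eig_cnj: "span_eig f \<Longrightarrow> span_eig (\<lambda>x. cnj (f x))"
proof (induction rule: span_eig.induct)
  case zero
  then show ?case by (simp add: span_eig.zero)
next
  case (add f c a n)
  then have "span_eig (\<lambda>x. cnj (f x) + cnj c * eigc a n x)" by (intro span_eig.add)
  then show ?case by simp
qed

lemma orthogonal_span_eig:
  assumes w: "w \<in> borel_measurable borel" "sqn w < \<infinity>"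
    and orth: "\<And>a n. (\<integral>x. w x * eigc a n x \<partial>M) = 0" and "span_eig f"
  shows "integrable M (\<lambda>x. w x * f x) \<and> (\<integral>x. w x * f x \<partial>M) = 0"
  using assms(4)
proof induction
  case zero
  then show ?case by simp
next
  case (add f c a n)
  have eq: "w x * (f x + c * eigc a n x) = w x * f x + c * (w x * eigc a n x)" for x
    by (simp add: algebra_simps)
  have int: "integrable M (\<lambda>x. c * (w x * eigc a n x))"
    using integrable_L2_eig[OF w] by (intro integrable_mult_right) auto
  show ?case
    unfolding eq using add.IH int orth[of a n]
    by (simp add: Bochner_Integration.integral_add[OF conjunct1[OF add.IH] int])
qed

text \<open>For \<open>w\<close> orthogonal to the span, 0 is its best approximation there; since
  other elements of the span come arbitrarily close, \<open>w\<close> has norm 0.\<close>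

lemma orthogonal_imp_zero:
  assumes w: "w \<in> borel_measurable borel" "sqn w < \<infinity>"
    and orth: "\<And>a n. (\<integral>x. w x * eigc a n x \<partial>M) = 0"
  shows "AE x in M. w x = 0"
proof -
  note w(1) [measurable]
  have le: "sqn w \<le> sqn (\<lambda>x. w x - \<psi> x)" if \<psi>: "span_eig \<psi>" for \<psi>
  proof -
    have [measurable]: "\<psi> \<in> borel_measurable borel" by (rule span_eig_measurable[OF \<psi>])
    have o: "integrable M (\<lambda>x. w x * cnj (\<psi> x))" "(\<integral>x. w x * cnj (\<psi> x) \<partial>M) = 0"
      using orthogonal_span_eig[OF w orth span_eig_cnj[OF \<psi>]] by auto
    have iw: "integrable M (\<lambda>x. (cmod (w x))\<^sup>2)" using w(2) unfolding integrable_iff_bounded by simp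
    define r where "r = (\<lambda>x. Re (w x * cnj (\<psi> x)))"
    have re: "integrable M r" unfolding r_def using o(1) by (rule integrable_Re)
    have re0: "(\<integral>x. r x \<partial>M) = 0"
      unfolding r_def using integral_Re[OF o(1)] o(2) by simp
    \<comment> \<open>The expanded square without the term |\<psi>|^2; after integration the mixed
      term \<open>r\<close> vanishes by orthogonality.\<close>
    have pt: "(cmod (w x))\<^sup>2 - 2 * r x \<le> (cmod (w x - \<psi> x))\<^sup>2" for x
      unfolding cmod_power2 r_def by (simp add: power2_eq_square algebra_simps)
    show ?thesis
    proof (cases "sqn (\<lambda>x. w x - \<psi> x) < \<infinity>")
      case True
      then have id: "integrable M (\<lambda>x. (cmod (w x - \<psi> x))\<^sup>2)" unfolding integrable_iff_bounded by simp
      have "(\<integral>x. (cmod (w x))\<^sup>2 \<partial>M) = (\<integral>x. (cmod (w x))\<^sup>2 - 2 * r x \<partial>M)"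
        using iw re re0 by (subst Bochner_Integration.integral_diff) auto
      also have "\<dots> \<le> (\<integral>x. (cmod (w x - \<psi> x))\<^sup>2 \<partial>M)"
        using iw re id pt by (intro integral_mono Bochner_Integration.integrable_diff integrable_mult_right) auto
      finally have "ennreal (\<integral>x. (cmod (w x))\<^sup>2 \<partial>M) \<le> ennreal (\<integral>x. (cmod (w x - \<psi> x))\<^sup>2 \<partial>M)" by (rule ennreal_leI)
      moreover have "sqn w = ennreal (\<integral>x. (cmod (w x))\<^sup>2 \<partial>M)" by (rule nn_integral_eq_integral[OF iw]) simp
      moreover have "sqn (\<lambda>x. w x - \<psi> x) = ennreal (\<integral>x. (cmod (w x - \<psi> x))\<^sup>2 \<partial>M)"
        by (rule nn_integral_eq_integral[OF id]) simp
      ultimately show ?thesis by simp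
    qed (simp add: not_less top_unique)
  qed
  have "sqn w \<le> 0 + ennreal e" if e: "0 < e" for e
  proof -
    obtain \<psi> where "span_eig \<psi>" "sqn (\<lambda>x. w x - \<psi> x) < ennreal e"
      using approximable_L2[OF w] e unfolding approximable_def by blast
    then have "sqn w < ennreal e" using le by (blast intro: le_less_trans)
    then show ?thesis by simp
  qed
  then have "sqn w \<le> 0" by (rule ennreal_le_epsilon)
  then have "sqn w = 0" by simp
  then have "AE x in M. ennreal ((cmod (w x))\<^sup>2) = 0" by (subst (asm) nn_integral_0_iff_AE) auto
  then show ?thesis by (rule AE_mp) (rule AE_I2, simp)
qed

text \<open>Pairing the equation with an eigenfunction determines the coefficient of the solution,
  as lam + l is not 0; totality then determines the solution.\<close>

lemma calL_closure_resolvent_unique: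
  assumes l: "0 < l"
    and u1: "Lclos u1 (\<lambda>x. f x - of_real l * u1 x)"
    and u2: "Lclos u2 (\<lambda>x. f x - of_real l * u2 x)"
    and f: "f \<in> borel_measurable borel" "sqn f < \<infinity>"
  shows "AE x in M. u1 x = u2 x"
proof -
  have val: "of_real (lam a (n + 1) + l) * (\<integral>x. u x * eigc a n x \<partial>M) = (\<integral>x. f x * eigc a n x \<partial>M)"
    if "Lclos u (\<lambda>x. f x - of_real l * u x)" for u a n
  proof -
    have u: "u \<in> borel_measurable borel" "sqn u < \<infinity>" using that by (simp_all add: calL_closure_def L2_fun_iff)
    have iu: "integrable M (\<lambda>x. of_real l * (u x * eigc a n x))"
      using integrable_L2_eig[OF u] by (intro integrable_mult_right) auto
    have "(\<integral>x. (f x - of_real l * u x) * eigc a n x \<partial>M)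
        = (\<integral>x. f x * eigc a n x - of_real l * (u x * eigc a n x) \<partial>M)"
      by (simp add: algebra_simps)
    also have "\<dots> = (\<integral>x. f x * eigc a n x \<partial>M) - of_real l * (\<integral>x. u x * eigc a n x \<partial>M)"
      by (subst Bochner_Integration.integral_diff[OF integrable_L2_eig[OF f] iu]) simp
    finally show ?thesis using calL_closure_eig[OF that, of a n] by (simp add: algebra_simps)
  qed
  have m1: "u1 \<in> borel_measurable borel" "sqn u1 < \<infinity>" using u1 by (simp_all add: calL_closure_def L2_fun_iff)
  have m2: "u2 \<in> borel_measurable borel" "sqn u2 < \<infinity>" using u2 by (simp_all add: calL_closure_def L2_fun_iff)
  note m1(1) [measurable] m2(1) [measurable]
  have "AE x in M. u1 x - u2 x = 0"
  proof (rule orthogonal_imp_zero)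
    have "sqn (\<lambda>x. u1 x + (- 1) * u2 x) \<le> 2 * sqn u1 + 2 * sqn (\<lambda>x. (- 1) * u2 x)" by (rule sqn_add_le) measurable
    also have "\<dots> < \<infinity>" using m1(2) m2(2) by (simp add: ennreal_mult_less_top)
    finally show "sqn (\<lambda>x. u1 x - u2 x) < \<infinity>" by simp
    fix a n
    have "complex_of_real (lam a (n + 1) + l) \<noteq> 0"
      using lam_plus_pos[of l a "n + 1"] l unfolding of_real_eq_0_iff by linarith
    moreover have "complex_of_real (lam a (n + 1) + l) * (\<integral>x. u1 x * eigc a n x \<partial>M)
        = complex_of_real (lam a (n + 1) + l) * (\<integral>x. u2 x * eigc a n x \<partial>M)"
      using val[OF u1, of a n] val[OF u2, of a n] by (rule trans[OF _ sym])
    ultimately have "(\<integral>x. u1 x * eigc a n x \<partial>M) = (\<integral>x. u2 x * eigc a n x \<partial>M)"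
      unfolding mult_cancel_left by blast
    then show "(\<integral>x. (u1 x - u2 x) * eigc a n x \<partial>M) = 0"
      unfolding left_diff_distrib
      by (subst Bochner_Integration.integral_diff[OF integrable_L2_eig[OF m1] integrable_L2_eig[OF m2]]) simp
  qed measurable
  then show ?thesis by (rule AE_mp) (rule AE_I2, simp)
qed

section \<open>From equality of operators to equality of kernels\<close>

lemma continuous_kernel_measurable:
  fixes K :: "'p padic \<Rightarrow> 'p padic \<Rightarrow> ennreal"
  assumes "continuous_on UNIV (\<lambda>(x, y). K x y)" shows "K x \<in> borel_measurable borel"
proof -
  have "(\<lambda>(x, y). K x y) \<in> borel_measurable (borel \<Otimes>\<^sub>M borel)"
    unfolding borel_prod by (rule borel_measurable_continuous_onI[OF assms])
  from measurable_compose[OF measurable_Pair1' this, of x] show ?thesis by simp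
qed

text \<open>A strict inequality at one point persists on a product of two balls. Integrating over
  the second ball then separates the kernels for all points of the first, a set of positive
  measure.\<close>

lemma kernel_le_by_balls:
  fixes K1 K2 :: "'p padic \<Rightarrow> 'p padic \<Rightarrow> ennreal"
  assumes c1: "continuous_on UNIV (\<lambda>(x, y). K1 x y)" and c2: "continuous_on UNIV (\<lambda>(x, y). K2 x y)"
    and eq: "\<And>a n. AE x in M. (\<integral>\<^sup>+y. K1 x y * indicator (pball a n) y \<partial>M) = (\<integral>\<^sup>+y. K2 x y * indicator (pball a n) y \<partial>M)"
  shows "K1 x y \<le> K2 x y"
proof (rule ccontr)
  assume "\<not> K1 x y \<le> K2 x y"
  then have "K2 x y < K1 x y" by simp
  \<comment> \<open>Two separating constants \<open>c < d\<close> are inserted so that the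
    inequality stays strict after integration, even where \<open>K1\<close> is infinite.\<close>
  then obtain d where d: "K2 x y < d" "d < K1 x y" using dense by blast
  obtain c where c: "K2 x y < c" "c < d" using dense[OF d(1)] by blast
  have at: "(\<lambda>(x, y). K x y) \<midarrow>(x, y)\<rightarrow> K x y" if "continuous_on UNIV (\<lambda>(x, y). K x y)" for K :: "'p padic \<Rightarrow> 'p padic \<Rightarrow> ennreal"
    using that unfolding continuous_on_def by fastforce
  have nb: "((\<lambda>(x, y). K x y) \<longlongrightarrow> K x y) (nhds (x, y))" if "continuous_on UNIV (\<lambda>(x, y). K x y)" for K :: "'p padic \<Rightarrow> 'p padic \<Rightarrow> ennreal"
    using at[OF that] tendsto_at_iff_tendsto_nhds[of "\<lambda>(x, y). K x y" "(x, y)"] by simp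
  have "eventually (\<lambda>z. (\<lambda>(x, y). K2 x y) z < c \<and> d < (\<lambda>(x, y). K1 x y) z) (nhds (x, y))"
    using order_tendstoD(2)[OF nb[OF c2] c(1)] order_tendstoD(1)[OF nb[OF c1] d(2)] by (rule eventually_conj)
  then obtain Q R where QR: "eventually Q (nhds x)" "eventually R (nhds y)"
    "\<And>a b. Q a \<Longrightarrow> R b \<Longrightarrow> K2 a b < c \<and> d < K1 a b"
    unfolding nhds_prod eventually_prod_filter by auto
  obtain e1 where e1: "0 < e1" "\<And>a. dist a x < e1 \<Longrightarrow> Q a" using QR(1) unfolding eventually_nhds_metric by blast
  obtain e2 where e2: "0 < e2" "\<And>b. dist b y < e2 \<Longrightarrow> R b" using QR(2) unfolding eventually_nhds_metric by blast
  obtain i where i: "q i < e1" using q_below[OF e1(1)] by blast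
  obtain j where j: "q j < e2" using q_below[OF e2(1)] by blast
  have Q: "Q a" if "a \<in> pball x i" for a
    using that i e1(2)[of a] unfolding mem_pball by (simp add: dist_commute)
  have R: "R b" if "b \<in> pball y j" for b
    using that j e2(2)[of b] unfolding mem_pball by (simp add: dist_commute)
  have neq: "(\<integral>\<^sup>+b. K1 a b * indicator (pball y j) b \<partial>M) \<noteq> (\<integral>\<^sup>+b. K2 a b * indicator (pball y j) b \<partial>M)"
    if a: "a \<in> pball x i" for a
  proof -
    have "(\<integral>\<^sup>+b. K2 a b * indicator (pball y j) b \<partial>M) \<le> (\<integral>\<^sup>+b. c * indicator (pball y j) b \<partial>M)"
      using QR(3)[OF Q[OF a] R] by (intro nn_integral_mono) (auto simp: indicator_def intro: less_imp_le)
    also have "\<dots> = c * ennreal (mu y j)" by (simp add: nn_integral_cmult_indicator emeasure_M_pball)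
    also have "\<dots> < d * ennreal (mu y j)"
      using c(2) mu_pos[of y j] by (subst (1 2) mult.commute) (intro ennreal_mult_strict_left_mono, auto)
    also have "\<dots> = (\<integral>\<^sup>+b. d * indicator (pball y j) b \<partial>M)" by (simp add: nn_integral_cmult_indicator emeasure_M_pball)
    also have "\<dots> \<le> (\<integral>\<^sup>+b. K1 a b * indicator (pball y j) b \<partial>M)"
      using QR(3)[OF Q[OF a] R] by (intro nn_integral_mono) (auto simp: indicator_def intro: less_imp_le)
    finally show ?thesis by simp
  qed
  have "AE a in M. a \<notin> pball x i"
    using eq[of y j] by (rule AE_mp) (rule AE_I2, use neq in blast)
  then have "emeasure M (pball x i) = 0"
    by (subst (asm) AE_iff_measurable[of "pball x i"]) auto
  then show False using mu_pos[of x i] unfolding emeasure_M_pball by simp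
qed

lemma is_resolvent_kernel_closure:
  assumes K: "is_resolvent_kernel m \<alpha> \<beta> l K" and f: "L2_fun M f"
  shows "Lclos (\<lambda>x. \<integral>y. of_real (enn2real (K x y)) * f y \<partial>M)
    (\<lambda>x. f x - of_real l * (\<integral>y. of_real (enn2real (K x y)) * f y \<partial>M))"
proof -
  have "\<forall>f. L2_fun M f \<longrightarrow>
      (AE x in M. (\<integral>\<^sup>+y. K x y * ennreal (cmod (f y)) \<partial>M) < \<infinity>) \<and>
      Lclos (\<lambda>x. \<integral>y. of_real (enn2real (K x y)) * f y \<partial>M)
        (\<lambda>x. f x - of_real l * (\<integral>y. of_real (enn2real (K x y)) * f y \<partial>M))"
    using K unfolding is_resolvent_kernel_def Let_def by (elim conjE)
  then show ?thesis using f by (elim allE[of _ f] impE conjE)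
qed

text \<open>Converts the Bochner integral in the definition of a resolvent kernel into the
  \<open>ennreal\<close> integral compared in \<open>kernel_le_by_balls\<close>; finiteness almost
  everywhere and the null diagonal justify it.\<close>

lemma resolvent_kernel_ball:
  assumes l: "0 < l" and K: "is_resolvent_kernel m \<alpha> \<beta> l K"
  shows "AE x in M. (\<integral>\<^sup>+y. K x y * indicator (pball a n) y \<partial>M)
    = ennreal (Re (\<integral>y. of_real (enn2real (K x y)) * of_real (indicator (pball a n) y) \<partial>M))"
proof -
  let ?f = "\<lambda>y. complex_of_real (indicator (pball a n) y)"
  have cont: "continuous_on UNIV (\<lambda>(x, y). K x y)" and fin: "\<And>x y. x \<noteq> y \<Longrightarrow> K x y < \<infinity>"
    using K unfolding is_resolvent_kernel_def by blast+
  have [measurable]: "K x \<in> borel_measurable borel" for x by (rule continuous_kernel_measurable[OF cont])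
  have sq: "ennreal ((cmod (?f y))\<^sup>2) = indicator (pball a n) y" "ennreal (cmod (?f y)) = indicator (pball a n) y" for y
    by (auto simp: indicator_def)
  have "L2_fun M ?f" unfolding L2_fun_iff sq by (simp add: emeasure_M_pball)
  then have "AE x in M. (\<integral>\<^sup>+y. K x y * indicator (pball a n) y \<partial>M) < \<infinity>"
    using K unfolding is_resolvent_kernel_def sq(2)[symmetric] by blast
  then show ?thesis
  proof (rule AE_mp, intro AE_I2 impI)
    fix x assume fin_x: "(\<integral>\<^sup>+y. K x y * indicator (pball a n) y \<partial>M) < \<infinity>"
    have "(\<integral>y. of_real (enn2real (K x y)) * ?f y \<partial>M) = of_real (\<integral>y. enn2real (K x y) * indicator (pball a n) y \<partial>M)"
      unfolding of_real_mult[symmetric] by (rule integral_complex_of_real)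
    then have "Re (\<integral>y. of_real (enn2real (K x y)) * ?f y \<partial>M) = (\<integral>y. enn2real (K x y) * indicator (pball a n) y \<partial>M)" by simp
    also have "\<dots> = enn2real (\<integral>\<^sup>+y. ennreal (enn2real (K x y) * indicator (pball a n) y) \<partial>M)"
      by (rule integral_eq_nn_integral) auto
    also have "(\<integral>\<^sup>+y. ennreal (enn2real (K x y) * indicator (pball a n) y) \<partial>M)
        = (\<integral>\<^sup>+y. K x y * indicator (pball a n) y \<partial>M)"
    proof (rule nn_integral_cong_AE, rule AE_mp[OF AE_M_neq[of x]], rule AE_I2, rule impI)
      fix y :: "'p padic" assume "y \<noteq> x"
      then have "K x y < \<infinity>" using fin[of x y] by metis
      then show "ennreal (enn2real (K x y) * indicator (pball a n) y) = K x y * indicator (pball a n) y"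
        by (simp add: indicator_def less_top)
    qed
    finally show "(\<integral>\<^sup>+y. K x y * indicator (pball a n) y \<partial>M)
        = ennreal (Re (\<integral>y. of_real (enn2real (K x y)) * ?f y \<partial>M))"
      using fin_x by (simp add: less_top)
  qed
qed

lemma resolvent_kernel_unique:
  assumes l: "0 < l" and K: "is_resolvent_kernel m \<alpha> \<beta> l K"
  shows "K = G l"
proof -
  have G: "is_resolvent_kernel m \<alpha> \<beta> l (G l)" by (rule is_resolvent_kernel_G[OF l])
  have cK: "continuous_on UNIV (\<lambda>(x, y). K x y)" using K unfolding is_resolvent_kernel_def by blast
  have cG: "continuous_on UNIV (\<lambda>(x, y). G l x y)" using G unfolding is_resolvent_kernel_def by blast
  have eq: "AE x in M. (\<integral>\<^sup>+y. K x y * indicator (pball a n) y \<partial>M) = (\<integral>\<^sup>+y. G l x y * indicator (pball a n) y \<partial>M)" for a n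
  proof -
    let ?f = "\<lambda>y. complex_of_real (indicator (pball a n) y)"
    let ?u = "\<lambda>K x. \<integral>y. of_real (enn2real (K x y)) * ?f y \<partial>M"
    have "ennreal ((cmod (?f y))\<^sup>2) = indicator (pball a n) y" for y by (auto simp: indicator_def)
    then have f: "?f \<in> borel_measurable borel" "sqn ?f < \<infinity>" by (simp_all add: emeasure_M_pball)
    then have L2: "L2_fun M ?f" by (simp only: L2_fun_iff)
    have "Lclos (?u K) (\<lambda>x. ?f x - of_real l * ?u K x)"
      "Lclos (?u (G l)) (\<lambda>x. ?f x - of_real l * ?u (G l) x)"
      by (rule is_resolvent_kernel_closure[OF K L2] is_resolvent_kernel_closure[OF G L2])+
    then have "AE x in M. ?u K x = ?u (G l) x" using f by (rule calL_closure_resolvent_unique[OF l])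
    then show ?thesis
      using resolvent_kernel_ball[OF l K, of a n] resolvent_kernel_ball[OF l G, of a n]
      by eventually_elim simp
  qed
  have eq': "AE x in M. (\<integral>\<^sup>+y. G l x y * indicator (pball a n) y \<partial>M) = (\<integral>\<^sup>+y. K x y * indicator (pball a n) y \<partial>M)" for a n
    using eq[of a n] by eventually_elim simp
  show "K = G l"
    by (intro ext antisym kernel_le_by_balls[OF cK cG eq] kernel_le_by_balls[OF cG cK eq'])
qed

lemma resolvent_kernel_eq: "0 < l \<Longrightarrow> resolvent_kernel m \<alpha> \<beta> l = G l"
  unfolding resolvent_kernel_def
  by (rule the_equality) (auto intro: is_resolvent_kernel_G resolvent_kernel_unique)

section \<open>The Green function\<close>

lemma lam_nz: "lam x k \<noteq> 0" using lam_pos[of x k] by linarith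

text \<open>Along a sequence decreasing to 0 every coefficient increases, so monotone convergence
  applies to the series, whether or not its limit is finite.\<close>

lemma G_tendsto: "((\<lambda>l. G l x y) \<longlongrightarrow> G 0 x y) (at_right 0)"
proof (rule tendsto_at_right_sequentially[of 0 1])
  fix S :: "nat \<Rightarrow> real"
  assume S: "\<And>n. 0 < S n" "decseq S" "S \<longlonglongrightarrow> 0"
  show "(\<lambda>n. G (S n) x y) \<longlonglongrightarrow> G 0 x y"
    unfolding G_def
  proof (rule nn_integral_LIMSEQ)
    show "incseq (\<lambda>n k. ennreal (G_coeff (S n) x k) * indicator (pball x k) y)"
      unfolding incseq_def le_fun_def
    proof (intro allI impI)
      fix i j k assume "i \<le> (j :: nat)"
      then have "S j \<le> S i" using S(2) by (simp add: decseqD)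
      then show "ennreal (G_coeff (S i) x k) * indicator (pball x k) y \<le> ennreal (G_coeff (S j) x k) * indicator (pball x k) y"
        using S(1)[of j] by (intro mult_right_mono ennreal_leI G_coeff_antimono) auto
    qed
    fix k
    have "(\<lambda>n. G_coeff (S n) x k) \<longlonglongrightarrow> G_coeff 0 x k"
      unfolding G_coeff_def using lam_nz[of x k] lam_nz[of x "k + 1"]
      by (intro tendsto_intros S(3)) simp
    then have "(\<lambda>n. ennreal (G_coeff (S n) x k)) \<longlonglongrightarrow> ennreal (G_coeff 0 x k)" by (rule tendsto_ennrealI)
    then show "(\<lambda>n. ennreal (G_coeff (S n) x k) * indicator (pball x k) y) \<longlonglongrightarrow> ennreal (G_coeff 0 x k) * indicator (pball x k) y"
      by (cases "y \<in> pball x k") auto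
  qed simp
qed simp

lemma green_calL_eq: "green_calL m \<alpha> \<beta> x y = G 0 x y"
  unfolding green_calL_def
proof (rule tendsto_Lim)
  show "((\<lambda>l. resolvent_kernel m \<alpha> \<beta> l x y) \<longlongrightarrow> G 0 x y) (at_right 0)"
  proof (rule tendsto_cong[THEN iffD2, OF _ G_tendsto])
    have "eventually (\<lambda>l. l \<in> {0<..<1::real}) (at_right 0)"
      by (rule eventually_at_right_real) simp
    then show "eventually (\<lambda>l. resolvent_kernel m \<alpha> \<beta> l x y = G l x y) (at_right 0)"
      by (rule eventually_mono) (simp add: resolvent_kernel_eq)
  qed
qed (rule trivial_limit_at_right_real)

section \<open>Two-sided bounds for the kernel at l = 0\<close>

lemma G_tail_0_ge: "ennreal (cU * U x n) \<le> G_tail 0 x n"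
proof -
  have "ennreal (cU * U x n) \<le> ennreal (G_coeff 0 x n)" by (intro ennreal_leI G_coeff_0_ge)
  also have "\<dots> \<le> G_tail 0 x n" using G_tail_ge_sum[of "{n}" n 0 x] by simp
  finally show ?thesis .
qed

text \<open>The last factor sums the geometric series over growing balls; its rate
  \<open>1 - \<alpha> - max (- 2 * \<beta>) 0\<close> is positive for \<alpha> < 1 precisely when
  \<beta> > (\<alpha> - 1)/2.\<close>

definition CT :: real where "CT = CU * (1 / (1 - P powr (- (1 - \<alpha> - max (- 2 * \<beta>) 0))))"

lemma
  assumes "(\<alpha> - 1) / 2 < \<beta>"
  shows CT_pos: "0 < CT" and G_tail_0_le: "G_tail 0 x n \<le> ennreal (CT * U x n)"
proof -
  let ?s = "1 - \<alpha> - max (- 2 * \<beta>) 0"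
  have s: "0 < ?s" using assms alpha_less by simp
  show "0 < CT" using CU_pos P_powr_neg_less[OF s] by (simp add: CT_def)
  have Ushift: "U x (n + int i) \<le> U x n * q (int i) powr (- ?s)" for i
  proof -
    have "U x (n + int i) \<le> q (n + int i) powr (\<alpha> - 1) * (N x n powr (- 2 * \<beta>) * q (int i) powr (max (- 2 * \<beta>) 0))"
      unfolding U_def by (intro mult_left_mono N_powr_le) auto
    also have "\<dots> = U x n * (q (int i) powr (\<alpha> - 1) * q (int i) powr (max (- 2 * \<beta>) 0))"
      by (simp add: U_def q_add powr_mult)
    also have "q (int i) powr (\<alpha> - 1) * q (int i) powr (max (- 2 * \<beta>) 0) = q (int i) powr (- ?s)"
      unfolding powr_add[symmetric] by (rule arg_cong[where f = "(powr) (q (int i))"]) linarith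
    finally show ?thesis .
  qed
  have bij: "bij_betw (\<lambda>i. n + int i) UNIV {n..}"
    by (rule bij_betwI[where g = "\<lambda>k. nat (k - n)"]) auto
  have "G_tail 0 x n = (\<integral>\<^sup>+k. ennreal (G_coeff 0 x k) \<partial>count_space {n..})"
    unfolding G_tail_def by (subst nn_integral_count_space_indicator) auto
  also have "\<dots> = (\<integral>\<^sup>+i. ennreal (G_coeff 0 x (n + int i)) \<partial>count_space UNIV)"
    by (rule nn_integral_bij_count_space[OF bij, symmetric])
  also have "\<dots> = (\<Sum>i. ennreal (G_coeff 0 x (n + int i)))"
    by (rule nn_integral_count_space_nat)
  also have "\<dots> \<le> (\<Sum>i. ennreal (CU * U x n * q (int i) powr (- ?s)))"
  proof (rule suminf_le)
    fix i
    have "G_coeff 0 x (n + int i) \<le> CU * U x (n + int i)" by (rule G_coeff_0_le)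
    also have "\<dots> \<le> CU * (U x n * q (int i) powr (- ?s))"
      using CU_pos by (intro mult_left_mono Ushift) auto
    finally show "ennreal (G_coeff 0 x (n + int i)) \<le> ennreal (CU * U x n * q (int i) powr (- ?s))"
      by (intro ennreal_leI) (simp add: mult.assoc)
  qed auto
  also have "\<dots> = ennreal (CU * U x n * (1 / (1 - P powr (- ?s))))"
    by (intro suminf_ennreal_eq sums_mult sums_q s)
       (use CU_pos less_imp_le[OF U_pos[of x n]] in auto)
  finally show "G_tail 0 x n \<le> ennreal (CT * U x n)" by (simp add: CT_def mult_ac)
qed

text \<open>By the ultrametric inequality |x - y| and |y| have the same maximum with |x|, so
  \<open>N x n\<close> becomes symmetric in the two points.\<close>

lemma U_dist:
  assumes "dist x y = q n"
  shows "U x n = dist x y powr (\<alpha> - 1) / max (nrm x) (nrm y) powr (2 * \<beta>)"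
proof -
  have "max (nrm x) (dist x y) = max (nrm x) (nrm y)"
    using padic_dist_ultra[of x 0 y] padic_dist_ultra[of x y 0] padic_dist_ultra[of y 0 x]
    by (simp add: padic_norm_eq_dist dist_commute max_def split: if_splits)
  then have "N x n = max (nrm x) (nrm y)" by (simp add: N_def assms)
  then show ?thesis by (simp add: U_def assms powr_minus_divide)
qed

definition Ud :: "'p padic \<Rightarrow> 'p padic \<Rightarrow> real" where
  "Ud x y = dist x y powr (\<alpha> - 1) / max (nrm x) (nrm y) powr (2 * \<beta>)"

lemma G_0_bounds:
  assumes "(\<alpha> - 1) / 2 < \<beta>" "x \<noteq> y"
  shows "ennreal (cU * Ud x y) \<le> G 0 x y" "G 0 x y \<le> ennreal (CT * Ud x y)"
proof -
  obtain n where n: "dist x y = q n" using assms(2) by (rule dist_eq_q)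
  have "G 0 x y = G_tail 0 x n" "Ud x y = U x n" using G_eq_tail[OF n] U_dist[OF n] by (simp_all add: Ud_def)
  then show "ennreal (cU * Ud x y) \<le> G 0 x y" "G 0 x y \<le> ennreal (CT * Ud x y)"
    using G_tail_0_ge G_tail_0_le[OF assms(1)] by simp_all
qed

text \<open>At the critical exponent the powers of \<open>q k\<close> and \<open>N\<close> in
  \<open>U\<close> balance, so all terms are bounded below, and infinitely many large balls contain
  both points.\<close>

lemma G_0_critical:
  assumes "\<beta> = (\<alpha> - 1) / 2" shows "G 0 x y = \<infinity>"
proof -
  have U1: "1 \<le> U z k" for z k
  proof -
    have "q k powr (1 - \<alpha>) \<le> N z k powr (1 - \<alpha>)"
      using alpha_less by (intro powr_mono2) (auto simp: N_def)
    then have "q k powr (\<alpha> - 1) * q k powr (1 - \<alpha>) \<le> q k powr (\<alpha> - 1) * N z k powr (1 - \<alpha>)"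
      by (intro mult_left_mono) auto
    moreover have "q k powr (\<alpha> - 1) * q k powr (1 - \<alpha>) = 1" by (simp flip: powr_add)
    moreover have "- 2 * \<beta> = 1 - \<alpha>" using assms by simp
    ultimately show ?thesis unfolding U_def by metis
  qed
  have G_coeff_U: "cU \<le> G_coeff 0 z k" for z k
    using mult_left_mono[OF U1[of z k], of cU] cU_pos G_coeff_0_ge[of z k] by linarith
  have "G_tail 0 z n = \<infinity>" for z n
  proof (rule ccontr)
    assume "G_tail 0 z n \<noteq> \<infinity>"
    then obtain B where B: "0 \<le> B" "G_tail 0 z n = ennreal B" by (cases "G_tail 0 z n") auto
    obtain i :: nat where i: "B < real i * cU" using cU_pos reals_Archimedean3 by blast
    have "ennreal (real i * cU) = (\<Sum>k\<in>{n..<n + int i}. ennreal cU)"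
      using cU_pos by (simp add: ennreal_mult ennreal_of_nat_eq_real_of_nat)
    also have "\<dots> \<le> (\<Sum>k\<in>{n..<n + int i}. ennreal (G_coeff 0 z k))"
      by (intro sum_mono ennreal_leI G_coeff_U)
    also have "\<dots> \<le> G_tail 0 z n" by (rule G_tail_ge_sum) auto
    finally have "real i * cU \<le> B" using B cU_pos by (simp add: ennreal_le_iff)
    then show False using i by linarith
  qed
  then have G_tail: "G_tail 0 z n = \<infinity>" for z n .
  show ?thesis
  proof (cases "x = y")
    case False
    then obtain n where "dist x y = q n" by (rule dist_eq_q)
    then show ?thesis by (simp only: G_eq_tail G_tail)
  qed (simp add: G_diag)
qed

section \<open>The Green function of H: continuity, finiteness, comparison\<close>

lemma norm_powr_tendsto:
  "((norm_powr s :: 'p padic \<Rightarrow> ennreal) \<longlongrightarrow> norm_powr s x) (nhds x)"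
proof (cases "x = 0")
  case False
  then have pos: "0 < nrm x" using padic_norm_nonneg[of x] padic_norm_eq_0_iff[of x] by linarith
  obtain k where k: "q k < nrm x" using q_below[OF pos] by blast
  have "norm_powr s y = norm_powr s x" if "y \<in> pball x k" for y
  proof -
    have "nrm y = nrm x" using nrm_eq_on_pball[OF _ that] k by simp
    moreover have "y \<noteq> 0" using calculation pos padic_norm_eq_0_iff[of y] by auto
    ultimately show ?thesis using False by (simp add: norm_powr_def)
  qed
  then show ?thesis
    by (intro tendsto_eventually eventually_mono[OF eventually_nhds_pball[of x k]])
next
  case True
  consider "s = 0" | "0 < s" | "s < 0" by linarith
  then show ?thesis
  proof cases
    case 1
    have "norm_powr s y = 1" for y :: "'p padic"
      using 1 by (cases "y = 0") (simp_all add: norm_powr_def padic_norm_eq_0_iff)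
    then have "norm_powr s = (\<lambda>y :: 'p padic. 1)" by (rule ext)
    then show ?thesis by simp
  next
    case 2
    have eq: "norm_powr s = (\<lambda>y :: 'p padic. ennreal (dist y 0 powr s))"
      using 2 by (auto simp: norm_powr_def padic_norm_eq_dist)
    have "((\<lambda>y :: 'p padic. dist y 0) \<longlongrightarrow> dist (0 :: 'p padic) 0) (nhds 0)"
      by (intro tendsto_dist tendsto_const filterlim_ident)
    then have "((\<lambda>y :: 'p padic. dist y 0 powr s) \<longlongrightarrow> dist (0 :: 'p padic) 0 powr s) (nhds 0)"
      using 2 by (intro tendsto_powr' tendsto_const) auto
    then show ?thesis unfolding eq True by (rule tendsto_ennrealI)
  next
    case 3
    have "norm_powr s x = \<infinity>" using 3 True by (simp add: norm_powr_def)
    moreover have "((norm_powr s :: 'p padic \<Rightarrow> ennreal) \<longlongrightarrow> \<infinity>) (nhds x)"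
    proof (rule order_tendstoI)
      fix b :: ennreal assume "b < \<infinity>"
      then obtain B where B: "0 \<le> B" "b = ennreal B" by (cases b) auto
      \<comment> \<open>The exponent is negative, so small radii give large values;
        \<open>B + 1\<close> provides a positive base and a strict bound.\<close>
      obtain k where k: "q k < (B + 1) powr (1 / s)" using q_below[of "(B + 1) powr (1 / s)"] B(1) by auto
      have "((B + 1) powr (1 / s)) powr s \<le> q k powr s" using k 3 by (intro powr_mono2') auto
      then have Bk: "B < q k powr s" using 3 B(1) by (simp add: powr_powr)
      have "b < norm_powr s y" if "y \<in> pball x k" for y
      proof (cases "y = 0")
        case False
        then have "0 < nrm y" using padic_norm_nonneg[of y] padic_norm_eq_0_iff[of y] by linarith
        moreover have "nrm y \<le> q k" using that True by (simp add: mem_pball padic_norm_eq_dist dist_commute)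
        ultimately have "q k powr s \<le> nrm y powr s" using 3 by (intro powr_mono2') auto
        then have "B < nrm y powr s" using Bk by linarith
        then show ?thesis using False B by (simp add: norm_powr_def ennreal_less_iff)
      qed (use 3 B in \<open>simp add: norm_powr_def\<close>)
      then show "eventually (\<lambda>y. b < norm_powr s y) (nhds x)"
        by (intro eventually_mono[OF eventually_nhds_pball[of x k]])
    qed simp
    ultimately show ?thesis by simp
  qed
qed

lemma norm_powr_finite: "x \<noteq> 0 \<Longrightarrow> norm_powr s x = ennreal (nrm x powr s)"
  by (simp add: norm_powr_def)

lemma nrm_pos: "x \<noteq> 0 \<Longrightarrow> 0 < nrm x"
  using padic_norm_nonneg[of x] padic_norm_eq_0_iff[of x] by linarith

lemma Ud_pos: "x \<noteq> y \<Longrightarrow> 0 < Ud x y"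
proof -
  assume xy: "x \<noteq> y"
  then have "0 < max (nrm x) (nrm y)" using nrm_pos[of x] nrm_pos[of y] by (auto simp: less_max_iff_disj)
  then show ?thesis using xy by (simp add: Ud_def)
qed

definition gH :: "'p padic \<Rightarrow> 'p padic \<Rightarrow> ennreal" where
  "gH x y = norm_powr \<beta> x * G 0 x y * norm_powr \<beta> y"

text \<open>At the critical exponent \<beta> is negative, so \<open>norm_powr \<beta>\<close> never
  vanishes and \<open>gH\<close> is infinite everywhere. Its integral against the indicator of the
  unit ball then violates the finiteness required of a fundamental solution.\<close>

lemma not_critical:
  assumes "fundamental_solution_H m \<alpha> b gH"
  shows "(\<alpha> - 1) / 2 < \<beta>"
proof (rule ccontr)
  assume "\<not> (\<alpha> - 1) / 2 < \<beta>"
  then have crit: "\<beta> = (\<alpha> - 1) / 2" using beta_ge by simp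
  then have b: "\<beta> < 0" using alpha_less by simp
  have np: "norm_powr \<beta> x \<noteq> 0" for x :: "'p padic"
    using b nrm_pos[of x] by (auto simp: norm_powr_def)
  have inf: "gH x y = \<infinity>" for x y
    unfolding gH_def G_0_critical[OF crit] using np[of x] np[of y] by (simp add: ennreal_mult_eq_top_iff)
  let ?v = "\<lambda>y :: 'p padic. complex_of_real (indicator (pball 0 0) y)"
  have "ball_const 0 ?v" unfolding ball_const_def
  proof (intro allI ballI)
    fix x y :: "'p padic" assume "y \<in> pball x 0"
    then have "y \<in> pball 0 0 \<longleftrightarrow> x \<in> pball 0 0" using pball_trans pball_sym by blast
    then show "?v y = ?v x" by (simp add: indicator_def)
  qed
  moreover have "ball_supp 0 ?v" by (auto simp: ball_supp_def indicator_def)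
  ultimately have "test_function ?v" by (rule ball_const_test_function)
  then have "AE x in m. (\<integral>\<^sup>+y. gH x y * ennreal (cmod (?v y)) \<partial>m) < \<infinity>"
    using assms unfolding fundamental_solution_H_def by blast
  moreover have "(\<integral>\<^sup>+y. gH x y * ennreal (cmod (?v y)) \<partial>m) = \<infinity>" for x
  proof -
    have "(\<integral>\<^sup>+y. gH x y * ennreal (cmod (?v y)) \<partial>m) = (\<integral>\<^sup>+y. \<infinity> * indicator (pball 0 0) y \<partial>m)"
      unfolding inf by (intro nn_integral_cong) (auto simp: indicator_def)
    also have "\<dots> = \<infinity>" by (subst nn_integral_cmult_indicator) (auto simp: emeasure_m ennreal_top_mult)
    finally show ?thesis .
  qed
  ultimately have "AE x in m. False" by simp
  then have "emeasure m (space m) = 0" by (simp add: AE_iff_measurable[OF sets.top])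
  moreover have "emeasure m (pball 0 0) \<le> emeasure m (space m)"
    by (rule emeasure_space)
  ultimately show False by (simp add: emeasure_m)
qed

context
  assumes subcrit: "(\<alpha> - 1) / 2 < \<beta>"
begin

lemma G_0_pos: "G 0 x y \<noteq> 0"
proof (cases "x = y")
  case True
  then show ?thesis by (simp add: G_diag)
next
  case False
  then have "0 < cU * Ud x y" using cU_pos Ud_pos by simp
  then show ?thesis using G_0_bounds(1)[OF subcrit False] by auto
qed

lemma G_0_finite: "x \<noteq> y \<Longrightarrow> G 0 x y < \<infinity>"
  using G_0_bounds(2)[OF subcrit, of x y] by (simp add: le_less_trans)

lemma norm_powr_nz: "x \<noteq> 0 \<Longrightarrow> norm_powr s x \<noteq> 0" for x :: "'p padic"
  using nrm_pos[of x] by (simp add: norm_powr_def)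

text \<open>Multiplication on [0,\<infinity>] is discontinuous only at 0 times infinity. Away from
  (0,0) this never arises: when one point is 0 the other is not, and the kernel between them is
  finite and nonzero.\<close>

lemma continuous_gH: "continuous_on (- {(0, 0)}) (\<lambda>(x, y). gH x y)"
  unfolding continuous_on_def
proof
  fix z :: "'p padic \<times> 'p padic" assume "z \<in> - {(0, 0)}"
  then obtain x y where z: "z = (x, y)" and nz: "x \<noteq> 0 \<or> y \<noteq> 0" by (cases z) auto
  have fst: "((\<lambda>w. norm_powr \<beta> (fst w)) \<longlongrightarrow> norm_powr \<beta> x) (nhds (x, y))"
    by (rule filterlim_compose[OF norm_powr_tendsto]) (simp add: nhds_prod filterlim_fst)
  have snd: "((\<lambda>w. norm_powr \<beta> (snd w)) \<longlongrightarrow> norm_powr \<beta> y) (nhds (x, y))"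
    by (rule filterlim_compose[OF norm_powr_tendsto]) (simp add: nhds_prod filterlim_snd)
  have G: "((\<lambda>w. G 0 (fst w) (snd w)) \<longlongrightarrow> G 0 x y) (nhds (x, y))"
    using continuous_at_G_offdiag[of x y 0] continuous_at_G_diag[of 0 x]
    by (cases "x = y") (simp_all add: case_prod_beta')
  have fin: "norm_powr \<beta> w < \<infinity>" if "w \<noteq> 0" for w :: "'p padic"
    using that by (simp add: norm_powr_def)
  have c1: "\<not> ((norm_powr \<beta> x = 0 \<and> G 0 x y = \<infinity>) \<or> (norm_powr \<beta> x = \<infinity> \<and> G 0 x y = 0))"
    using nz norm_powr_nz[of x \<beta>] G_0_pos[of x y] G_0_finite[of x y] by fastforce
  have c2: "\<not> ((norm_powr \<beta> x * G 0 x y = 0 \<and> norm_powr \<beta> y = \<infinity>)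
      \<or> (norm_powr \<beta> x * G 0 x y = \<infinity> \<and> norm_powr \<beta> y = 0))"
  proof (cases "y = 0")
    case True
    then have x: "x \<noteq> 0" "x \<noteq> y" using nz by auto
    then show ?thesis using norm_powr_nz[of x \<beta>] G_0_pos[of x y] G_0_finite[of x y] fin[of x]
      by (auto simp: ennreal_mult_eq_top_iff)
  next
    case False
    then show ?thesis using norm_powr_nz[of y \<beta>] fin[of y] by auto
  qed
  have "((\<lambda>w. norm_powr \<beta> (fst w) * G 0 (fst w) (snd w) * norm_powr \<beta> (snd w)) \<longlongrightarrow> gH x y) (nhds (x, y))"
    unfolding gH_def by (rule tendsto_mult_ennreal[OF tendsto_mult_ennreal[OF fst G c1] snd c2])
  then have "((\<lambda>(x, y). gH x y) \<longlongrightarrow> gH x y) (nhds (x, y))"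
    by (simp add: gH_def case_prod_beta')
  then show "((\<lambda>(x, y). gH x y) \<longlongrightarrow> (case z of (x, y) \<Rightarrow> gH x y)) (at z within - {(0, 0)})"
    unfolding z prod.case by (rule tendsto_mono[OF at_within_le_nhds])
qed

lemma gH_finite: 
  assumes "x \<noteq> y" "\<beta> < 0 \<longrightarrow> x \<noteq> 0 \<and> y \<noteq> 0" shows "gH x y < \<infinity>"
proof -
  have "norm_powr \<beta> w < \<infinity>" if "\<beta> < 0 \<longrightarrow> w \<noteq> 0" for w :: "'p padic"
    using that by (auto simp: norm_powr_def)
  then show ?thesis unfolding gH_def using assms G_0_finite[OF assms(1)]
    by (simp add: ennreal_mult_less_top)
qed

lemma gH_value:
  assumes "x \<noteq> 0" "y \<noteq> 0" "x \<noteq> y"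
  obtains t where "cU \<le> t" "t \<le> CT" "gH x y = ennreal (t * (nrm x powr \<beta> * nrm y powr \<beta> * Ud x y))"
proof -
  obtain g where g: "0 \<le> g" "G 0 x y = ennreal g"
    using G_0_finite[OF assms(3)] by (cases "G 0 x y") auto
  have pos: "0 < Ud x y" using Ud_pos assms(3) by simp
  have "cU * Ud x y \<le> g" "g \<le> CT * Ud x y"
    using G_0_bounds[OF subcrit assms(3)] g CT_pos[OF subcrit] pos by (simp_all add: ennreal_le_iff)
  then have "cU \<le> g / Ud x y" "g / Ud x y \<le> CT" using pos by (simp_all add: pos_le_divide_eq pos_divide_le_eq)
  moreover have "gH x y = ennreal (g / Ud x y * (nrm x powr \<beta> * nrm y powr \<beta> * Ud x y))"
    unfolding gH_def g(2) norm_powr_finite[OF assms(1)] norm_powr_finite[OF assms(2)]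
    using g(1) pos by (simp add: ennreal_mult[symmetric] mult_ac)
  ultimately show thesis by (rule that)
qed

text \<open>Common to both forms of the estimate: \<open>d\<close> is the divisor with real value
  \<open>s\<close>, \<open>r\<close> is the right-hand side, and \<open>K\<close> absorbs the
  constant relating them.\<close>

lemma comparable_gH:
  assumes f: "\<And>x y. x \<noteq> 0 \<Longrightarrow> y \<noteq> 0 \<Longrightarrow> x \<noteq> y \<Longrightarrow>
      0 < r x y \<and> d x y = ennreal (s x y) \<and> 0 < s x y \<and> nrm x powr \<beta> * nrm y powr \<beta> * Ud x y = K * (s x y * r x y)"
    and K: "0 < K"
  shows "comparable_on {(x, y). x \<noteq> 0 \<and> y \<noteq> 0 \<and> x \<noteq> y} (\<lambda>(x, y). gH x y / d x y) (\<lambda>(x, y). ennreal (r x y))"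
  unfolding comparable_on_def
proof (rule exI[of _ "cU * K"], rule exI[of _ "CT * K"], intro conjI ballI)
  show "0 < cU * K" "0 < CT * K" using cU_pos CT_pos[OF subcrit] K by simp_all
  fix z :: "'p padic \<times> 'p padic" assume "z \<in> {(x, y). x \<noteq> 0 \<and> y \<noteq> 0 \<and> x \<noteq> y}"
  then obtain x y where z: "z = (x, y)" and xy: "x \<noteq> 0" "y \<noteq> 0" "x \<noteq> y" by auto
  obtain t where t: "cU \<le> t" "t \<le> CT" "gH x y = ennreal (t * (nrm x powr \<beta> * nrm y powr \<beta> * Ud x y))"
    using gH_value[OF xy] by blast
  have t0: "0 \<le> t" using t(1) cU_pos by linarith
  note fxy = f[OF xy]
  have "(case z of (x, y) \<Rightarrow> gH x y / d x y) / (case z of (x, y) \<Rightarrow> ennreal (r x y))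
      = ennreal (t * (K * (s x y * r x y))) / ennreal (s x y) / ennreal (r x y)"
    using t(3) fxy by (simp add: z)
  also have "\<dots> = ennreal (t * (K * (s x y * r x y)) / s x y / r x y)"
    using t0 K fxy by (simp add: divide_ennreal)
  also have "t * (K * (s x y * r x y)) / s x y / r x y = t * K" using fxy by (simp add: field_simps)
  finally have eq: "(case z of (x, y) \<Rightarrow> gH x y / d x y) / (case z of (x, y) \<Rightarrow> ennreal (r x y)) = ennreal (t * K)" .
  show "ennreal (cU * K) \<le> (case z of (x, y) \<Rightarrow> gH x y / d x y) / (case z of (x, y) \<Rightarrow> ennreal (r x y))"
    "(case z of (x, y) \<Rightarrow> gH x y / d x y) / (case z of (x, y) \<Rightarrow> ennreal (r x y)) \<le> ennreal (CT * K)"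
    unfolding eq using t K by (auto intro!: ennreal_leI)
qed

lemma comparable_gH_green_L:
  "comparable_on {(x, y). x \<noteq> 0 \<and> y \<noteq> 0 \<and> x \<noteq> y} (\<lambda>(x, y). gH x y / green_L \<alpha> x y)
    (\<lambda>(x, y). ennreal (min (nrm x / nrm y) (nrm y / nrm x) powr \<beta>))"
proof -
  let ?\<Gamma> = "padic_Gamma CARD('p) \<alpha>"
  have "P powr (\<alpha> - 1) < 1" "P powr (- \<alpha>) < 1"
    using P_powr_neg_less[of "1 - \<alpha>"] P_powr_neg_less[of \<alpha>] alpha_pos alpha_less by simp_all
  then have Gam: "0 < ?\<Gamma>" by (simp add: padic_Gamma_def P_def)
  show ?thesis
  proof (rule comparable_gH[where K = ?\<Gamma> and d = "green_L \<alpha>"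
        and s = "\<lambda>x y. 1 / ?\<Gamma> * nrm (x - y) powr (\<alpha> - 1)"
        and r = "\<lambda>x y. min (nrm x / nrm y) (nrm y / nrm x) powr \<beta>", OF _ Gam])
  fix x y :: "'p padic" assume xy: "x \<noteq> 0" "y \<noteq> 0" "x \<noteq> y"
  have pos: "0 < nrm x" "0 < nrm y" "0 < nrm (x - y)" using nrm_pos xy by auto
  \<comment> \<open>The larger norm cancels once against the denominator, leaving the power of
    smaller over larger norm.\<close>
  have eq: "nrm x powr \<beta> * nrm y powr \<beta> / max (nrm x) (nrm y) powr (2 * \<beta>) = min (nrm x / nrm y) (nrm y / nrm x) powr \<beta>"
  proof (cases "nrm x \<le> nrm y")
    case True
    then have "nrm x / nrm y \<le> nrm y / nrm x" using pos by (simp add: frac_le)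
    moreover have "nrm y powr (2 * \<beta>) = nrm y powr \<beta> * nrm y powr \<beta>" by (simp flip: powr_add)
    ultimately show ?thesis using True pos by (simp add: max_def min_def powr_divide)
  next
    case False
    then have "nrm y / nrm x \<le> nrm x / nrm y" using pos by (simp add: frac_le)
    moreover have "nrm x powr (2 * \<beta>) = nrm x powr \<beta> * nrm x powr \<beta>" by (simp flip: powr_add)
    ultimately show ?thesis using False pos by (auto simp: max_def min_def powr_divide)
  qed
  have "green_L \<alpha> x y = ennreal (1 / ?\<Gamma> * nrm (x - y) powr (\<alpha> - 1))"
    using xy Gam by (simp add: green_L_def norm_powr_def ennreal_mult[symmetric] del: times_divide_eq_left)
  moreover have "nrm x powr \<beta> * nrm y powr \<beta> * Ud x y
      = ?\<Gamma> * ((1 / ?\<Gamma> * nrm (x - y) powr (\<alpha> - 1)) * min (nrm x / nrm y) (nrm y / nrm x) powr \<beta>)"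
    unfolding eq[symmetric] Ud_def dist_padic_def using Gam by simp
  ultimately show "0 < min (nrm x / nrm y) (nrm y / nrm x) powr \<beta>
      \<and> green_L \<alpha> x y = ennreal (1 / ?\<Gamma> * nrm (x - y) powr (\<alpha> - 1))
      \<and> 0 < 1 / ?\<Gamma> * nrm (x - y) powr (\<alpha> - 1)
      \<and> nrm x powr \<beta> * nrm y powr \<beta> * Ud x y
        = ?\<Gamma> * ((1 / ?\<Gamma> * nrm (x - y) powr (\<alpha> - 1)) * min (nrm x / nrm y) (nrm y / nrm x) powr \<beta>)"
    using pos Gam by (auto simp: min_def)
  qed
qed

lemma comparable_gH_explicit:
  "comparable_on {(x, y). x \<noteq> 0 \<and> y \<noteq> 0 \<and> x \<noteq> y} (\<lambda>(x, y). gH x y)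
    (\<lambda>(x, y). ennreal (nrm x powr \<beta> * nrm (x - y) powr (\<alpha> - 1)
      * nrm y powr \<beta> / max (nrm x) (nrm y) powr (2 * \<beta>)))"
proof -
  have "comparable_on {(x, y). x \<noteq> 0 \<and> y \<noteq> 0 \<and> x \<noteq> y} (\<lambda>(x, y). gH x y / (\<lambda>_ _. 1) x y)
    (\<lambda>(x, y). ennreal (nrm x powr \<beta> * nrm (x - y) powr (\<alpha> - 1)
      * nrm y powr \<beta> / max (nrm x) (nrm y) powr (2 * \<beta>)))"
  proof (rule comparable_gH[where K = 1 and s = "\<lambda>_ _. 1"])
    fix x y :: "'p padic" assume xy: "x \<noteq> 0" "y \<noteq> 0" "x \<noteq> y"
    have "0 < nrm x" "0 < nrm y" "0 < nrm (x - y)" using nrm_pos xy by auto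
    then show "0 < nrm x powr \<beta> * nrm (x - y) powr (\<alpha> - 1) * nrm y powr \<beta> / max (nrm x) (nrm y) powr (2 * \<beta>)
      \<and> 1 = ennreal 1 \<and> (0 :: real) < 1
      \<and> nrm x powr \<beta> * nrm y powr \<beta> * Ud x y
        = 1 * (1 * (nrm x powr \<beta> * nrm (x - y) powr (\<alpha> - 1) * nrm y powr \<beta> / max (nrm x) (nrm y) powr (2 * \<beta>)))"
      by (auto simp: Ud_def dist_padic_def max_def)
  qed simp
  moreover have "gH x y / 1 = gH x y" for x y
    by (simp add: divide_ennreal_def)
  ultimately show ?thesis by simp
qed

end

end

theorem corollary4p7:
  fixes m :: "'p::prime_card padic measure"
    and \<alpha> \<beta> b :: real
    and g_H :: "'p padic \<Rightarrow> 'p padic \<Rightarrow> ennreal"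
  assumes "haar_measure m"
    and "0 < \<alpha>" "\<alpha> < 1"
    and "(\<alpha> - 1) / 2 \<le> \<beta>" "\<beta> < \<alpha>"
    and "b = - padic_Gamma CARD('p) (\<beta> + 1) / padic_Gamma CARD('p) (\<beta> + 1 - \<alpha>)"
    and "green_function_H m \<alpha> \<beta> b g_H"
  shows "continuous_on (- {(0, 0)}) (\<lambda>(x, y). g_H x y)
    \<and> (\<forall>x y. x \<noteq> y \<and> (\<beta> < 0 \<longrightarrow> x \<noteq> 0 \<and> y \<noteq> 0) \<longrightarrow> g_H x y < \<infinity>)
    \<and> comparable_on {(x, y). x \<noteq> 0 \<and> y \<noteq> 0 \<and> x \<noteq> y}
        (\<lambda>(x, y). g_H x y)
        (\<lambda>(x, y). ennreal (padic_norm x powr \<beta> * padic_norm (x - y) powr (\<alpha> - 1)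
           * padic_norm y powr \<beta> / max (padic_norm x) (padic_norm y) powr (2 * \<beta>)))
    \<and> comparable_on {(x, y). x \<noteq> 0 \<and> y \<noteq> 0 \<and> x \<noteq> y}
        (\<lambda>(x, y). g_H x y / green_L \<alpha> x y)
        (\<lambda>(x, y). ennreal (min (padic_norm x / padic_norm y) (padic_norm y / padic_norm x)
           powr \<beta>))"
proof -
  interpret hweight m \<alpha> \<beta>
    using assms(1-5) by unfold_locales
  have g: "g_H = gH"
    using assms(7) by (intro ext) (simp add: green_function_H_def green_calL_eq gH_def)
  have "fundamental_solution_H m \<alpha> b gH"
    using assms(7) unfolding green_function_H_def g by (rule conjunct2)
  then have sub: "(\<alpha> - 1) / 2 < \<beta>" by (rule not_critical)
  show ?thesis
    unfolding g
    by (intro conjI allI impI continuous_gH[OF sub] comparable_gH_explicit[OF sub]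
        comparable_gH_green_L[OF sub] gH_finite[OF sub]) auto
qed

end
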